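(* Let $\mathcal H=\bigoplus_{m\ge0}\mathcal H_m$ be a graded connected Hopf algebra over $\mathbb R$ with each $\mathcal H_m$ finite-dimensional, and let $r\ge1$, $n\ge2r$. (i) The distinct eigenvalues of $\mathrm{TaB}r\mathrm{2R}_n$ are $\beta_j=\frac{j(j-1)\cdots(j-2r+1)}{n(n-1)\cdots(n-2r+1)}$ with $j\in\{0\}\cup[2r,n-2]\cup\{n\}$. For $j\neq0$ the multiplicity of $\beta_j$ is the coefficient of $x^{n-j}y^j$ in $\left(\frac{1-x}{1-y}\right)^{\dim\mathcal H_1}\sum_m\dim\mathcal H_mx^m$; the multiplicity of $\beta_0$ is the sum of the coefficients of $x^n,x^{n-1}y,\dots,x^{n-2r+1}y^{2r-1}$ in that series. (ii) Let $p\in\mathcal H_{n-j}$ satisfy $\Delta_{1,n-j-1}(p)=\Delta_{n-j-1,1}(p)=0$ and let $c_1,\dots,c_j\in\mathcal H_1$. If $j<2r$ then $\sum_{\sigma\in\mathfrak S_j}c_{\sigma(1)}\cdots c_{\sigma(j)}p$ is a $0$-eigenvector of $\mathrm{TaB}r\mathrm{2R}_n$; if $j\ge2r$ then $\sum_{i=r}^{j-r}\sum_{\sigma\in\mathfrak S_j}\binom{j-r}{i}\binom{j-r}{i-r}c_{\sigma(1)}\cdots c_{\sigma(i)}\,p\,c_{\sigma(i+1)}\cdots c_{\sigma(j)}$ is a $\beta_j$-eigenvector of $\mathrm{TaB}r\mathrm{2R}_n$. (iii) Let $\mathcal P=\mathcal P_1\sqcup\mathcal P_{>1}$ be a graded basis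 of the primitive subspace of $\mathcal H$ ($\mathcal P_1$ the degree-1 elements). For $j<2r$ let $\mathcal E_j$ be the set of elements $\big(\sum_{\sigma\in\mathfrak S_j}c_{\sigma(1)}\cdots c_{\sigma(j)}\big)\big(\sum_{\tau\in\mathfrak S_{k-j}}p_{\tau(1)}\cdots p_{\tau(k-j)}\big)$, and for $j\ge2r$ the set of elements $\sum_{i=r}^{j-r}\sum_{\sigma\in\mathfrak S_j}\binom{j-r}i\binom{j-r}{i-r}c_{\sigma(1)}\cdots c_{\sigma(i)}\big(\sum_{\tau\in\mathfrak S_{k-j}}p_{\tau(1)}\cdots p_{\tau(k-j)}\big)c_{\sigma(i+1)}\cdots c_{\sigma(j)}$, in both cases over all multisets $\{c_1,\dots,c_j\}$ of $\mathcal P_1$ and all multisets $\{p_1,\dots,p_{k-j}\}$ of $\mathcal P_{>1}$ with $\sum\deg p_i=n-j$. Then $\bigsqcup_{j=0}^{2r-1}\mathcal E_j$ consists of linearly independent $0$-eigenvectors of $\mathrm{TaB}r\mathrm{2R}_n$, and for $j>2r$, $\mathcal E_j$ consists of linearly independent $\beta_j$-eigenvectors of $\mathrm{TaB}r\mathrm{2R}_n$. (iv) If $\mathcal H$ is cocommutative, then $\bigsqcup_{j=0}^{n-2}\mathcal E_j\sqcup\mathcal E_n$ is an eigenbasis of $\mathcal H_n$ for $\mathrm{TaB}r\mathrm{2R}_n$.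
   Context: For a weak-composition $D=(d_1,\dots,d_l)$ of $n$, $\Delta_D$ is the iterated coproduct $(\Delta\otimes\mathrm{id}^{\otimes(l-2)})\circ\cdots\circ\Delta$ projected to $\mathcal H_{d_1}\otimes\cdots\otimes\mathcal H_{d_l}$, and $m\Delta_D$ is $\Delta_D$ followed by multiplication. $1^r$ denotes $r$ consecutive parts equal to $1$. $\mathrm{TaB}r\mathrm{2R}_n:=\frac{1}{n(n-1)\cdots(n-2r+1)}m\Delta_{1^r,n-2r,1^r}$. An element $p$ is primitive if $\Delta(p)=1\otimes p+p\otimes1$.
   Formalization: In (i) a listed β_j is claimed to be an eigenvalue exactly when its stated (algebraic) multiplicity is nonzero (for polynomials in one degree-1 primitive, β_0 has multiplicity 0); in (ii) "eigenvector" means the eigen-equation, zero allowed since p or c_i may be 0. *)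

theory Defs
  imports
    Complex_Main
    "HOL-Library.Poly_Mapping"
    "HOL-Library.Multiset"
    "HOL-Library.Disjoint_Sets"
    "HOL-Combinatorics.Permutations"
    "HOL-Computational_Algebra.Formal_Power_Series"
    "Jordan_Normal_Form.Char_Poly"
begin

section \<open>Tensor powers of a real vector space\<close>

instantiation poly_mapping :: (type, real_vector) real_vector
begin

lift_definition scaleR_poly_mapping :: "real \<Rightarrow> ('a \<Rightarrow>\<^sub>0 'b) \<Rightarrow> ('a \<Rightarrow>\<^sub>0 'b)"
  is "\<lambda>c f k. c *\<^sub>R f k"
  by (rule finite_subset[rotated]) auto

instance
  by standard (transfer; simp add: fun_eq_iff scaleR_add_right scaleR_add_left)+

end

definition multilinear :: "('a::real_vector list \<Rightarrow> 'b::real_vector) \<Rightarrow> bool" where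
  "multilinear f \<longleftrightarrow> (\<forall>xs ys. linear (\<lambda>x. f (xs @ x # ys)))"

definition tensor_relations :: "('a::real_vector list \<Rightarrow>\<^sub>0 real) set" where
  "tensor_relations = span
     ({Poly_Mapping.single (xs @ (x + y) # ys) 1 - Poly_Mapping.single (xs @ x # ys) 1
         - Poly_Mapping.single (xs @ y # ys) 1 | xs ys x y. True}
      \<union> {Poly_Mapping.single (xs @ (c *\<^sub>R x) # ys) 1 - c *\<^sub>R Poly_Mapping.single (xs @ x # ys) 1
         | xs ys c x. True})"

text \<open>
  The relations preserve the length of lists, so the quotient below is the direct sum of all tensor
  powers of \<open>'a\<close>; the \<open>k\<close>-th tensor power is the span of the pure tensors on lists of length \<open>k\<close>.
  Having all tensor powers in one type makes iterated coproducts with a variable number of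
  tensor factors expressible.
\<close>

quotient_type (overloaded) 'a tensor = "'a::real_vector list \<Rightarrow>\<^sub>0 real" /
  "\<lambda>s t. s - t \<in> tensor_relations"
proof (rule equivpI)
  show "reflp (\<lambda>s t :: 'a list \<Rightarrow>\<^sub>0 real. s - t \<in> tensor_relations)"
    by (simp add: reflp_def tensor_relations_def span_zero)
  show "symp (\<lambda>s t :: 'a list \<Rightarrow>\<^sub>0 real. s - t \<in> tensor_relations)"
    unfolding symp_def tensor_relations_def using span_neg by fastforce
  show "transp (\<lambda>s t :: 'a list \<Rightarrow>\<^sub>0 real. s - t \<in> tensor_relations)"
    unfolding transp_def tensor_relations_def using span_add by fastforce
qed

instantiation tensor :: (real_vector) real_vector
begin

lift_definition zero_tensor :: "'a tensor" is 0 .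

lift_definition plus_tensor :: "'a tensor \<Rightarrow> 'a tensor \<Rightarrow> 'a tensor" is "(+)"
  unfolding tensor_relations_def by (simp only: add_diff_add span_add)

lift_definition uminus_tensor :: "'a tensor \<Rightarrow> 'a tensor" is uminus
  unfolding tensor_relations_def by (simp only: minus_diff_minus span_neg)

lift_definition minus_tensor :: "'a tensor \<Rightarrow> 'a tensor \<Rightarrow> 'a tensor" is "(-)"
proof -
  fix s s' t t' :: "'a list \<Rightarrow>\<^sub>0 real"
  assume "s - s' \<in> tensor_relations" "t - t' \<in> tensor_relations"
  then have "(s - s') - (t - t') \<in> tensor_relations"
    unfolding tensor_relations_def by (rule span_diff)
  then show "(s - t) - (s' - t') \<in> tensor_relations"
    by (simp add: algebra_simps)
qed

lift_definition scaleR_tensor :: "real \<Rightarrow> 'a tensor \<Rightarrow> 'a tensor" is "scaleR"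
  unfolding tensor_relations_def by (simp only: scaleR_diff_right[symmetric] span_scale)

instance
proof
  fix a b c :: "'a tensor" and x y :: real
  show "a + b + c = a + (b + c)" "a + b = b + a" "0 + a = a" "- a + a = 0" "a - b = a + - b"
    "x *\<^sub>R (a + b) = x *\<^sub>R a + x *\<^sub>R b" "(x + y) *\<^sub>R a = x *\<^sub>R a + y *\<^sub>R a"
    "x *\<^sub>R y *\<^sub>R a = (x * y) *\<^sub>R a" "1 *\<^sub>R a = a"
    by (transfer; simp add: tensor_relations_def span_zero add_ac scaleR_add_right scaleR_add_left)+
qed

end

lift_definition tens :: "'a::real_vector list \<Rightarrow> 'a tensor" is "\<lambda>xs. Poly_Mapping.single xs 1" .

lemma multilinear_tens: "multilinear tens"
  unfolding multilinear_def
proof (intro allI linearI)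
  fix xs ys :: "'a list" and x y :: 'a and c :: real
  show "tens (xs @ (x + y) # ys) = tens (xs @ x # ys) + tens (xs @ y # ys)"
  proof transfer
    fix xs ys :: "'a list" and x y :: 'a
    show "Poly_Mapping.single (xs @ (x + y) # ys) 1 -
       (Poly_Mapping.single (xs @ x # ys) 1 + Poly_Mapping.single (xs @ y # ys) 1)
      \<in> tensor_relations"
      unfolding tensor_relations_def diff_diff_eq[symmetric] by (intro span_base UnI1) blast
  qed
  show "tens (xs @ (c *\<^sub>R x) # ys) = c *\<^sub>R tens (xs @ x # ys)"
  proof transfer
    fix xs ys :: "'a list" and x :: 'a and c :: real
    show "Poly_Mapping.single (xs @ (c *\<^sub>R x) # ys) 1 - c *\<^sub>R Poly_Mapping.single (xs @ x # ys) 1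
      \<in> tensor_relations"
      unfolding tensor_relations_def by (intro span_base UnI2) blast
  qed
qed

lemma span_tens: "span (range tens) = UNIV"
proof -
  have single: "Poly_Mapping.single k (c::real) = c *\<^sub>R Poly_Mapping.single k 1" for k :: "'a list" and c
    by (transfer; auto simp: when_def fun_eq_iff)
  have "abs_tensor s \<in> span (range tens)" for s :: "'a list \<Rightarrow>\<^sub>0 real"
  proof (induction s rule: update_induct)
    case const
    then show ?case by (simp add: zero_tensor.abs_eq[symmetric] span_zero)
  next
    case (update f k v)
    have "Poly_Mapping.update k v f = f + v *\<^sub>R Poly_Mapping.single k 1"
      unfolding single[of k v, symmetric] using update(1)
      by (intro poly_mapping_eqI) (auto simp: lookup_add lookup_single lookup_update in_keys_iff when_def)
    then have "abs_tensor (Poly_Mapping.update k v f) = abs_tensor f + v *\<^sub>R tens k"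
      by (simp add: plus_tensor.abs_eq scaleR_tensor.abs_eq tens.abs_eq)
    with update show ?case by (simp add: span_add span_base span_scale)
  qed
  then have "t \<in> span (range tens)" for t :: "'a tensor"
    by (induction t rule: tensor.abs_induct)
  then show ?thesis by blast
qed

text \<open>The linear map induced by a multilinear one (unspecified if the argument is not multilinear).\<close>

definition tensor_lift :: "('a::real_vector list \<Rightarrow> 'b::real_vector) \<Rightarrow> 'a tensor \<Rightarrow> 'b" where
  "tensor_lift f = (THE F. linear F \<and> (\<forall>xs. F (tens xs) = f xs))"

lemma
  assumes "multilinear f"
  shows linear_tensor_lift: "linear (tensor_lift f)"
    and tensor_lift_tens: "tensor_lift f (tens xs) = f xs"
proof -
  define F0 where "F0 = (\<lambda>s. \<Sum>xs\<in>Poly_Mapping.keys s. Poly_Mapping.lookup s xs *\<^sub>R f xs)"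
  have F0: "F0 s = (\<Sum>xs\<in>A. Poly_Mapping.lookup s xs *\<^sub>R f xs)" if "finite A" "Poly_Mapping.keys s \<subseteq> A" for s A
    unfolding F0_def using that by (intro sum.mono_neutral_left) (auto simp: in_keys_iff)
  have "linear F0"
  proof (rule linearI)
    fix s t :: "'a list \<Rightarrow>\<^sub>0 real" and c :: real
    have "Poly_Mapping.keys (s + t) \<subseteq> Poly_Mapping.keys s \<union> Poly_Mapping.keys t" by (rule keys_add)
    then show "F0 (s + t) = F0 s + F0 t"
      by (simp add: F0[of "Poly_Mapping.keys s \<union> Poly_Mapping.keys t"] lookup_add scaleR_add_left sum.distrib)
    have "Poly_Mapping.lookup (c *\<^sub>R s) xs = c * Poly_Mapping.lookup s xs" for xs
      by transfer simp
    moreover from this have "Poly_Mapping.keys (c *\<^sub>R s) \<subseteq> Poly_Mapping.keys s"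
      by (auto simp: in_keys_iff)
    ultimately show "F0 (c *\<^sub>R s) = c *\<^sub>R F0 s"
      by (simp add: F0[of "Poly_Mapping.keys s"] scaleR_sum_right)
  qed
  then interpret F0: linear F0 .
  have single: "F0 (Poly_Mapping.single ys 1) = f ys" for ys
    by (simp add: F0_def)
  have "F0 s = 0" if "s \<in> tensor_relations" for s
    using that unfolding tensor_relations_def
  proof (induction rule: span_induct)
    case base
    show ?case by (simp add: subspace_def F0.add F0.scale)
  next
    case (step s)
    have lin: "linear (\<lambda>x. f (xs @ x # ys))" for xs ys
      using assms by (simp add: multilinear_def)
    from step show ?case
      by (auto simp: F0.diff F0.scale single linear_add[OF lin] linear_scale[OF lin])
  qed
  then have resp: "F0 s = F0 t" if "s - t \<in> tensor_relations" for s t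
    using that F0.diff[of s t] by simp
  define F where "F t = F0 (rep_tensor t)" for t
  have abs: "F (abs_tensor s) = F0 s" for s
  proof -
    have "abs_tensor (rep_tensor (abs_tensor s)) = abs_tensor s"
      by (rule Quotient3_abs_rep[OF Quotient3_tensor])
    then have "rep_tensor (abs_tensor s) - s \<in> tensor_relations"
      by (simp add: tensor.abs_eq_iff)
    then show ?thesis by (simp add: F_def resp)
  qed
  have "linear F"
  proof (rule linearI)
    fix s t :: "'a tensor" and c :: real
    show "F (s + t) = F s + F t"
      by (induction s rule: tensor.abs_induct; induction t rule: tensor.abs_induct)
        (simp add: plus_tensor.abs_eq abs F0.add)
    show "F (c *\<^sub>R s) = c *\<^sub>R F s"
      by (induction s rule: tensor.abs_induct) (simp add: scaleR_tensor.abs_eq abs F0.scale)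
  qed
  have val: "F (tens xs) = f xs" for xs
    by (simp add: tens.abs_eq abs single)
  have "G = F" if G: "linear G" "\<forall>xs. G (tens xs) = f xs" for G
  proof
    fix t :: "'a tensor"
    have "t \<in> span (range tens)" by (simp add: span_tens)
    moreover have "G t = F t" if "t \<in> range tens" for t
      using that G(2) val by auto
    ultimately show "G t = F t"
      by (rule linear_eq_on[OF G(1) \<open>linear F\<close>])
  qed
  with \<open>linear F\<close> val have "tensor_lift f = F"
    unfolding tensor_lift_def by (intro the_equality) blast+
  with \<open>linear F\<close> val show "linear (tensor_lift f)" "tensor_lift f (tens xs) = f xs"
    by simp_all
qed

definition tensor_space :: "'a::real_vector set list \<Rightarrow> 'a tensor set" where
  "tensor_space Vs = span {tens xs | xs. list_all2 (\<in>) xs Vs}"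

definition tensor_append :: "'a::real_vector tensor \<Rightarrow> 'a tensor \<Rightarrow> 'a tensor" where
  "tensor_append s t = tensor_lift (\<lambda>xs. tensor_lift (\<lambda>ys. tens (xs @ ys)) t) s"

definition tensor_map :: "('a::real_vector \<Rightarrow> 'a) list \<Rightarrow> 'a tensor \<Rightarrow> 'a tensor" where
  "tensor_map fs = tensor_lift
     (\<lambda>xs. if length xs = length fs then tens (map2 (\<lambda>f x. f x) fs xs) else 0)"

text \<open>On the tensor square this is the flip \<open>x \<otimes> y \<mapsto> y \<otimes> x\<close>.\<close>

definition tensor_rev :: "'a::real_vector tensor \<Rightarrow> 'a tensor" where
  "tensor_rev = tensor_lift (\<lambda>xs. tens (rev xs))"

text \<open>The factorwise product \<open>(a \<otimes> b)(c \<otimes> d) = ac \<otimes> bd\<close> of the algebra structure on a tensor power.\<close>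

definition tensor_times :: "'a::real_algebra_1 tensor \<Rightarrow> 'a tensor \<Rightarrow> 'a tensor" where
  "tensor_times s t = tensor_lift (\<lambda>xs. tensor_lift
     (\<lambda>ys. if length ys = length xs then tens (map2 (*) xs ys) else 0) t) s"

text \<open>The iterated multiplication \<open>m\<close>.\<close>

definition tensor_mult :: "'a::real_algebra_1 tensor \<Rightarrow> 'a" where
  "tensor_mult = tensor_lift prod_list"

text \<open>\<open>comult_first \<Delta>\<close> is \<open>\<Delta> \<otimes> id \<otimes> \<dots> \<otimes> id\<close> on every tensor power; \<open>comult_second \<Delta>\<close> is
  \<open>id \<otimes> \<Delta>\<close> on the tensor square.\<close>

definition comult_first :: "('a::real_vector \<Rightarrow> 'a tensor) \<Rightarrow> 'a tensor \<Rightarrow> 'a tensor" where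
  "comult_first \<Delta> = tensor_lift
     (\<lambda>xs. case xs of [] \<Rightarrow> 0 | x # ys \<Rightarrow> tensor_append (\<Delta> x) (tens ys))"

definition comult_second :: "('a::real_vector \<Rightarrow> 'a tensor) \<Rightarrow> 'a tensor \<Rightarrow> 'a tensor" where
  "comult_second \<Delta> = tensor_lift
     (\<lambda>xs. case xs of [x, y] \<Rightarrow> tensor_append (tens [x]) (\<Delta> y) | _ \<Rightarrow> 0)"

subsection \<open>Values on pure tensors\<close>

lemma multilinear_compose:
  assumes "multilinear f" "linear g"
  shows "multilinear (\<lambda>xs. g (f xs))"
  using assms linear_compose[OF _ assms(2)] unfolding multilinear_def o_def by blast

lemma multilinear_tensor_lift:
  assumes "\<And>xs. multilinear (f xs)" "\<And>ys. multilinear (\<lambda>xs. f xs ys)"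
  shows "multilinear (\<lambda>xs. tensor_lift (f xs) t)"
proof -
  have "t \<in> span (range tens)" by (simp add: span_tens)
  then show ?thesis
  proof (induction rule: span_induct)
    case base
    show ?case
      unfolding subspace_def
      using linear_tensor_lift[OF assms(1)]
      by (auto simp: multilinear_def linear_0 linear_add linear_scale
          intro: linear_compose_add linear_compose_scale_right real_vector.linear_zero)
  next
    case (step t)
    then show ?case
      using assms(2) by (auto simp: tensor_lift_tens[OF assms(1)])
  qed
qed

lemma linear_tens: "linear (\<lambda>x. tens (xs @ x # ys))"
  using multilinear_tens unfolding multilinear_def by blast

lemma multilinear_append:
  fixes xs ys :: "'a::real_vector list"
  shows "multilinear (\<lambda>ys. tens (xs @ ys))" "multilinear (\<lambda>xs. tens (xs @ ys))"
  unfolding multilinear_def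
  using linear_tens[of "xs @ _"] linear_tens[of _ "_ @ ys"] by simp_all

lemma tensor_append_tens: "tensor_append (tens xs) (tens ys) = tens (xs @ ys)"
  unfolding tensor_append_def
  by (simp add: tensor_lift_tens multilinear_tensor_lift multilinear_append)

lemma linear_tensor_append_left: "linear (\<lambda>s. tensor_append s t)"
  unfolding tensor_append_def
  by (intro linear_tensor_lift multilinear_tensor_lift multilinear_append)

lemma linear_tensor_append_tens: "linear (tensor_append (tens xs))"
  using linear_tensor_lift[OF multilinear_append(1)[of xs]]
  by (simp add: tensor_append_def[abs_def] tensor_lift_tens multilinear_tensor_lift multilinear_append)

lemma multilinear_map2:
  assumes "\<And>k. k \<in> set ks \<Longrightarrow> linear (g k)"
  shows "multilinear (\<lambda>xs. if length xs = length ks then tens (map2 g ks xs) else 0)"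
  unfolding multilinear_def
proof (intro allI)
  fix xs ys
  show "linear (\<lambda>x. if length (xs @ x # ys) = length ks then tens (map2 g ks (xs @ x # ys)) else 0)"
  proof (cases "length xs + Suc (length ys) = length ks")
    case True
    define us k vs where "us = take (length xs) ks" and "k = ks ! length xs"
      and "vs = drop (Suc (length xs)) ks"
    have ks: "ks = us @ k # vs" and len: "length us = length xs"
      using True by (simp_all add: us_def k_def vs_def id_take_nth_drop[symmetric])
    have "linear (g k)" using assms ks by simp
    from linear_compose[OF this linear_tens[of "map2 g us xs" "map2 g vs ys"]]
    show ?thesis using True len by (simp add: ks o_def)
  qed (simp add: real_vector.linear_zero)
qed

lemma tensor_map_tens:
  assumes "\<And>f. f \<in> set fs \<Longrightarrow> linear f"
  shows "tensor_map fs (tens xs) = (if length xs = length fs then tens (map2 (\<lambda>f x. f x) fs xs) else 0)"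
  unfolding tensor_map_def by (simp add: tensor_lift_tens multilinear_map2 assms)

lemma tensor_rev_tens: "tensor_rev (tens xs) = tens (rev xs)"
  unfolding tensor_rev_def
  by (rule tensor_lift_tens) (simp add: multilinear_def linear_tens)

lemma tensor_times_tens:
  "tensor_times (tens xs) (tens ys) = (if length ys = length xs then tens (map2 (*) xs ys) else 0)"
proof -
  have 1: "multilinear (\<lambda>ys. if length ys = length xs then tens (map2 (*) xs ys) else 0)" for xs :: "'a list"
    by (rule multilinear_map2) (simp add: linear_iff algebra_simps)
  have flip: "map2 (*) xs ys = map2 (\<lambda>y x. x * y) ys xs" for xs ys :: "'a list"
    by (subst zip_commute) (simp add: case_prod_unfold)
  have "multilinear (\<lambda>xs. if length xs = length ys then tens (map2 (\<lambda>y x. x * y) ys xs) else 0)"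
    for ys :: "'a list"
    by (rule multilinear_map2) (simp add: linear_iff algebra_simps)
  then have 2: "multilinear (\<lambda>xs. if length ys = length xs then tens (map2 (*) xs ys) else 0)"
    for ys :: "'a list"
    by (simp only: flip eq_commute[of "length ys"])
  show ?thesis
    unfolding tensor_times_def by (simp only: tensor_lift_tens multilinear_tensor_lift 1 2)
qed

lemma tensor_mult_tens: "tensor_mult (tens xs) = prod_list xs"
  unfolding tensor_mult_def
  by (rule tensor_lift_tens) (simp add: multilinear_def linear_iff algebra_simps)

lemma comult_first_tens:
  assumes "linear \<Delta>"
  shows "comult_first \<Delta> (tens (x # ys)) = tensor_append (\<Delta> x) (tens ys)"
proof -
  have "multilinear (\<lambda>xs. case xs of [] \<Rightarrow> 0 | x # ys \<Rightarrow> tensor_append (\<Delta> x) (tens ys))"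
    unfolding multilinear_def
  proof (intro allI)
    fix xs ys
    show "linear (\<lambda>x. case xs @ x # ys of [] \<Rightarrow> 0 | x # ys \<Rightarrow> tensor_append (\<Delta> x) (tens ys))"
    proof (cases xs)
      case Nil
      then show ?thesis
        using linear_compose[OF assms linear_tensor_append_left] by (simp add: o_def)
    next
      case (Cons z zs)
      have "linear (\<lambda>x. tensor_append s (tens (zs @ x # ys)))" for s
      proof -
        have "s \<in> span (range tens)" by (simp add: span_tens)
        then show ?thesis
        proof (induction rule: span_induct)
          case base
          show ?case
            unfolding subspace_def
            by (auto simp: linear_0[OF linear_tensor_append_left] linear_add[OF linear_tensor_append_left]
                linear_scale[OF linear_tensor_append_left]
                intro: linear_compose_add linear_compose_scale_right real_vector.linear_zero)
        next
          case (step s)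
          then show ?case
            using linear_tens[of "_ @ zs"] by (auto simp: tensor_append_tens)
        qed
      qed
      with Cons show ?thesis by simp
    qed
  qed
  from tensor_lift_tens[OF this] show ?thesis by (simp add: comult_first_def)
qed

lemma comult_second_tens:
  assumes "linear \<Delta>"
  shows "comult_second \<Delta> (tens [x, y]) = tensor_append (tens [x]) (\<Delta> y)"
proof -
  have right: "linear (\<lambda>y. tensor_append (tens [x]) (\<Delta> y))" for x
    using linear_compose[OF assms linear_tensor_append_tens] by (simp add: o_def)
  have left: "linear (\<lambda>x. tensor_append (tens [x]) t)" for t :: "'a tensor"
    using linear_compose[OF linear_tens[of "[]" "[]"] linear_tensor_append_left] by (simp add: o_def)
  have "multilinear (\<lambda>xs. case xs of [x, y] \<Rightarrow> tensor_append (tens [x]) (\<Delta> y) | _ \<Rightarrow> 0)"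
    unfolding multilinear_def
  proof (intro allI)
    fix xs ys :: "'a list"
    consider "xs = []" "ys = []" | b where "xs = []" "ys = [b]" | b c zs where "xs = []" "ys = b # c # zs"
      | a where "xs = [a]" "ys = []" | a b zs where "xs = [a]" "ys = b # zs"
      | a b zs where "xs = a # b # zs"
      by (metis list.exhaust)
    then show "linear (\<lambda>x. case xs @ x # ys of [x, y] \<Rightarrow> tensor_append (tens [x]) (\<Delta> y) | _ \<Rightarrow> 0)"
    proof cases
      case (6 a b zs)
      then have "(case xs @ x # ys of [x, y] \<Rightarrow> tensor_append (tens [x]) (\<Delta> y) | _ \<Rightarrow> 0) = 0" for x
        by (cases zs) auto
      then show ?thesis by (simp add: real_vector.linear_zero)
    qed (simp_all add: left right real_vector.linear_zero)
  qed
  from tensor_lift_tens[OF this] show ?thesis by (simp add: comult_second_def)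
qed


section \<open>Graded connected Hopf algebras\<close>

text \<open>
  The underlying algebra is the whole type \<open>'a\<close>; \<open>H m\<close> is its component of degree \<open>m\<close>.
\<close>

locale graded_connected_hopf_algebra =
  fixes H :: "nat \<Rightarrow> 'a::real_algebra_1 set"
    and \<Delta> :: "'a \<Rightarrow> 'a tensor"
    and \<epsilon> :: "'a \<Rightarrow> real"
    and S :: "'a \<Rightarrow> 'a"
  assumes subspace_H: "subspace (H m)"
    and direct_sum: "\<exists>!c. (\<forall>m. c m \<in> H m) \<and> finite {m. c m \<noteq> 0} \<and> x = (\<Sum>m | c m \<noteq> 0. c m)"
    and finite_dimensional: "\<exists>B. finite B \<and> span B = H m"
    and connected: "H 0 = span {1}"
    and mult_graded: "x \<in> H i \<Longrightarrow> y \<in> H j \<Longrightarrow> x * y \<in> H (i + j)"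
    and linear_comult: "linear \<Delta>"
    and comult_graded: "x \<in> H m \<Longrightarrow> \<Delta> x \<in> span (\<Union>i\<le>m. tensor_space [H i, H (m - i)])"
    and coassociative: "comult_first \<Delta> (\<Delta> x) = comult_second \<Delta> (\<Delta> x)"
    and linear_counit: "linear \<epsilon>"
    and counit_graded: "x \<in> H m \<Longrightarrow> m \<noteq> 0 \<Longrightarrow> \<epsilon> x = 0"
    and counit_left: "tensor_lift (\<lambda>xs. case xs of [x, y] \<Rightarrow> \<epsilon> x *\<^sub>R y | _ \<Rightarrow> 0) (\<Delta> x) = x"
    and counit_right: "tensor_lift (\<lambda>xs. case xs of [x, y] \<Rightarrow> \<epsilon> y *\<^sub>R x | _ \<Rightarrow> 0) (\<Delta> x) = x"
    and comult_mult: "\<Delta> (x * y) = tensor_times (\<Delta> x) (\<Delta> y)"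
    and comult_one: "\<Delta> 1 = tens [1, 1]"
    and counit_mult: "\<epsilon> (x * y) = \<epsilon> x * \<epsilon> y"
    and counit_one: "\<epsilon> 1 = 1"
    and linear_antipode: "linear S"
    and antipode_graded: "x \<in> H m \<Longrightarrow> S x \<in> H m"
    and antipode_left: "tensor_mult (tensor_map [S, id] (\<Delta> x)) = \<epsilon> x *\<^sub>R 1"
    and antipode_right: "tensor_mult (tensor_map [id, S] (\<Delta> x)) = \<epsilon> x *\<^sub>R 1"

definition cocommutative :: "('a::real_vector \<Rightarrow> 'a tensor) \<Rightarrow> bool" where
  "cocommutative \<Delta> \<longleftrightarrow> (\<forall>x. tensor_rev (\<Delta> x) = \<Delta> x)"

definition primitives :: "('a::real_algebra_1 \<Rightarrow> 'a tensor) \<Rightarrow> 'a set" where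
  "primitives \<Delta> = {p. \<Delta> p = tens [1, p] + tens [p, 1]}"

definition component :: "(nat \<Rightarrow> 'a::real_vector set) \<Rightarrow> nat \<Rightarrow> 'a \<Rightarrow> 'a" where
  "component H m x =
     (THE c. (\<forall>m. c m \<in> H m) \<and> finite {m. c m \<noteq> 0} \<and> x = (\<Sum>m | c m \<noteq> 0. c m)) m"

text \<open>The degree of a nonzero homogeneous element.\<close>

definition deg :: "(nat \<Rightarrow> 'a set) \<Rightarrow> 'a \<Rightarrow> nat" where
  "deg H x = (THE m. x \<in> H m)"

definition graded_basis :: "(nat \<Rightarrow> 'a::real_vector set) \<Rightarrow> 'a set \<Rightarrow> 'a set \<Rightarrow> bool" where
  "graded_basis H V P \<longleftrightarrow> independent P \<and> span P = V \<and> P \<subseteq> (\<Union>m. H m)"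


section \<open>Descent operators\<close>

text \<open>\<open>comult_wc H \<Delta> D\<close> is \<open>\<Delta>\<^bsub>D\<^esub>\<close> for a nonempty weak composition \<open>D\<close>.\<close>

definition comult_wc ::
    "(nat \<Rightarrow> 'a::real_vector set) \<Rightarrow> ('a \<Rightarrow> 'a tensor) \<Rightarrow> nat list \<Rightarrow> 'a \<Rightarrow> 'a tensor" where
  "comult_wc H \<Delta> D x =
     tensor_map (map (component H) D) ((comult_first \<Delta> ^^ (length D - 1)) (tens [x]))"

definition falling :: "nat \<Rightarrow> nat \<Rightarrow> real" where
  "falling j k = (\<Prod>i<k. real j - real i)"

definition TaBr2R ::
    "(nat \<Rightarrow> 'a::real_algebra_1 set) \<Rightarrow> ('a \<Rightarrow> 'a tensor) \<Rightarrow> nat \<Rightarrow> nat \<Rightarrow> 'a \<Rightarrow> 'a" where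
  "TaBr2R H \<Delta> r n x = (1 / falling n (2 * r)) *\<^sub>R
     tensor_mult (comult_wc H \<Delta> (replicate r 1 @ [n - 2 * r] @ replicate r 1) x)"

definition \<beta> :: "nat \<Rightarrow> nat \<Rightarrow> nat \<Rightarrow> real" where
  "\<beta> r n j = falling j (2 * r) / falling n (2 * r)"


section \<open>Eigenvalues and multiplicities\<close>

definition ordered_basis :: "'a::real_vector list \<Rightarrow> 'a set \<Rightarrow> bool" where
  "ordered_basis bs V \<longleftrightarrow> distinct bs \<and> independent (set bs) \<and> span (set bs) = V"

definition matrix_of :: "'a::real_vector list \<Rightarrow> ('a \<Rightarrow> 'a) \<Rightarrow> real mat" where
  "matrix_of bs T =
     mat (length bs) (length bs) (\<lambda>(i, j). representation (set bs) (T (bs ! j)) (bs ! i))"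

text \<open>The characteristic polynomial of a linear operator \<open>T\<close> on a finite-dimensional
  \<open>T\<close>-invariant subspace \<open>V\<close>.\<close>

definition char_poly_on :: "'a::real_vector set \<Rightarrow> ('a \<Rightarrow> 'a) \<Rightarrow> real poly" where
  "char_poly_on V T = char_poly (matrix_of (SOME bs. ordered_basis bs V) T)"

text \<open>The choice of basis is immaterial.\<close>

lemma char_poly_matrix_of_cong:
  assumes "ordered_basis bs V" "ordered_basis cs V" "linear T" "T ` V \<subseteq> V"
  shows "char_poly (matrix_of bs T) = char_poly (matrix_of cs T)"
proof -
  define M where "M bs cs F = mat (length bs) (length cs)
    (\<lambda>(i, j). representation (set bs) (F (cs ! j)) (bs ! i))"
    for bs cs :: "'a list" and F :: "'a \<Rightarrow> 'a"
  have coord: "(\<Sum>k<length bs. representation (set bs) v (bs ! k) *\<^sub>R (bs ! k)) = v"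
    if "ordered_basis bs V" "v \<in> V" for bs v
  proof -
    have "(\<Sum>b\<in>set bs. representation (set bs) v b *\<^sub>R b) = v"
      using that unfolding ordered_basis_def by (intro real_vector.sum_representation_eq) auto
    then show ?thesis
      using that(1) by (simp add: ordered_basis_def sum_list_distinct_conv_sum_set[symmetric]
          sum_list_sum_nth lessThan_atLeast0)
  qed
  have comp: "M bs cs F * M cs ds G = M bs ds (F \<circ> G)"
    if b: "ordered_basis bs V" "ordered_basis cs V" "ordered_basis ds V"
      and F: "linear F" "F ` V \<subseteq> V" and G: "G ` V \<subseteq> V" for bs cs ds F G
  proof (rule eq_matI)
    fix i j assume ij: "i < dim_row (M bs ds (F \<circ> G))" "j < dim_col (M bs ds (F \<circ> G))"
    have inV: "cs ! k \<in> V" if "k < length cs" for k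
      using b(2) that unfolding ordered_basis_def by (metis nth_mem real_vector.span_base)
    have "ds ! j \<in> V"
      using b(3) ij unfolding ordered_basis_def by (auto simp: M_def intro: real_vector.span_base)
    then have GV: "G (ds ! j) \<in> V" using G by auto
    let ?c = "\<lambda>k. representation (set cs) (G (ds ! j)) (cs ! k)"
    have "F (G (ds ! j)) = F (\<Sum>k<length cs. ?c k *\<^sub>R (cs ! k))"
      using coord[OF b(2) GV] by simp
    also have "\<dots> = (\<Sum>k<length cs. ?c k *\<^sub>R F (cs ! k))"
      by (simp add: linear_sum[OF F(1)] linear_scale[OF F(1)])
    finally have "representation (set bs) (F (G (ds ! j))) (bs ! i) =
      representation (set bs) (\<Sum>k<length cs. ?c k *\<^sub>R F (cs ! k)) (bs ! i)" by simp
    also have "\<dots> = (\<Sum>k<length cs. ?c k * representation (set bs) (F (cs ! k)) (bs ! i))"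
    proof -
      have FV: "F (cs ! k) \<in> span (set bs)" if "k < length cs" for k
        using inV[OF that] F(2) b(1) by (auto simp: ordered_basis_def)
      have ind: "independent (set bs)" using b(1) by (simp add: ordered_basis_def)
      show ?thesis
        by (subst real_vector.representation_sum[OF ind])
          (auto simp: real_vector.representation_scale[OF ind] FV intro: real_vector.span_scale)
    qed
    finally show "(M bs cs F * M cs ds G) $$ (i, j) = M bs ds (F \<circ> G) $$ (i, j)"
      using ij by (simp add: M_def scalar_prod_def mult.commute lessThan_atLeast0)
  qed (simp_all add: M_def)
  have one: "M bs bs id = 1\<^sub>m (length bs)" if "ordered_basis bs V" for bs
    using that by (intro eq_matI)
      (auto simp: M_def ordered_basis_def real_vector.representation_basis nth_eq_iff_index_eq)
  have len: "length bs = length cs"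
    using assms(1,2) unfolding ordered_basis_def
    by (metis distinct_card real_vector.dim_eq_card_independent real_vector.dim_span)
  have M: "matrix_of bs T = M bs bs T" for bs
    by (simp add: matrix_of_def M_def)
  have id: "linear (id :: 'a \<Rightarrow> 'a)" "id ` V \<subseteq> V"
    by (simp_all add: linear_id[unfolded id_def] id_def)
  have "similar_mat_wit (M bs bs T) (M cs cs T) (M bs cs id) (M cs bs id)"
  proof (rule similar_mat_witI)
    show "M bs cs id * M cs bs id = 1\<^sub>m (length bs)"
      using comp[OF assms(1,2,1) id id(2)] one[OF assms(1)] by simp
    show "M cs bs id * M bs cs id = 1\<^sub>m (length bs)"
      using comp[OF assms(2,1,2) id id(2)] one[OF assms(2)] len by simp
    show "M bs bs T = M bs cs id * M cs cs T * M cs bs id"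
      using comp[OF assms(1,2,2) id assms(4)] comp[OF assms(1,2,1) assms(3,4) id(2)] by simp
  qed (simp_all add: M_def len)
  then show ?thesis
    unfolding M by (intro char_poly_similar) (auto simp: similar_mat_def)
qed

definition eigenvalues_on :: "'a::real_vector set \<Rightarrow> ('a \<Rightarrow> 'a) \<Rightarrow> complex set" where
  "eigenvalues_on V T = {z. poly (map_poly of_real (char_poly_on V T)) z = 0}"

definition multiplicity_on :: "'a::real_vector set \<Rightarrow> ('a \<Rightarrow> 'a) \<Rightarrow> real \<Rightarrow> nat" where
  "multiplicity_on V T l = order l (char_poly_on V T)"

text \<open>The zero vector is not excluded; where it has to be, linear independence does so.\<close>

definition eigenvector_on :: "'a::real_vector set \<Rightarrow> ('a \<Rightarrow> 'a) \<Rightarrow> real \<Rightarrow> 'a \<Rightarrow> bool" where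
  "eigenvector_on V T l v \<longleftrightarrow> v \<in> V \<and> T v = l *\<^sub>R v"

text \<open>A power series in \<open>y\<close> (the outer variable) whose coefficients are power series in \<open>x\<close>.\<close>

definition multiplicity_series :: "(nat \<Rightarrow> 'a::real_vector set) \<Rightarrow> real fps fps" where
  "multiplicity_series H =
     ((1 - fps_const fps_X) / (1 - fps_X)) ^ dim (H 1)
       * fps_const (Abs_fps (\<lambda>m. real (dim (H m))))"

text \<open>The iterated power series do not have coefficients in a field, but division by \<open>1 - y\<close> behaves
  as it should.\<close>

lemma fps_fps_divide_one_minus_X: "(f :: real fps fps) / (1 - fps_X) = f * Abs_fps (\<lambda>_. 1)"
proof -
  have "inverse (1 :: real fps) = 1"
    by (simp add: fps_inverse_one')
  then have "inverse (1 - fps_X :: real fps fps) = Abs_fps (\<lambda>_. 1)"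
    by (simp add: fps_inverse_def fps_lr_inverse_one_minus_fps_X(2))
  then show ?thesis
    by (simp add: fps_divide_unit)
qed

definition series_coeff :: "(nat \<Rightarrow> 'a::real_vector set) \<Rightarrow> nat \<Rightarrow> nat \<Rightarrow> real" where
  "series_coeff H a b = fps_nth (fps_nth (multiplicity_series H) b) a"

definition eigen_index :: "nat \<Rightarrow> nat \<Rightarrow> nat set" where
  "eigen_index r n = {0} \<union> {2 * r..n - 2} \<union> {n}"

definition eigen_mult :: "(nat \<Rightarrow> 'a::real_vector set) \<Rightarrow> nat \<Rightarrow> nat \<Rightarrow> nat \<Rightarrow> real" where
  "eigen_mult H r n j =
     (if j = 0 then \<Sum>k<2 * r. series_coeff H (n - k) k else series_coeff H (n - j) j)"


section \<open>Eigenvectors\<close>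

definition perm_prod :: "'a::monoid_mult list \<Rightarrow> (nat \<Rightarrow> nat) \<Rightarrow> nat list \<Rightarrow> 'a" where
  "perm_prod cs \<sigma> ks = prod_list (map (\<lambda>k. cs ! \<sigma> k) ks)"

definition sym_prod :: "'a::ring_1 list \<Rightarrow> 'a" where
  "sym_prod cs = (\<Sum>\<sigma> | \<sigma> permutes {..<length cs}. perm_prod cs \<sigma> [0..<length cs])"

definition sym_sandwich :: "nat \<Rightarrow> 'a::real_algebra_1 list \<Rightarrow> 'a \<Rightarrow> 'a" where
  "sym_sandwich r cs p = (let j = length cs in
     \<Sum>i = r..j - r. \<Sum>\<sigma> | \<sigma> permutes {..<j}.
       real (((j - r) choose i) * ((j - r) choose (i - r))) *\<^sub>R
         (perm_prod cs \<sigma> [0..<i] * p * perm_prod cs \<sigma> [i..<j]))"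

definition eigvec :: "nat \<Rightarrow> 'a::real_algebra_1 list \<Rightarrow> 'a \<Rightarrow> 'a" where
  "eigvec r cs p = (if length cs < 2 * r then sym_prod cs * p else sym_sandwich r cs p)"

lemma perm_prod_permute_list:
  assumes "f permutes {..<length cs}" "\<sigma> permutes {..<length cs}" "set ks \<subseteq> {..<length cs}"
  shows "perm_prod (permute_list f cs) \<sigma> ks = perm_prod cs (f \<circ> \<sigma>) ks"
proof -
  have "permute_list f cs ! \<sigma> k = cs ! f (\<sigma> k)" if "k \<in> set ks" for k
    using that assms(3) permutes_in_image[OF assms(2), of k]
    by (intro permute_list_nth[OF assms(1)]) auto
  then show ?thesis
    unfolding perm_prod_def by (intro arg_cong[of _ _ prod_list] map_cong) simp_all
qed

lemma sym_prod_cong: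
  assumes "mset cs = mset cs'"
  shows "sym_prod cs = sym_prod cs'"
proof -
  obtain f where f: "f permutes {..<length cs'}" "permute_list f cs' = cs"
    using mset_eq_permutation[OF assms] by blast
  have len: "length cs = length cs'"
    using assms by (rule mset_eq_length)
  have pp: "perm_prod cs \<sigma> ks = perm_prod cs' (f \<circ> \<sigma>) ks"
    if "\<sigma> permutes {..<length cs'}" "\<forall>k\<in>set ks. k < length cs'" for \<sigma> ks
    using perm_prod_permute_list[OF f(1) that(1), of ks] that(2) f(2) by auto
  have "sym_prod cs = (\<Sum>\<sigma> | \<sigma> permutes {..<length cs'}. perm_prod cs' (f \<circ> \<sigma>) [0..<length cs'])"
    unfolding sym_prod_def len by (intro sum.cong refl pp) auto
  then show ?thesis
    using setum_permutations_compose_left[OF f(1), of "\<lambda>\<sigma>. perm_prod cs' \<sigma> [0..<length cs']"]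
    by (simp add: sym_prod_def)
qed

lemma sym_sandwich_cong:
  assumes "mset cs = mset cs'"
  shows "sym_sandwich r cs p = sym_sandwich r cs' p"
proof -
  obtain f where f: "f permutes {..<length cs'}" "permute_list f cs' = cs"
    using mset_eq_permutation[OF assms] by blast
  have len: "length cs = length cs'"
    using assms by (rule mset_eq_length)
  have pp: "perm_prod cs \<sigma> ks = perm_prod cs' (f \<circ> \<sigma>) ks"
    if "\<sigma> permutes {..<length cs'}" "\<forall>k\<in>set ks. k < length cs'" for \<sigma> ks
    using perm_prod_permute_list[OF f(1) that(1), of ks] that(2) f(2) by auto
  define g where "g i \<sigma> = real (((length cs' - r) choose i) * ((length cs' - r) choose (i - r))) *\<^sub>R
    (perm_prod cs' \<sigma> [0..<i] * p * perm_prod cs' \<sigma> [i..<length cs'])" for i \<sigma>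
  have "sym_sandwich r cs p =
    (\<Sum>i = r..length cs' - r. \<Sum>\<sigma> | \<sigma> permutes {..<length cs'}. g i (f \<circ> \<sigma>))"
    unfolding sym_sandwich_def len g_def Let_def
  proof (intro sum.cong refl)
    fix i \<sigma> assume "i \<in> {r..length cs' - r}" "\<sigma> \<in> {\<sigma>. \<sigma> permutes {..<length cs'}}"
    then have "perm_prod cs \<sigma> [0..<i] = perm_prod cs' (f \<circ> \<sigma>) [0..<i]"
      "perm_prod cs \<sigma> [i..<length cs'] = perm_prod cs' (f \<circ> \<sigma>) [i..<length cs']"
      by (auto intro!: pp)
    then show "real (((length cs' - r) choose i) * ((length cs' - r) choose (i - r))) *\<^sub>R
        (perm_prod cs \<sigma> [0..<i] * p * perm_prod cs \<sigma> [i..<length cs']) =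
      real (((length cs' - r) choose i) * ((length cs' - r) choose (i - r))) *\<^sub>R
        (perm_prod cs' (f \<circ> \<sigma>) [0..<i] * p * perm_prod cs' (f \<circ> \<sigma>) [i..<length cs'])"
      by simp
  qed
  also have "\<dots> = (\<Sum>i = r..length cs' - r. \<Sum>\<sigma> | \<sigma> permutes {..<length cs'}. g i \<sigma>)"
    by (intro sum.cong refl setum_permutations_compose_left[OF f(1), symmetric])
  finally show ?thesis
    by (simp add: sym_sandwich_def g_def Let_def)
qed

text \<open>Both \<open>sym_prod\<close> and \<open>sym_sandwich\<close> depend only on the multiset of factors, so any
  enumeration of the multisets may be used.\<close>

definition eigvec_mset :: "nat \<Rightarrow> 'a::real_algebra_1 multiset \<times> 'a multiset \<Rightarrow> 'a" where
  "eigvec_mset r = (\<lambda>(C, Q). eigvec r (SOME cs. mset cs = C) (sym_prod (SOME ps. mset ps = Q)))"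

lemma eigvec_mset_eq: "eigvec_mset r (mset cs, mset ps) = eigvec r cs (sym_prod ps)"
proof -
  have "mset (SOME xs. mset xs = mset ys) = mset ys" for ys :: "'a list"
    by (rule someI) (rule refl)
  note cs = this[of cs] and ps = this[of ps]
  show ?thesis
    unfolding eigvec_mset_def eigvec_def prod.case sym_prod_cong[OF cs] sym_prod_cong[OF ps]
      sym_sandwich_cong[OF cs] mset_eq_length[OF cs] ..
qed

text \<open>The pairs of multisets indexing \<open>\<E>\<^sub>j\<close>, where \<open>P\<close> is a graded basis of the
  primitive subspace, \<open>\<P>\<^sub>1 = P \<inter> H 1\<close> and \<open>\<P>\<^bsub>>1\<^esub> = P - H 1\<close>.\<close>

definition mset_index ::
    "(nat \<Rightarrow> 'a set) \<Rightarrow> 'a set \<Rightarrow> nat \<Rightarrow> nat \<Rightarrow> ('a multiset \<times> 'a multiset) set" where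
  "mset_index H P n j = {(C, Q). set_mset C \<subseteq> P \<inter> H 1 \<and> size C = j \<and>
     set_mset Q \<subseteq> P - H 1 \<and> (\<Sum>p\<in>#Q. deg H p) + j = n}"

definition \<E> :: "(nat \<Rightarrow> 'a::real_algebra_1 set) \<Rightarrow> 'a set \<Rightarrow> nat \<Rightarrow> nat \<Rightarrow> nat \<Rightarrow> 'a set" where
  "\<E> H P r n j = eigvec_mset r ` mset_index H P n j"

text \<open>Linear independence as a family: distinct indices yield distinct vectors.\<close>

definition independent_family :: "('i \<Rightarrow> 'a::real_vector) \<Rightarrow> 'i set \<Rightarrow> bool" where
  "independent_family f I \<longleftrightarrow> inj_on f I \<and> independent (f ` I)"

end

theory Submission
  imports Defs "HOL-Combinatorics.Multiset_Permutations"
begin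

text \<open>
  For a functional \<open>\<phi>\<close> supported in degree 1, contracting the first (or the last) factor of the
  coproduct with \<open>\<phi>\<close> is a derivation \<open>D\<close> (or \<open>D'\<close>) of degree \<open>- 1\<close>, and up to a scalar the
  operator is \<open>x \<mapsto> \<Sum> c\<^sub>1 \<cdots> c\<^sub>r (D\<^sub>r \<cdots> D\<^sub>1 D'\<^sub>1 \<cdots> D'\<^sub>r x) c'\<^sub>r \<cdots> c'\<^sub>1\<close>, summed over a basis of \<open>H 1\<close> and the dual
  functionals. On words in \<open>H 1\<close> around a factor killed by all \<open>D\<close> and \<open>D'\<close>, it therefore moves
  \<open>2 r\<close> letters to the ends; the stationary distribution of this process is hypergeometric.

  For the multiplicities, filter \<open>H\<close> by the powers of the augmentation ideal \<open>I\<close>. A derivation maps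
  \<open>I\<^sup>s\<^sup>+\<^sup>1\<close> to \<open>I\<^sup>s\<close>; since commutators of the \<open>D\<close> are derivations again, and since
  \<open>D - D'\<close> maps \<open>I\<close> to itself, in the associated graded space the \<open>D\<close> commute and agree with the
  \<open>D'\<close>. Taylor expansion along \<open>H 1\<close> then splits it into symmetric powers of \<open>H 1\<close> tensored with the
  joint kernel, and the operator acts by the scalar \<open>\<beta>\<^sub>k\<close> on the part of symmetric degree \<open>k\<close>.

  The symmetrised products of primitives are separated by contracting with functionals dual to the
  basis of primitives. They span in the cocommutative case because \<open>\<Sum> q (q\<^sup>* \<rightharpoonup> x)\<close> is
  congruent to \<open>k x\<close> on the \<open>k\<close>-th step of the coradical filtration.
\<close>

text \<open>Connectedness enters through degree 1: a functional supported there satisfies \<phi>(ab)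
  = \<phi>(a) \<epsilon>(b) + \<epsilon>(a) \<phi>(b), since degree 0 consists of scalars and a
  product of two elements of positive degree has no component in degree 1. Outside the cocommutative
  case nothing ensures that the eigenvectors span, so multiplicities are read off a triangular
  matrix instead. The obstacle is that the contractions neither commute nor agree from left and
  right on \<open>H\<close> itself; both defects lie one power of I deeper than the leading term.
  Since I^s has no component below degree s, the filtration is finite on each \<open>H n\<close>.
  Within each of its quotients, elements are sorted by their polynomial degree in
  \<open>H 1\<close>, measured by the number of contractions that it takes to lose them. The same
  flag for the identity map counts dim \<open>H n\<close>; hence the joint kernel has the Hilbert
  series of \<open>H\<close> times (1-x)^d with d = dim \<open>H 1\<close>, while (1-y)^(-d) counts
  the symmetric powers. For independence only the sum of the binomial weights matters, because a
  contraction multiplies it by a positive factor.\<close>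

lemma sum_list_linear:
  assumes "linear f"
  shows "f (\<Sum>x\<leftarrow>xs. g x) = (\<Sum>x\<leftarrow>xs. f (g x))"
  by (induction xs) (simp_all add: linear_0[OF assms] linear_add[OF assms])

lemma linear_sum_list:
  assumes "\<And>i. i \<in> set is \<Longrightarrow> linear (f i)"
  shows "linear (\<lambda>x. \<Sum>i\<leftarrow>is. f i x)"
  using assms
  by (induction "is") (simp_all add: real_vector.linear_zero linear_compose_add)

lemma linear_scaleR_fun:
  fixes f :: "'a::real_vector \<Rightarrow> real"
  assumes "linear f"
  shows "linear (\<lambda>x. f x *\<^sub>R v)"
  by (rule linearI) (simp_all add: linear_add[OF assms] linear_scale[OF assms] scaleR_add_left)

lemma linear_mult_left: "linear ((*) (a :: 'a::real_algebra))"
  and linear_mult_right: "linear (\<lambda>x. x * (a :: 'a::real_algebra))"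
  by (simp_all add: linear_iff algebra_simps)

lemma linear_mult_left_fun: "linear f \<Longrightarrow> linear (\<lambda>x. a * f x :: 'a::real_algebra)"
  and linear_mult_right_fun: "linear f \<Longrightarrow> linear (\<lambda>x. f x * a :: 'a::real_algebra)"
  by (simp_all add: linear_iff algebra_simps)

lemma dual_functionals:
  fixes E :: "'a::real_vector set"
  assumes "independent E"
  obtains \<phi> :: "'a \<Rightarrow> 'a \<Rightarrow> real"
  where "\<And>e. linear (\<phi> e)" "\<And>e x. x \<in> E \<Longrightarrow> \<phi> e x = (if x = e then 1 else 0)"
proof -
  have "\<forall>e. \<exists>g. linear g \<and> (\<forall>x\<in>E. g x = (if x = e then 1 else 0 :: real))"
    by (intro allI linear_independent_extend assms)
  then obtain \<phi> where "\<forall>e. linear (\<phi> e) \<and> (\<forall>x\<in>E. \<phi> e x = (if x = e then 1 else 0 :: real))"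
    by (rule choice[THEN exE])
  then show ?thesis by (intro that[of \<phi>]) auto
qed

lemma dual_functionals_expansion:
  fixes E :: "'a::real_vector set" and \<phi> :: "'a \<Rightarrow> 'a \<Rightarrow> real"
  assumes "finite E" "\<And>e. linear (\<phi> e)" "\<And>e x. x \<in> E \<Longrightarrow> \<phi> e x = (if x = e then 1 else 0)"
    and "x \<in> span E"
  shows "(\<Sum>e\<in>E. \<phi> e x *\<^sub>R e) = x"
proof -
  have "linear (\<lambda>x. \<Sum>e\<in>E. \<phi> e x *\<^sub>R e)"
    by (intro linear_compose_sum linear_scaleR_fun assms(2) ballI)
  moreover have "(\<Sum>e\<in>E. \<phi> e x *\<^sub>R e) = x" if "x \<in> E" for x
  proof -
    have "(\<Sum>e\<in>E. \<phi> e x *\<^sub>R e) = (\<Sum>e\<in>E. if x = e then e else 0)"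
      using that assms(3) by (intro sum.cong) auto
    with assms(1) that show ?thesis by simp
  qed
  ultimately show ?thesis
    by (rule linear_eq_on[OF _ real_vector.linear_ident assms(4)])
qed

section \<open>Bilinear and trilinear forms on tensor powers\<close>

text \<open>\<open>'a tensor\<close> contains all tensor powers, so a bilinear map on the square is
  extended by 0 to the other powers.\<close>

definition tensor_lift2 :: "('a::real_vector \<Rightarrow> 'a \<Rightarrow> 'b::real_vector) \<Rightarrow> 'a tensor \<Rightarrow> 'b" where
  "tensor_lift2 g = tensor_lift (\<lambda>xs. case xs of [x, y] \<Rightarrow> g x y | _ \<Rightarrow> 0)"

definition tensor_lift3 ::
    "('a::real_vector \<Rightarrow> 'a \<Rightarrow> 'a \<Rightarrow> 'b::real_vector) \<Rightarrow> 'a tensor \<Rightarrow> 'b" where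
  "tensor_lift3 h = tensor_lift (\<lambda>xs. case xs of [x, y, z] \<Rightarrow> h x y z | _ \<Rightarrow> 0)"

lemma multilinear_case2:
  assumes "\<And>x. linear (g x)" "\<And>y. linear (\<lambda>x. g x y)"
  shows "multilinear (\<lambda>xs. case xs of [x, y] \<Rightarrow> g x y | _ \<Rightarrow> 0)"
  unfolding multilinear_def
proof (intro allI)
  fix xs ys :: "'a list"
  consider "xs = []" "ys = []" | b where "xs = []" "ys = [b]" | b c zs where "xs = []" "ys = b # c # zs"
    | a where "xs = [a]" "ys = []" | a b zs where "xs = [a]" "ys = b # zs"
    | a b zs where "xs = a # b # zs"
    by (metis list.exhaust)
  then show "linear (\<lambda>x. case xs @ x # ys of [x, y] \<Rightarrow> g x y | _ \<Rightarrow> 0)"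
  proof cases
    case (6 a b zs)
    then have "(case xs @ x # ys of [x, y] \<Rightarrow> g x y | _ \<Rightarrow> 0) = 0" for x
      by (cases zs) auto
    then show ?thesis by (simp add: real_vector.linear_zero)
  qed (simp_all add: assms real_vector.linear_zero)
qed

lemma multilinear_case3:
  assumes "\<And>x y. linear (h x y)" "\<And>x z. linear (\<lambda>y. h x y z)" "\<And>y z. linear (\<lambda>x. h x y z)"
  shows "multilinear (\<lambda>xs. case xs of [x, y, z] \<Rightarrow> h x y z | _ \<Rightarrow> 0)"
  unfolding multilinear_def
proof (intro allI)
  fix xs ys :: "'a list"
  show "linear (\<lambda>x. case xs @ x # ys of [x, y, z] \<Rightarrow> h x y z | _ \<Rightarrow> 0)"
  proof (cases "length xs + length ys = 2")
    case False
    have "(case zs of [x, y, z] \<Rightarrow> h x y z | _ \<Rightarrow> 0) = 0" if "length zs \<noteq> 3" for zs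
      using that by (auto split: list.splits)
    with False show ?thesis by (simp add: real_vector.linear_zero)
  next
    case True
    then consider b c where "xs = []" "ys = [b, c]" | b c where "xs = [b]" "ys = [c]"
      | b c where "xs = [b, c]" "ys = []"
    proof -
      from True consider "length xs = 0" "length ys = 2" | "length xs = 1" "length ys = 1"
        | "length xs = 2" "length ys = 0"
        by linarith
      then show thesis
        by cases (auto simp: numeral_2_eq_2 length_Suc_conv intro: that)
    qed
    then show ?thesis by cases (simp_all add: assms)
  qed
qed

lemma
  assumes "\<And>x. linear (g x)" "\<And>y. linear (\<lambda>x. g x y)"
  shows linear_tensor_lift2: "linear (tensor_lift2 g)"
    and tensor_lift2_tens: "tensor_lift2 g (tens xs) = (case xs of [x, y] \<Rightarrow> g x y | _ \<Rightarrow> 0)"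
  unfolding tensor_lift2_def
  by (rule linear_tensor_lift[OF multilinear_case2[OF assms]],
      rule tensor_lift_tens[OF multilinear_case2[OF assms]])

lemma
  assumes "\<And>x y. linear (h x y)" "\<And>x z. linear (\<lambda>y. h x y z)" "\<And>y z. linear (\<lambda>x. h x y z)"
  shows linear_tensor_lift3: "linear (tensor_lift3 h)"
    and tensor_lift3_tens: "tensor_lift3 h (tens xs) = (case xs of [x, y, z] \<Rightarrow> h x y z | _ \<Rightarrow> 0)"
  unfolding tensor_lift3_def
  by (rule linear_tensor_lift[OF multilinear_case3[OF assms]],
      rule tensor_lift_tens[OF multilinear_case3[OF assms]])

lemma tensor_lift2_sum:
  assumes "\<And>x. linear (g x)" "\<And>y. linear (\<lambda>x. g x y)"
  shows "tensor_lift2 g (\<Sum>(a, b)\<leftarrow>ps. tens [a, b]) = (\<Sum>(a, b)\<leftarrow>ps. g a b)"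
  using sum_list_linear[OF linear_tensor_lift2[of g, OF assms], of "\<lambda>(a, b). tens [a, b]" ps]
  by (simp add: tensor_lift2_tens[of g, OF assms] case_prod_unfold)

lemma tens_pair_scale:
  "tens [c *\<^sub>R a, b] = c *\<^sub>R tens [a, b]" "tens [a, c *\<^sub>R b] = c *\<^sub>R tens [a, b]"
  using linear_scale[OF linear_tens[of "[]" "[b]"], of c a]
    linear_scale[OF linear_tens[of "[a]" "[]"], of c b] by simp_all

lemma tens_pair_0: "tens [a, 0] = 0"
  using linear_0[OF linear_tens[of "[a]" "[]"]] by simp

text \<open>Sweedler notation: scalars are absorbed into the first factors, so that an element of
  the tensor square is a plain sum over a list of pairs, and identities can be computed on
  lists.\<close>

lemma sum_tens_pairs:
  assumes "t \<in> span {tens [a, b] | a b. True}"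
  obtains ps where "t = (\<Sum>(a, b)\<leftarrow>ps. tens [a, b])"
proof -
  have "\<exists>ps. t = (\<Sum>(a, b)\<leftarrow>ps. tens [a, b])"
    using assms
  proof (induction rule: real_vector.span_induct_alt)
    case base
    then show ?case by (intro exI[of _ "[]"]) simp
  next
    case (step c x y)
    then obtain a b ps where "x = tens [a, b]" "y = (\<Sum>(a, b)\<leftarrow>ps. tens [a, b])"
      by auto
    then show ?case by (intro exI[of _ "(c *\<^sub>R a, b) # ps"]) (simp add: tens_pair_scale)
  qed
  with that show ?thesis by blast
qed

lemma
  fixes t :: "'a::real_algebra_1 tensor" and xs :: "'a list"
  shows linear_tensor_times_left: "linear (\<lambda>s. tensor_times s t)"
    and linear_tensor_times_tens: "linear (tensor_times (tens xs))"
proof -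
  have 1: "multilinear (\<lambda>ys. if length ys = length xs then tens (map2 (*) xs ys) else 0)" for xs :: "'a list"
    by (rule multilinear_map2) (simp add: linear_iff algebra_simps)
  have flip: "map2 (*) xs ys = map2 (\<lambda>y x. x * y) ys xs" for xs ys :: "'a list"
    by (subst zip_commute) (simp add: case_prod_unfold)
  have "multilinear (\<lambda>xs. if length xs = length ys then tens (map2 (\<lambda>y x. x * y) ys xs) else 0)"
    for ys :: "'a list"
    by (rule multilinear_map2) (simp add: linear_iff algebra_simps)
  then have 2: "multilinear (\<lambda>xs. if length ys = length xs then tens (map2 (*) xs ys) else 0)"
    for ys :: "'a list"
    by (simp only: flip eq_commute[of "length ys"])
  show "linear (\<lambda>s. tensor_times s t)"
    unfolding tensor_times_def
    by (rule linear_tensor_lift, rule multilinear_tensor_lift) (rule 1, rule 2)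
  have "tensor_times (tens xs) =
      tensor_lift (\<lambda>ys. if length ys = length xs then tens (map2 (*) xs ys) else 0)"
    unfolding tensor_times_def by (rule ext) (intro tensor_lift_tens multilinear_tensor_lift 1 2)
  then show "linear (tensor_times (tens xs))"
    using linear_tensor_lift[OF 1[of xs]] by simp
qed

lemma tensor_times_sum:
  "tensor_times (\<Sum>(a, b)\<leftarrow>ps. tens [a, b]) (\<Sum>(a, b)\<leftarrow>qs. tens [a, b]) =
    (\<Sum>(a, b)\<leftarrow>ps. \<Sum>(c, d)\<leftarrow>qs. tens [a * c, b * d])"
  using sum_list_linear[OF linear_tensor_times_left[of "\<Sum>(a, b)\<leftarrow>qs. tens [a, b]"],
      of "\<lambda>(a, b). tens [a, b]" ps]
  by (simp add: case_prod_unfold sum_list_linear[OF linear_tensor_times_tens] tensor_times_tens)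

lemma linear_tensor_map:
  assumes "\<And>f. f \<in> set fs \<Longrightarrow> linear f"
  shows "linear (tensor_map fs)"
  unfolding tensor_map_def by (rule linear_tensor_lift) (simp add: multilinear_map2 assms)

lemma linear_tensor_mult: "linear tensor_mult"
  unfolding tensor_mult_def
  by (rule linear_tensor_lift) (simp add: multilinear_def linear_iff algebra_simps)

lemma linear_tensor_rev: "linear tensor_rev"
  unfolding tensor_rev_def
  by (rule linear_tensor_lift) (simp add: multilinear_def linear_tens)

text \<open>Prepared for the two sides of coassociativity, whose values are coproducts appended to
  one further factor on the right or on the left.\<close>

lemma tensor_append_lift3:
  assumes "\<And>x y. linear (h x y)" "\<And>x z. linear (\<lambda>y. h x y z)" "\<And>y z. linear (\<lambda>x. h x y z)"
  shows "tensor_lift3 h (tensor_append s (tens [b])) = tensor_lift2 (\<lambda>x y. h x y b) s"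
    and "tensor_lift3 h (tensor_append (tens [a]) s) = tensor_lift2 (h a) s"
proof -
  have s: "s \<in> span (range tens)" by (simp add: span_tens)
  have "linear (\<lambda>s. tensor_lift3 h (tensor_append s (tens [b])))"
    using linear_compose[OF linear_tensor_append_left linear_tensor_lift3[of h, OF assms]]
    by (simp add: o_def)
  note l1 = this
  have l2: "linear (tensor_lift2 (\<lambda>x y. h x y b))"
    by (rule linear_tensor_lift2) (rule assms)+
  have "tensor_lift3 h (tensor_append s (tens [b])) = tensor_lift2 (\<lambda>x y. h x y b) s"
    if "s \<in> range tens" for s
    using that
    by (auto simp: tensor_append_tens tensor_lift3_tens[of h, OF assms] tensor_lift2_tens assms
        split: list.splits)
  then show "tensor_lift3 h (tensor_append s (tens [b])) = tensor_lift2 (\<lambda>x y. h x y b) s"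
    by (rule linear_eq_on[OF l1 l2 s])
  have "linear (\<lambda>s. tensor_lift3 h (tensor_append (tens [a]) s))"
    using linear_compose[OF linear_tensor_append_tens linear_tensor_lift3[of h, OF assms]]
    by (simp add: o_def)
  note l1 = this
  have l2: "linear (tensor_lift2 (h a))"
    by (rule linear_tensor_lift2) (rule assms)+
  have "tensor_lift3 h (tensor_append (tens [a]) s) = tensor_lift2 (h a) s"
    if "s \<in> range tens" for s
    using that
    by (auto simp: tensor_append_tens tensor_lift3_tens[of h, OF assms] tensor_lift2_tens assms
        split: list.splits)
  then show "tensor_lift3 h (tensor_append (tens [a]) s) = tensor_lift2 (h a) s"
    by (rule linear_eq_on[OF l1 l2 s])
qed

text \<open>In an expansion along a basis of the span of the first factors, the second factors are the
  contractions with the dual functionals.\<close>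

lemma tens_pairs_eq_0:
  fixes t :: "'a::real_vector tensor"
  assumes "t \<in> span {tens [a, b] | a b. True}"
    and "\<And>\<phi>. linear \<phi> \<Longrightarrow> tensor_lift2 (\<lambda>x y. \<phi> x *\<^sub>R y) t = 0"
  shows "t = 0"
proof -
  obtain ps where ps: "t = (\<Sum>(a, b)\<leftarrow>ps. tens [a, b])"
    using sum_tens_pairs[OF assms(1)] .
  obtain E where E: "E \<subseteq> fst ` set ps" "independent E" "fst ` set ps \<subseteq> span E"
    using real_vector.maximal_independent_subset[of "fst ` set ps"] by blast
  have finE: "finite E" using E(1) by (rule finite_subset) simp
  obtain \<phi> :: "'a \<Rightarrow> 'a \<Rightarrow> real" where \<phi>: "\<And>e. linear (\<phi> e)"
      "\<And>e x. x \<in> E \<Longrightarrow> \<phi> e x = (if x = e then 1 else 0)"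
    using dual_functionals[OF E(2)] by blast
  note dual = dual_functionals_expansion[OF finE \<phi>]
  have "tens [a, b] = (\<Sum>e\<in>E. tens [e, \<phi> e a *\<^sub>R b])" if "(a, b) \<in> set ps" for a b
  proof -
    have "a \<in> span E" using that E(3) by force
    then have "tens [a, b] = tens [\<Sum>e\<in>E. \<phi> e a *\<^sub>R e, b]" by (simp add: dual)
    also have "\<dots> = (\<Sum>e\<in>E. tens [e, \<phi> e a *\<^sub>R b])"
      using linear_sum[OF linear_tens[of "[]" "[b]"], of "\<lambda>e. \<phi> e a *\<^sub>R e" E]
      by (simp add: tens_pair_scale)
    finally show ?thesis .
  qed
  then have "t = (\<Sum>(a, b)\<leftarrow>ps. \<Sum>e\<in>E. tens [e, \<phi> e a *\<^sub>R b])"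
    unfolding ps by (intro arg_cong[of _ _ sum_list] map_cong) auto
  also have "\<dots> = (\<Sum>e\<in>E. \<Sum>(a, b)\<leftarrow>ps. tens [e, \<phi> e a *\<^sub>R b])"
    by (induction ps) (auto simp: sum.distrib)
  also have "\<dots> = (\<Sum>e\<in>E. tens [e, \<Sum>(a, b)\<leftarrow>ps. \<phi> e a *\<^sub>R b])"
  proof (intro sum.cong refl)
    fix e
    show "(\<Sum>(a, b)\<leftarrow>ps. tens [e, \<phi> e a *\<^sub>R b]) = tens [e, \<Sum>(a, b)\<leftarrow>ps. \<phi> e a *\<^sub>R b]"
      using sum_list_linear[OF linear_tens[of "[e]" "[]"], of "\<lambda>(a, b). \<phi> e a *\<^sub>R b" ps]
      by (simp add: case_prod_unfold)
  qed
  also have "\<dots> = (\<Sum>e\<in>E. tens [e, 0])"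
  proof (intro sum.cong refl)
    fix e
    have "(\<Sum>(a, b)\<leftarrow>ps. \<phi> e a *\<^sub>R b) = tensor_lift2 (\<lambda>x y. \<phi> e x *\<^sub>R y) t"
      unfolding ps
      by (rule tensor_lift2_sum[symmetric], simp add: linear_iff scaleR_add_right) (simp_all add: linear_scaleR_fun[OF \<phi>(1)])
    then show "tens [e, \<Sum>(a, b)\<leftarrow>ps. \<phi> e a *\<^sub>R b] = tens [e, 0]"
      using assms(2)[OF \<phi>(1)] by simp
  qed
  also have "\<dots> = 0"
    by (simp add: tens_pair_0)
  finally show ?thesis .
qed

section \<open>Contractions of the coproduct\<close>

context graded_connected_hopf_algebra
begin

section \<open>Homogeneous components\<close>

lemma component_eqI:
  assumes "\<And>m. c m \<in> H m" "finite A" "\<And>m. m \<notin> A \<Longrightarrow> c m = 0" "x = (\<Sum>m\<in>A. c m)"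
  shows "component H m x = c m"
proof -
  have sub: "{m. c m \<noteq> 0} \<subseteq> A" using assms(3) by blast
  then have "x = (\<Sum>m | c m \<noteq> 0. c m)"
    unfolding assms(4) using assms(2) by (intro sum.mono_neutral_right) auto
  moreover have "finite {m. c m \<noteq> 0}" using sub assms(2) by (rule finite_subset)
  ultimately have "(THE c. (\<forall>m. c m \<in> H m) \<and> finite {m. c m \<noteq> 0} \<and> x = (\<Sum>m | c m \<noteq> 0. c m)) = c"
    using assms(1) by (intro the1_equality[OF direct_sum]) auto
  then show ?thesis by (simp add: component_def)
qed

lemma component_mem: "component H m x \<in> H m"
  and finite_component: "finite {m. component H m x \<noteq> 0}"
  and sum_component: "(\<Sum>m | component H m x \<noteq> 0. component H m x) = x"
proof -
  have "(\<lambda>m. component H m x) = (THE c. (\<forall>m. c m \<in> H m) \<and> finite {m. c m \<noteq> 0} \<and> x = (\<Sum>m | c m \<noteq> 0. c m))"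
    by (simp add: component_def)
  then have "(\<forall>m. component H m x \<in> H m) \<and> finite {m. component H m x \<noteq> 0} \<and>
      x = (\<Sum>m | component H m x \<noteq> 0. component H m x)"
    using theI'[OF direct_sum[of x]] by metis
  then show "component H m x \<in> H m" "finite {m. component H m x \<noteq> 0}"
    "(\<Sum>m | component H m x \<noteq> 0. component H m x) = x"
    by auto
qed

lemma sum_component_superset:
  assumes "finite A" "{m. component H m x \<noteq> 0} \<subseteq> A"
  shows "(\<Sum>m\<in>A. component H m x) = x"
proof -
  have "(\<Sum>m\<in>A. component H m x) = (\<Sum>m | component H m x \<noteq> 0. component H m x)"
    using assms by (intro sum.mono_neutral_right) auto
  then show ?thesis by (simp only: sum_component)
qed

lemma linear_component: "linear (component H m)"
proof (rule linearI)
  fix x y c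
  let ?A = "{m. component H m x \<noteq> 0} \<union> {m. component H m y \<noteq> 0}"
  have fin: "finite ?A" by (simp add: finite_component)
  show "component H m (x + y) = component H m x + component H m y"
    by (rule component_eqI[OF _ fin])
      (auto simp: sum.distrib sum_component_superset[OF fin] intro: subspace_add subspace_H component_mem)
  show "component H m (c *\<^sub>R x) = c *\<^sub>R component H m x"
    by (rule component_eqI[OF _ fin])
      (auto simp: scaleR_sum_right[symmetric] sum_component_superset[OF fin]
        intro: subspace_scale subspace_H component_mem)
qed

lemma zero_H: "0 \<in> H m"
  by (rule subspace_0[OF subspace_H])

lemma component_H:
  assumes "x \<in> H k"
  shows "component H m x = (if m = k then x else 0)"
  by (rule component_eqI[where A = "{k}" and c = "\<lambda>m. if m = k then x else 0"])
    (auto simp: assms zero_H)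

lemma H_unique:
  assumes "x \<in> H i" "x \<in> H j" "x \<noteq> 0"
  shows "i = j"
  using component_H[OF assms(1), of i] component_H[OF assms(2), of i] assms(3) by (auto split: if_splits)

lemma linear_eq_on_H:
  assumes "linear f" "linear g" "\<And>m x. x \<in> H m \<Longrightarrow> f x = g x"
  shows "f x = g x"
proof -
  have "f x = (\<Sum>m | component H m x \<noteq> 0. f (component H m x))"
    using linear_sum[OF assms(1)] sum_component[of x] by metis
  also have "\<dots> = (\<Sum>m | component H m x \<noteq> 0. g (component H m x))"
    by (intro sum.cong refl assms(3)[OF component_mem])
  also have "\<dots> = g x"
    using linear_sum[OF assms(2)] sum_component[of x] by metis
  finally show ?thesis .
qed

lemma one_H: "1 \<in> H 0"
  unfolding connected by (simp add: real_vector.span_base)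

lemma H0_eq: "x \<in> H 0 \<Longrightarrow> x = \<epsilon> x *\<^sub>R 1"
  unfolding connected
  by (auto simp: real_vector.span_singleton linear_scale[OF linear_counit] counit_one)

text \<open>The type of \<open>\<Delta>\<close> allows values in every tensor power; the grading
  axiom, applied to the homogeneous components of \<open>x\<close>, confines them to the square,
  where Sweedler notation is available.\<close>

lemma comult_sum:
  obtains ps where "\<Delta> x = (\<Sum>(a, b)\<leftarrow>ps. tens [a, b])"
proof -
  have ts: "tensor_space [H i, H j] \<subseteq> span {tens [a, b] | a b. True}" for i j
    unfolding tensor_space_def
    by (intro real_vector.span_mono) (auto simp: list_all2_Cons2)
  have "\<Delta> x \<in> span {tens [a, b] | a b. True}" if "x \<in> H m" for x m
  proof -
    have "span (\<Union>i\<le>m. tensor_space [H i, H (m - i)]) \<subseteq> span {tens [a, b] | a b. True}"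
      by (rule real_vector.span_minimal) (use ts in auto)
    with comult_graded[OF that] show ?thesis by blast
  qed
  then have "(\<Sum>m | component H m x \<noteq> 0. \<Delta> (component H m x)) \<in> span {tens [a, b] | a b. True}"
    by (intro real_vector.span_sum) (use component_mem in blast)
  also have "(\<Sum>m | component H m x \<noteq> 0. \<Delta> (component H m x)) = \<Delta> x"
    using linear_sum[OF linear_comult] sum_component[of x] by metis
  finally show thesis by (rule sum_tens_pairs) (rule that)
qed

text \<open>\<open>lc\<close> and \<open>rc\<close> are the two actions of the linear dual on the
  coalgebra. Functionals supported in degree 1 serve for the eigenvalues, arbitrary ones for the
  study of primitive elements.\<close>

definition lc :: "('a \<Rightarrow> real) \<Rightarrow> 'a \<Rightarrow> 'a" where
  "lc \<phi> x = tensor_lift2 (\<lambda>a b. \<phi> a *\<^sub>R b) (\<Delta> x)"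

definition rc :: "('a \<Rightarrow> real) \<Rightarrow> 'a \<Rightarrow> 'a" where
  "rc \<phi> x = tensor_lift2 (\<lambda>a b. \<phi> b *\<^sub>R a) (\<Delta> x)"

text \<open>The convolution product of endomorphisms, in which m\<Delta>_D is the product of the
  projections to the degrees in D.\<close>

definition conv :: "('a \<Rightarrow> 'a) \<Rightarrow> ('a \<Rightarrow> 'a) \<Rightarrow> 'a \<Rightarrow> 'a" where
  "conv f g x = tensor_lift2 (\<lambda>a b. f a * g b) (\<Delta> x)"

lemma lc_sum: "linear \<phi> \<Longrightarrow> \<Delta> x = (\<Sum>(a, b)\<leftarrow>ps. tens [a, b]) \<Longrightarrow> lc \<phi> x = (\<Sum>(a, b)\<leftarrow>ps. \<phi> a *\<^sub>R b)"
  and rc_sum: "linear \<phi> \<Longrightarrow> \<Delta> x = (\<Sum>(a, b)\<leftarrow>ps. tens [a, b]) \<Longrightarrow> rc \<phi> x = (\<Sum>(a, b)\<leftarrow>ps. \<phi> b *\<^sub>R a)"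
  unfolding lc_def rc_def
  by (simp_all, (subst tensor_lift2_sum; simp add: linear_iff algebra_simps)+)

lemma conv_sum:
  "linear f \<Longrightarrow> linear g \<Longrightarrow> \<Delta> x = (\<Sum>(a, b)\<leftarrow>ps. tens [a, b]) \<Longrightarrow>
    conv f g x = (\<Sum>(a, b)\<leftarrow>ps. f a * g b)"
  unfolding conv_def by (simp, subst tensor_lift2_sum) (simp_all add: linear_iff algebra_simps)

lemma linear_lc: "linear \<phi> \<Longrightarrow> linear (lc \<phi>)"
  and linear_rc: "linear \<phi> \<Longrightarrow> linear (rc \<phi>)"
proof -
  assume l: "linear \<phi>"
  show "linear (lc \<phi>)"
    unfolding lc_def
    by (rule linear_compose[OF linear_comult linear_tensor_lift2, unfolded o_def])
      (use l in \<open>simp_all add: linear_iff algebra_simps\<close>)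
  show "linear (rc \<phi>)"
    unfolding rc_def
    by (rule linear_compose[OF linear_comult linear_tensor_lift2, unfolded o_def])
      (use l in \<open>simp_all add: linear_iff algebra_simps\<close>)
qed

lemma linear_conv: "linear f \<Longrightarrow> linear g \<Longrightarrow> linear (conv f g)"
  unfolding conv_def
  by (rule linear_compose[OF linear_comult linear_tensor_lift2, unfolded o_def])
    (simp_all add: linear_iff algebra_simps)

lemma lc_counit: "lc \<epsilon> x = x"
  using counit_left by (simp add: lc_def tensor_lift2_def)

lemma rc_counit: "rc \<epsilon> x = x"
  using counit_right by (simp add: rc_def tensor_lift2_def)

text \<open>Both sides are the sum of \<phi>(a) \<epsilon>(b) over \<Delta> x. The functional is
  thus recovered from its contraction, which identifies scalars in \<open>H 0\<close> and shows that
  left and right contraction differ by an element of the augmentation ideal.\<close>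

lemma counit_lc:
  assumes "linear \<phi>"
  shows "\<epsilon> (lc \<phi> x) = \<phi> x"
proof -
  obtain ps where ps: "\<Delta> x = (\<Sum>(a, b)\<leftarrow>ps. tens [a, b])" by (rule comult_sum)
  have "\<epsilon> (lc \<phi> x) = (\<Sum>(a, b)\<leftarrow>ps. \<phi> a * \<epsilon> b)"
    by (simp add: lc_sum[OF assms ps] sum_list_linear[OF linear_counit] linear_scale[OF linear_counit]
        case_prod_unfold)
  also have "\<dots> = \<phi> (rc \<epsilon> x)"
    by (simp add: rc_sum[OF linear_counit ps] sum_list_linear[OF assms] linear_scale[OF assms]
        case_prod_unfold mult.commute)
  finally show ?thesis by (simp add: rc_counit)
qed

lemma counit_rc:
  assumes "linear \<phi>"
  shows "\<epsilon> (rc \<phi> x) = \<phi> x"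
proof -
  obtain ps where ps: "\<Delta> x = (\<Sum>(a, b)\<leftarrow>ps. tens [a, b])" by (rule comult_sum)
  have "\<epsilon> (rc \<phi> x) = (\<Sum>(a, b)\<leftarrow>ps. \<phi> b * \<epsilon> a)"
    by (simp add: rc_sum[OF assms ps] sum_list_linear[OF linear_counit] linear_scale[OF linear_counit]
        case_prod_unfold)
  also have "\<dots> = \<phi> (lc \<epsilon> x)"
    by (simp add: lc_sum[OF linear_counit ps] sum_list_linear[OF assms] linear_scale[OF assms]
        case_prod_unfold mult.commute)
  finally show ?thesis by (simp add: lc_counit)
qed

lemma lc_add: "linear \<phi> \<Longrightarrow> linear \<psi> \<Longrightarrow> lc (\<lambda>x. \<phi> x + \<psi> x) x = lc \<phi> x + lc \<psi> x"
  and lc_diff: "linear \<phi> \<Longrightarrow> linear \<psi> \<Longrightarrow> lc (\<lambda>x. \<phi> x - \<psi> x) x = lc \<phi> x - lc \<psi> x"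
  and lc_scale: "linear \<phi> \<Longrightarrow> lc (\<lambda>x. c * \<phi> x) x = c *\<^sub>R lc \<phi> x"
proof -
  obtain ps where ps: "\<Delta> x = (\<Sum>(a, b)\<leftarrow>ps. tens [a, b])" by (rule comult_sum)
  note s = lc_sum[OF _ ps] linear_compose_add linear_compose_sub linear_compose_scale_right[where 'b = real, simplified]
  show "linear \<phi> \<Longrightarrow> linear \<psi> \<Longrightarrow> lc (\<lambda>x. \<phi> x + \<psi> x) x = lc \<phi> x + lc \<psi> x"
    by (simp add: s case_prod_unfold scaleR_add_left sum_list_addf)
  show "linear \<phi> \<Longrightarrow> linear \<psi> \<Longrightarrow> lc (\<lambda>x. \<phi> x - \<psi> x) x = lc \<phi> x - lc \<psi> x"
    by (simp add: s case_prod_unfold scaleR_diff_left sum_list_subtractf)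
  show "linear \<phi> \<Longrightarrow> lc (\<lambda>x. c * \<phi> x) x = c *\<^sub>R lc \<phi> x"
    by (simp add: s case_prod_unfold sum_list_linear[OF real_vector.linear_scale_self, of c])
qed

lemma lc_sum_functional:
  assumes "finite A" "\<And>i. i \<in> A \<Longrightarrow> linear (f i)"
  shows "lc (\<lambda>x. \<Sum>i\<in>A. f i x) x = (\<Sum>i\<in>A. lc (f i) x)"
  using assms
proof (induction A)
  case empty
  have "lc (\<lambda>x. 0 * \<epsilon> x) x = 0" by (subst lc_scale) (simp_all add: linear_counit)
  then show ?case by simp
next
  case (insert a A)
  then show ?case by (simp add: lc_add linear_compose_sum)
qed

lemma lc_one: "linear \<phi> \<Longrightarrow> lc \<phi> 1 = \<phi> 1 *\<^sub>R 1"
  using lc_sum[of \<phi> 1 "[(1, 1)]"] comult_one by simp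

lemma lc_primitive: "linear \<phi> \<Longrightarrow> q \<in> primitives \<Delta> \<Longrightarrow> lc \<phi> q = \<phi> 1 *\<^sub>R q + \<phi> q *\<^sub>R 1"
  and rc_primitive: "linear \<phi> \<Longrightarrow> q \<in> primitives \<Delta> \<Longrightarrow> rc \<phi> q = \<phi> q *\<^sub>R 1 + \<phi> 1 *\<^sub>R q"
  using lc_sum[of \<phi> q "[(1, q), (q, 1)]"] rc_sum[of \<phi> q "[(1, q), (q, 1)]"]
  by (simp_all add: primitives_def)

lemma comult_mult_sum:
  assumes "\<Delta> x = (\<Sum>(a, b)\<leftarrow>ps. tens [a, b])" "\<Delta> y = (\<Sum>(a, b)\<leftarrow>qs. tens [a, b])"
  shows "\<Delta> (x * y) = (\<Sum>(a, b)\<leftarrow>concat (map (\<lambda>(a, b). map (\<lambda>(c, d). (a * c, b * d)) qs) ps). tens [a, b])"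
  unfolding comult_mult assms tensor_times_sum
  by (induction ps) (auto simp: case_prod_unfold o_def)

lemma sum_list_concat_pairs:
  "(\<Sum>(a, b)\<leftarrow>concat (map (\<lambda>(a, b). map (\<lambda>(c, d). (f a c, g b d)) qs) ps). h a b) =
    (\<Sum>(a, b)\<leftarrow>ps. \<Sum>(c, d)\<leftarrow>qs. h (f a c) (g b d))"
  by (induction ps) (auto simp: case_prod_unfold o_def)

text \<open>As \<Delta> is multiplicative, contracting x * y evaluates \<phi> at products of first
  (or last) factors; the assumed rule splits this into two terms, in each of which one of x and y is
  contracted with \<epsilon>, that is, left unchanged.\<close>

lemma
  assumes "linear \<phi>" "\<And>a b. \<phi> (a * b) = \<phi> a * \<epsilon> b + \<epsilon> a * \<phi> b"
  shows lc_derivation: "lc \<phi> (x * y) = lc \<phi> x * y + x * lc \<phi> y"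
    and rc_derivation: "rc \<phi> (x * y) = rc \<phi> x * y + x * rc \<phi> y"
proof -
  obtain ps where ps: "\<Delta> x = (\<Sum>(a, b)\<leftarrow>ps. tens [a, b])" by (rule comult_sum)
  obtain qs where qs: "\<Delta> y = (\<Sum>(a, b)\<leftarrow>qs. tens [a, b])" by (rule comult_sum)
  have prod: "(\<Sum>(a, b)\<leftarrow>ps. f a b) * (\<Sum>(c, d)\<leftarrow>qs. g c d) = (\<Sum>(a, b)\<leftarrow>ps. \<Sum>(c, d)\<leftarrow>qs. f a b * g c d)"
    for f g :: "'a \<Rightarrow> 'a \<Rightarrow> 'a"
    by (simp add: case_prod_unfold sum_list_mult_const[symmetric] sum_list_const_mult)
  have "lc \<phi> x * lc \<epsilon> y + lc \<epsilon> x * lc \<phi> y = lc \<phi> (x * y)"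
    by (simp add: lc_sum[OF assms(1) comult_mult_sum[OF ps qs]] sum_list_concat_pairs
        lc_sum[OF assms(1) ps] lc_sum[OF assms(1) qs] lc_sum[OF linear_counit ps] lc_sum[OF linear_counit qs]
        prod assms(2) scaleR_add_left)
      (simp add: case_prod_unfold sum_list_addf mult.commute)
  then show "lc \<phi> (x * y) = lc \<phi> x * y + x * lc \<phi> y" by (simp add: lc_counit)
  have "rc \<phi> x * rc \<epsilon> y + rc \<epsilon> x * rc \<phi> y = rc \<phi> (x * y)"
    by (simp add: rc_sum[OF assms(1) comult_mult_sum[OF ps qs]] sum_list_concat_pairs
        rc_sum[OF assms(1) ps] rc_sum[OF assms(1) qs] rc_sum[OF linear_counit ps] rc_sum[OF linear_counit qs]
        prod assms(2) scaleR_add_left)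
      (simp add: case_prod_unfold sum_list_addf mult.commute)
  then show "rc \<phi> (x * y) = rc \<phi> x * y + x * rc \<phi> y" by (simp add: rc_counit)
qed

text \<open>For a general functional the derivation rule fails: \<Delta> (q * u) is the sum of a
  \<otimes> q b and q a \<otimes> b over \<Delta> u, and the second kind of term contracts
  \<open>u\<close> with \<phi> composed with multiplication by q.\<close>

lemma lc_primitive_mult:
  assumes "linear \<phi>" "q \<in> primitives \<Delta>"
  shows "lc \<phi> (q * u) = lc (\<lambda>x. \<phi> (q * x)) u + q * lc \<phi> u"
proof -
  obtain ps where ps: "\<Delta> u = (\<Sum>(a, b)\<leftarrow>ps. tens [a, b])" by (rule comult_sum)
  have l: "linear (\<lambda>x. \<phi> (q * x))"
    using linear_compose[OF linear_mult_left assms(1)] by (simp add: o_def)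
  have q: "\<Delta> q = (\<Sum>(a, b)\<leftarrow>[(1, q), (q, 1)]. tens [a, b])"
    using assms(2) by (simp add: primitives_def)
  show ?thesis
    unfolding lc_sum[OF assms(1) comult_mult_sum[OF q ps]] sum_list_concat_pairs
      lc_sum[OF assms(1) ps] lc_sum[OF l ps]
    by (simp add: case_prod_unfold sum_list_const_mult[symmetric])
qed

section \<open>Consequences of coassociativity\<close>

lemma linear_comult_second: "linear (comult_second \<Delta>)"
proof -
  have "linear (\<lambda>y. tensor_append (tens [x]) (\<Delta> y))" for x
    using linear_compose[OF linear_comult linear_tensor_append_tens] by (simp add: o_def)
  moreover have "linear (\<lambda>x. tensor_append (tens [x]) t)" for t :: "'a tensor"
    using linear_compose[OF linear_tens[of "[]" "[]"] linear_tensor_append_left] by (simp add: o_def)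
  ultimately show ?thesis
    unfolding comult_second_def by (intro linear_tensor_lift multilinear_case2)
qed

lemma append_comult:
  assumes "\<Delta> x = (\<Sum>(a, b)\<leftarrow>ps. tens [a, b])"
  shows "tensor_append (\<Delta> x) (tens ys) = (\<Sum>(a, b)\<leftarrow>ps. tens (a # b # ys))"
  unfolding assms
  by (simp add: case_prod_unfold sum_list_linear[OF linear_tensor_append_left] tensor_append_tens)

lemma linear_comult_first: "linear (comult_first \<Delta>)"
  unfolding comult_first_def
proof (intro linear_tensor_lift, unfold multilinear_def, intro allI)
  fix xs ys
  show "linear (\<lambda>x. case xs @ x # ys of [] \<Rightarrow> 0 | x # ys \<Rightarrow> tensor_append (\<Delta> x) (tens ys))"
  proof (cases xs)
    case Nil
    then show ?thesis
      using linear_compose[OF linear_comult linear_tensor_append_left] by (simp add: o_def)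
  next
    case (Cons z zs)
    obtain ps where ps: "\<Delta> z = (\<Sum>(a, b)\<leftarrow>ps. tens [a, b])" by (rule comult_sum)
    have "linear (\<lambda>x. tens (a # b # zs @ x # ys))" for a b
      using linear_tens[of "a # b # zs" ys] by simp
    with Cons show ?thesis
      by (auto simp: append_comult[OF ps] intro!: linear_sum_list)
  qed
qed

text \<open>Coassociativity in Sweedler notation: a trilinear form takes the same value on both ways
  of splitting \<Delta> x into three factors. Commutation and associativity below are instances for
  explicit \<open>h\<close>.\<close>

lemma coassociative_lift3:
  assumes "\<And>x y. linear (h x y)" "\<And>x z. linear (\<lambda>y. h x y z)" "\<And>y z. linear (\<lambda>x. h x y z)"
    and ps: "\<Delta> x = (\<Sum>(a, b)\<leftarrow>ps. tens [a, b])"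
  shows "(\<Sum>(a, b)\<leftarrow>ps. tensor_lift2 (\<lambda>x y. h x y b) (\<Delta> a)) = (\<Sum>(a, b)\<leftarrow>ps. tensor_lift2 (h a) (\<Delta> b))"
proof -
  note l = linear_comult_second linear_comult_first
  have "(\<Sum>(a, b)\<leftarrow>ps. tensor_lift2 (\<lambda>x y. h x y b) (\<Delta> a)) = tensor_lift3 h (comult_first \<Delta> (\<Delta> x))"
    unfolding ps
    by (simp add: case_prod_unfold sum_list_linear[OF l(2)] comult_first_tens[OF linear_comult]
        sum_list_linear[OF linear_tensor_lift3[of h, OF assms(1-3)]] tensor_append_lift3[of h, OF assms(1-3)])
  also have "\<dots> = (\<Sum>(a, b)\<leftarrow>ps. tensor_lift2 (h a) (\<Delta> b))"
    unfolding coassociative unfolding ps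
    by (simp add: case_prod_unfold sum_list_linear[OF l(1)] comult_second_tens[OF linear_comult]
        sum_list_linear[OF linear_tensor_lift3[of h, OF assms(1-3)]] tensor_append_lift3[of h, OF assms(1-3)])
  finally show ?thesis .
qed

text \<open>Both sides equal the sum of \<phi>(x1) \<psi>(x3) x2 over the threefold coproduct x1
  \<otimes> x2 \<otimes> x3 of \<open>x\<close>.\<close>

lemma lc_rc_commute:
  assumes "linear \<phi>" "linear \<psi>"
  shows "lc \<phi> (rc \<psi> x) = rc \<psi> (lc \<phi> x)"
proof -
  obtain ps where ps: "\<Delta> x = (\<Sum>(a, b)\<leftarrow>ps. tens [a, b])" by (rule comult_sum)
  note l = linear_add[OF assms(1)] linear_scale[OF assms(1)] linear_add[OF assms(2)] linear_scale[OF assms(2)]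
  have "lc \<phi> (rc \<psi> x) = (\<Sum>(a, b)\<leftarrow>ps. tensor_lift2 (\<lambda>x y. \<phi> x *\<^sub>R \<psi> b *\<^sub>R y) (\<Delta> a))"
  proof -
    have "tensor_lift2 (\<lambda>x y. \<phi> x *\<^sub>R \<psi> b *\<^sub>R y) (\<Delta> a) = \<psi> b *\<^sub>R lc \<phi> a" for a b
    proof -
      obtain qs where qs: "\<Delta> a = (\<Sum>(a, b)\<leftarrow>qs. tens [a, b])" by (rule comult_sum)
      show ?thesis
        unfolding lc_sum[OF assms(1) qs] unfolding qs
        by (subst tensor_lift2_sum)
          (auto simp: l linear_iff algebra_simps case_prod_unfold
            sum_list_linear[OF real_vector.linear_scale_self, of "\<psi> b"])
    qed
    then show ?thesis
      by (simp add: rc_sum[OF assms(2) ps] sum_list_linear[OF linear_lc[OF assms(1)]] case_prod_unfold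
          linear_scale[OF linear_lc[OF assms(1)]])
  qed
  also have "\<dots> = (\<Sum>(a, b)\<leftarrow>ps. tensor_lift2 (\<lambda>x y. \<phi> a *\<^sub>R \<psi> y *\<^sub>R x) (\<Delta> b))"
    by (rule coassociative_lift3[OF _ _ _ ps]) (simp_all add: l linear_iff algebra_simps)
  also have "\<dots> = rc \<psi> (lc \<phi> x)"
  proof -
    have "tensor_lift2 (\<lambda>x y. \<phi> a *\<^sub>R \<psi> y *\<^sub>R x) (\<Delta> b) = \<phi> a *\<^sub>R rc \<psi> b" for a b
    proof -
      obtain qs where qs: "\<Delta> b = (\<Sum>(a, b)\<leftarrow>qs. tens [a, b])" by (rule comult_sum)
      show ?thesis
        unfolding rc_sum[OF assms(2) qs] unfolding qs
        by (subst tensor_lift2_sum)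
          (auto simp: l linear_iff algebra_simps case_prod_unfold
            sum_list_linear[OF real_vector.linear_scale_self, of "\<phi> a"])
    qed
    then show ?thesis
      by (simp add: lc_sum[OF assms(1) ps] sum_list_linear[OF linear_rc[OF assms(2)]] case_prod_unfold
          linear_scale[OF linear_rc[OF assms(2)]])
  qed
  finally show ?thesis .
qed

lemma conv_assoc:
  assumes "linear f" "linear g" "linear h"
  shows "conv (conv f g) h = conv f (conv g h)"
proof
  fix x
  obtain ps where ps: "\<Delta> x = (\<Sum>(a, b)\<leftarrow>ps. tens [a, b])" by (rule comult_sum)
  note l = linear_add[OF assms(1)] linear_scale[OF assms(1)] linear_add[OF assms(2)]
    linear_scale[OF assms(2)] linear_add[OF assms(3)] linear_scale[OF assms(3)]
  have "tensor_lift2 (\<lambda>x y. f x * g y * h b) (\<Delta> a) = conv f g a * h b" for a b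
  proof -
    obtain qs where qs: "\<Delta> a = (\<Sum>(a, b)\<leftarrow>qs. tens [a, b])" by (rule comult_sum)
    show ?thesis
      unfolding conv_sum[OF assms(1,2) qs] unfolding qs
      by (subst tensor_lift2_sum)
        (auto simp: l linear_iff distrib_left distrib_right case_prod_unfold sum_list_mult_const)
  qed
  then have "conv (conv f g) h x = (\<Sum>(a, b)\<leftarrow>ps. tensor_lift2 (\<lambda>x y. f x * g y * h b) (\<Delta> a))"
    by (simp add: conv_sum[OF linear_conv[OF assms(1,2)] assms(3) ps])
  also have "\<dots> = (\<Sum>(a, b)\<leftarrow>ps. tensor_lift2 (\<lambda>x y. f a * g x * h y) (\<Delta> b))"
    by (rule coassociative_lift3[OF _ _ _ ps]) (simp_all add: l linear_iff algebra_simps)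
  also have "\<dots> = conv f (conv g h) x"
  proof -
    have "tensor_lift2 (\<lambda>x y. f a * g x * h y) (\<Delta> b) = f a * conv g h b" for a b
    proof -
      obtain qs where qs: "\<Delta> b = (\<Sum>(a, b)\<leftarrow>qs. tens [a, b])" by (rule comult_sum)
      show ?thesis
        unfolding conv_sum[OF assms(2,3) qs] unfolding qs
        by (subst tensor_lift2_sum)
          (auto simp: l linear_iff algebra_simps case_prod_unfold sum_list_const_mult)
    qed
    then show ?thesis
      by (simp add: conv_sum[OF assms(1) linear_conv[OF assms(2,3)] ps])
  qed
  finally show "conv (conv f g) h x = conv f (conv g h) x" .
qed

lemma subspace_vimage_linear: "linear f \<Longrightarrow> subspace V \<Longrightarrow> subspace {x. f x \<in> V}"
  by (auto simp: subspace_def linear_0 linear_add linear_scale)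

text \<open>The grading of \<Delta> in usable form: to place a contraction of a homogeneous element
  in a subspace, it suffices to test pure tensors whose degrees add up to m.\<close>

lemma tensor_lift2_comult_in_subspace:
  assumes g: "\<And>x. linear (g x)" "\<And>y. linear (\<lambda>x. g x y)" and "subspace V" "x \<in> H m"
    and "\<And>i a b. i \<le> m \<Longrightarrow> a \<in> H i \<Longrightarrow> b \<in> H (m - i) \<Longrightarrow> g a b \<in> V"
  shows "tensor_lift2 g (\<Delta> x) \<in> V"
proof -
  have sub: "subspace {t. tensor_lift2 g t \<in> V}" (is "subspace ?U")
    by (rule subspace_vimage_linear[OF linear_tensor_lift2 assms(3)]) (rule g)+
  have "tensor_space [H i, H (m - i)] \<subseteq> ?U" if "i \<le> m" for i
    unfolding tensor_space_def
  proof (rule real_vector.span_minimal[OF _ sub])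
    show "{tens xs | xs. list_all2 (\<in>) xs [H i, H (m - i)]} \<subseteq> ?U"
      using assms(5)[OF that] by (auto simp: list_all2_Cons2 tensor_lift2_tens[of g, OF g])
  qed
  then have "span (\<Union>i\<le>m. tensor_space [H i, H (m - i)]) \<subseteq> ?U"
    using sub by (intro real_vector.span_minimal) auto
  with comult_graded[OF assms(4)] show ?thesis by auto
qed

lemma
  assumes "linear \<psi>" "subspace V" "x \<in> H m"
  shows lc_in_subspace: "(\<And>i a b. i \<le> m \<Longrightarrow> a \<in> H i \<Longrightarrow> b \<in> H (m - i) \<Longrightarrow> \<psi> a *\<^sub>R b \<in> V) \<Longrightarrow> lc \<psi> x \<in> V"
    and rc_in_subspace: "(\<And>i a b. i \<le> m \<Longrightarrow> a \<in> H i \<Longrightarrow> b \<in> H (m - i) \<Longrightarrow> \<psi> b *\<^sub>R a \<in> V) \<Longrightarrow> rc \<psi> x \<in> V"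
  unfolding lc_def rc_def
  by (rule tensor_lift2_comult_in_subspace[OF _ _ assms(2,3)];
      simp add: linear_iff linear_add[OF assms(1)] linear_scale[OF assms(1)] algebra_simps)+

end

section \<open>The operator as an iterated convolution\<close>

context graded_connected_hopf_algebra
begin

definition deg_functional :: "nat \<Rightarrow> ('a \<Rightarrow> real) \<Rightarrow> bool" where
  "deg_functional d \<phi> \<longleftrightarrow> linear \<phi> \<and> (\<forall>i x. i \<noteq> d \<longrightarrow> x \<in> H i \<longrightarrow> \<phi> x = 0)"

lemma deg_functional_component: "linear \<phi> \<Longrightarrow> deg_functional d (\<lambda>x. \<phi> (component H d x))"
  unfolding deg_functional_def
  using linear_compose[OF linear_component[of d], of \<phi>]
  by (auto simp: o_def component_H linear_0)

lemma
  assumes "deg_functional d \<phi>" "x \<in> H m"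
  shows lc_deg: "lc \<phi> x \<in> (if d \<le> m then H (m - d) else {0})"
    and rc_deg: "rc \<phi> x \<in> (if d \<le> m then H (m - d) else {0})"
proof -
  let ?V = "if d \<le> m then H (m - d) else {0}"
  have l: "linear \<phi>" and off: "\<And>i x. x \<in> H i \<Longrightarrow> i \<noteq> d \<Longrightarrow> \<phi> x = 0"
    using assms(1) by (auto simp: deg_functional_def)
  have V: "subspace ?V" by (simp add: subspace_H real_vector.subspace_single_0)
  have pair: "\<phi> a *\<^sub>R b \<in> ?V" "\<phi> b *\<^sub>R a \<in> ?V" if "i \<le> m" "a \<in> H i" "b \<in> H (m - i)" for i a b
  proof -
    show "\<phi> a *\<^sub>R b \<in> ?V"
      using that off[OF that(2)] by (cases "i = d") (auto simp: zero_H subspace_scale subspace_H)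
    show "\<phi> b *\<^sub>R a \<in> ?V"
      using that off[OF that(3)] by (cases "m - i = d") (auto simp: zero_H subspace_scale subspace_H)
  qed
  show "lc \<phi> x \<in> ?V" by (rule lc_in_subspace[OF l V assms(2) pair(1)])
  show "rc \<phi> x \<in> ?V" by (rule rc_in_subspace[OF l V assms(2) pair(2)])
qed

lemma deg_functional_one: "deg_functional d \<phi> \<Longrightarrow> 0 < d \<Longrightarrow> \<phi> 1 = 0"
  using one_H by (auto simp: deg_functional_def)

text \<open>By linearity both factors may be taken homogeneous. If one has degree 0 it is a scalar,
  by connectedness; if both have positive degree, the product has degree at least 2 and every term
  vanishes. A functional of higher degree need not vanish on such products, which explains the
  special part of \<open>H 1\<close>.\<close>

lemma deg1_functional_mult:
  assumes "deg_functional 1 \<phi>"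
  shows "\<phi> (a * b) = \<phi> a * \<epsilon> b + \<epsilon> a * \<phi> b"
proof -
  have l: "linear \<phi>" and off: "\<And>i x. i \<noteq> 1 \<Longrightarrow> x \<in> H i \<Longrightarrow> \<phi> x = 0"
    using assms by (auto simp: deg_functional_def)
  note lin = linear_add[OF l] linear_scale[OF l] linear_add[OF linear_counit] linear_scale[OF linear_counit]
  show ?thesis
  proof (rule linear_eq_on_H[where x = a])
    show "linear (\<lambda>a. \<phi> (a * b))" "linear (\<lambda>a. \<phi> a * \<epsilon> b + \<epsilon> a * \<phi> b)"
      by (simp_all add: linear_iff lin algebra_simps)
    fix i a assume a: "a \<in> H i"
    show "\<phi> (a * b) = \<phi> a * \<epsilon> b + \<epsilon> a * \<phi> b"
    proof (rule linear_eq_on_H[where x = b])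
      show "linear (\<lambda>b. \<phi> (a * b))" "linear (\<lambda>b. \<phi> a * \<epsilon> b + \<epsilon> a * \<phi> b)"
        by (simp_all add: linear_iff lin algebra_simps)
      fix j b assume b: "b \<in> H j"
      consider "i = 0" | "j = 0" | "i \<noteq> 0" "j \<noteq> 0" by blast
      then show "\<phi> (a * b) = \<phi> a * \<epsilon> b + \<epsilon> a * \<phi> b"
      proof cases
        case 1
        with a have "a = \<epsilon> a *\<^sub>R 1" "\<phi> a = 0" by (auto intro: H0_eq off)
        then have "\<phi> (a * b) = \<phi> ((\<epsilon> a *\<^sub>R 1) * b)" by metis
        then show ?thesis using \<open>\<phi> a = 0\<close> by (simp add: lin)
      next
        case 2
        with b have "b = \<epsilon> b *\<^sub>R 1" "\<phi> b = 0" by (auto intro: H0_eq off)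
        then have "\<phi> (a * b) = \<phi> (a * (\<epsilon> b *\<^sub>R 1))" by metis
        then show ?thesis using \<open>\<phi> b = 0\<close> by (simp add: lin)
      next
        case 3
        then show ?thesis
          using off[OF _ mult_graded[OF a b]] counit_graded[OF a] counit_graded[OF b] by simp
      qed
    qed
  qed
qed

text \<open>The contraction has degree 0, hence is a scalar by connectedness, and the counit
  determines which.\<close>

lemma H1_contraction:
  assumes "deg_functional 1 \<phi>" "x \<in> H 1"
  shows "lc \<phi> x = \<phi> x *\<^sub>R 1" "rc \<phi> x = \<phi> x *\<^sub>R 1"
proof -
  have l: "linear \<phi>" and off: "\<And>i x. i \<noteq> 1 \<Longrightarrow> x \<in> H i \<Longrightarrow> \<phi> x = 0"
    using assms by (auto simp: deg_functional_def)
  have "lc \<phi> x \<in> H 0" "rc \<phi> x \<in> H 0"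
    using lc_deg[OF assms] rc_deg[OF assms] by auto
  then show "lc \<phi> x = \<phi> x *\<^sub>R 1" "rc \<phi> x = \<phi> x *\<^sub>R 1"
    using H0_eq[of "lc \<phi> x"] H0_eq[of "rc \<phi> x"] by (simp_all add: counit_lc[OF l] counit_rc[OF l])
qed

section \<open>Multiplied iterated coproducts as convolution products\<close>

lemma mult_map_comult_first:
  fixes t :: "'a tensor"
  assumes "\<And>f. f \<in> set fs \<Longrightarrow> linear f" "linear f" "linear g"
    and t: "t \<in> span {tens xs | xs. length xs = Suc (length fs)}"
  shows "tensor_mult (tensor_map (f # g # fs) (comult_first \<Delta> t)) = tensor_mult (tensor_map (conv f g # fs) t)"
proof (rule linear_eq_on[OF _ _ t])
  have 1: "linear (tensor_map (f # g # fs))" "linear (tensor_map (conv f g # fs))"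
    using assms(1-3) by (intro linear_tensor_map; auto simp: linear_conv)+
  then show "linear (\<lambda>t. tensor_mult (tensor_map (f # g # fs) (comult_first \<Delta> t)))"
    "linear (\<lambda>t. tensor_mult (tensor_map (conv f g # fs) t))"
    using linear_compose[OF linear_compose[OF linear_comult_first 1(1)] linear_tensor_mult]
      linear_compose[OF 1(2) linear_tensor_mult]
    by (simp_all add: o_def)
  fix t :: "'a tensor" assume "t \<in> {tens xs | xs. length xs = Suc (length fs)}"
  then obtain y ys where y: "t = tens (y # ys)" "length ys = length fs"
    by (auto simp: length_Suc_conv)
  obtain ps where ps: "\<Delta> y = (\<Sum>(a, b)\<leftarrow>ps. tens [a, b])" by (rule comult_sum)
  have tm: "tensor_map (f # g # fs) (tens (a # b # ys)) = tens (f a # g b # map2 (\<lambda>f x. f x) fs ys)"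
    for a b
    using assms(1-3) y(2) by (subst tensor_map_tens) auto
  have "tensor_mult (tensor_map (f # g # fs) (comult_first \<Delta> t)) =
      (\<Sum>(a, b)\<leftarrow>ps. f a * (g b * prod_list (map2 (\<lambda>f x. f x) fs ys)))"
    unfolding y(1) comult_first_tens[OF linear_comult] append_comult[OF ps]
    by (simp add: sum_list_linear[OF 1(1)] sum_list_linear[OF linear_tensor_mult] case_prod_unfold
        tm tensor_mult_tens)
  also have "\<dots> = conv f g y * prod_list (map2 (\<lambda>f x. f x) fs ys)"
    by (simp add: conv_sum[OF assms(2,3) ps] case_prod_unfold sum_list_mult_const[symmetric] mult.assoc)
  also have "\<dots> = tensor_mult (tensor_map (conv f g # fs) t)"
    using assms(1-3) y(2) unfolding y(1) by (subst tensor_map_tens) (auto simp: linear_conv tensor_mult_tens)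
  finally show "tensor_mult (tensor_map (f # g # fs) (comult_first \<Delta> t)) = tensor_mult (tensor_map (conv f g # fs) t)" .
qed

lemma comult_first_funpow_length:
  "(comult_first \<Delta> ^^ k) (tens [x]) \<in> span {tens xs | xs. length xs = Suc k}"
proof (induction k)
  case 0
  have "tens [x] \<in> {tens xs | xs. length xs = Suc 0}" by force
  then show ?case by (simp add: real_vector.span_base)
next
  case (Suc k)
  have "comult_first \<Delta> t \<in> span {tens xs | xs. length xs = Suc (Suc k)}"
    if "t \<in> span {tens xs | xs. length xs = Suc k}" for t
    using that
  proof (induction rule: real_vector.span_induct_alt)
    case base
    show ?case by (simp add: linear_0[OF linear_comult_first] real_vector.span_zero)
  next
    case (step c t u)
    then obtain y ys where y: "t = tens (y # ys)" "length ys = k"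
      by (auto simp: length_Suc_conv)
    obtain ps where ps: "\<Delta> y = (\<Sum>(a, b)\<leftarrow>ps. tens [a, b])" by (rule comult_sum)
    have "(\<Sum>(a, b)\<leftarrow>ps. tens (a # b # ys)) \<in> span {tens xs | xs. length xs = Suc (Suc k)}"
    proof (induction ps)
      case (Cons p ps)
      have "tens (fst p # snd p # ys) \<in> span {tens xs | xs. length xs = Suc (Suc k)}"
        using y(2) by (intro real_vector.span_base CollectI exI[of _ "fst p # snd p # ys"]) simp
      with Cons show ?case by (simp add: case_prod_unfold real_vector.span_add)
    qed (simp add: real_vector.span_zero)
    with step show ?case
      by (simp add: linear_add[OF linear_comult_first] linear_scale[OF linear_comult_first]
          y(1) comult_first_tens[OF linear_comult] append_comult[OF ps] real_vector.span_add real_vector.span_scale)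
  qed
  with Suc show ?case by simp
qed

text \<open>\<open>comult_first\<close> always splits the leading factor, which is why the
  convolution product is bracketed to the left.\<close>

lemma mult_comult_eq_conv:
  assumes "linear f" "\<And>g. g \<in> set fs \<Longrightarrow> linear g"
  shows "tensor_mult (tensor_map (f # fs) ((comult_first \<Delta> ^^ length fs) (tens [x]))) = foldl conv f fs x"
  using assms
proof (induction fs arbitrary: f)
  case Nil
  then have "tensor_map [f] (tens [x]) = tens [f x]" by (subst tensor_map_tens) auto
  then show ?case by (simp add: tensor_mult_tens)
next
  case (Cons g fs)
  have "tensor_mult (tensor_map (f # g # fs) ((comult_first \<Delta> ^^ length (g # fs)) (tens [x]))) =
    tensor_mult (tensor_map (conv f g # fs) ((comult_first \<Delta> ^^ length fs) (tens [x])))"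
    using mult_map_comult_first[OF _ _ _ comult_first_funpow_length] Cons.prems by simp
  also have "\<dots> = foldl conv (conv f g) fs x"
    using Cons.prems by (intro Cons.IH linear_conv) auto
  finally show ?case by simp
qed

end

text \<open>A choice of coordinates on \<open>H 1\<close>, made inside the proof only. The
  functionals are indexed by all elements; for \<open>a\<close> outside \<open>C\<close> the
  conditions force \<open>\<phi> a\<close> to vanish, so statements for all \<open>a\<close> and for
  \<open>a \<in> C\<close> amount to the same.\<close>

locale H1_dual_basis = graded_connected_hopf_algebra H \<Delta> \<epsilon> S
  for H :: "nat \<Rightarrow> 'a::real_algebra_1 set" and \<Delta> \<epsilon> S +
  fixes C :: "'a set" and \<phi> :: "'a \<Rightarrow> 'a \<Rightarrow> real"
  assumes finite_C: "finite C" and independent_C: "independent C" and span_C: "span C = H 1"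
    and deg_functional_\<phi>: "deg_functional 1 (\<phi> a)"
    and \<phi>_C: "x \<in> C \<Longrightarrow> \<phi> a x = (if x = a then 1 else 0)"

lemma (in graded_connected_hopf_algebra) H1_dual_basis_exists:
  "\<exists>C \<phi>. H1_dual_basis H \<Delta> \<epsilon> S C \<phi>"
proof -
  obtain B where B: "finite B" "span B = H 1" using finite_dimensional by blast
  obtain C where C: "C \<subseteq> B" "independent C" "B \<subseteq> span C"
    using real_vector.maximal_independent_subset by blast
  have sC: "span C = H 1"
    using C B(2) by (metis real_vector.span_mono real_vector.span_span subset_antisym)
  obtain \<psi> :: "'a \<Rightarrow> 'a \<Rightarrow> real" where \<psi>: "\<And>e. linear (\<psi> e)"
      "\<And>e x. x \<in> C \<Longrightarrow> \<psi> e x = (if x = e then 1 else 0)"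
    using dual_functionals[OF C(2)] by blast
  have fix_C: "component H 1 x = x" if "x \<in> C" for x
    using sC real_vector.span_base[OF that] by (simp add: component_H)
  have "H1_dual_basis H \<Delta> \<epsilon> S C (\<lambda>a x. \<psi> a (component H 1 x))"
  proof (intro H1_dual_basis.intro H1_dual_basis_axioms.intro)
    show "graded_connected_hopf_algebra H \<Delta> \<epsilon> S"
      by (rule graded_connected_hopf_algebra_axioms)
    show "finite C" using C(1) B(1) by (rule finite_subset)
  qed (use C(2) sC \<psi> fix_C in \<open>simp_all add: deg_functional_component del: One_nat_def\<close>)
  then show ?thesis by blast
qed

section \<open>The operator in coordinates of degree 1\<close>

context H1_dual_basis
begin

lemma C_H1: "C \<subseteq> H 1"
  using span_C real_vector.span_superset by blast

lemma linear_\<phi>: "linear (\<phi> a)"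
  using deg_functional_\<phi> by (simp add: deg_functional_def)

lemma \<phi>_off: "x \<in> H m \<Longrightarrow> m \<noteq> 1 \<Longrightarrow> \<phi> a x = 0"
  using deg_functional_\<phi> by (auto simp: deg_functional_def)

lemma \<phi>_expansion: "x \<in> H 1 \<Longrightarrow> (\<Sum>a\<in>C. \<phi> a x *\<^sub>R a) = x"
  using dual_functionals_expansion[of C \<phi> x] finite_C linear_\<phi> \<phi>_C span_C by blast

text \<open>The projection to \<open>H 1\<close> has finite rank; expanding it along
  \<open>C\<close> turns convolution with it into the sums of \<open>opL\<close> and
  \<open>opR\<close>.\<close>

lemma component_1_eq: "component H 1 x = (\<Sum>a\<in>C. \<phi> a x *\<^sub>R a)"
proof (rule linear_eq_on_H[where f = "component H 1" and x = x])
  show "linear (component H 1)" by (rule linear_component)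
  show "linear (\<lambda>x. \<Sum>a\<in>C. \<phi> a x *\<^sub>R a)"
    by (intro linear_compose_sum linear_scaleR_fun linear_\<phi> ballI)
  fix m x assume "x \<in> H m"
  then show "component H 1 x = (\<Sum>a\<in>C. \<phi> a x *\<^sub>R a)"
    by (cases "m = 1") (simp_all add: component_H \<phi>_off \<phi>_expansion)
qed

abbreviation D :: "'a \<Rightarrow> 'a \<Rightarrow> 'a" where "D a \<equiv> lc (\<phi> a)"
abbreviation D' :: "'a \<Rightarrow> 'a \<Rightarrow> 'a" where "D' a \<equiv> rc (\<phi> a)"

text \<open>\<open>opL Y\<close> and \<open>opR Y\<close> are the convolution products of
  \<open>Y\<close> with the projection to \<open>H 1\<close> on the left and on the right.
  Transforming operators, not elements, makes the r-fold versions mere iterates.\<close>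

definition opL :: "('a \<Rightarrow> 'a) \<Rightarrow> 'a \<Rightarrow> 'a" where
  "opL Y x = (\<Sum>a\<in>C. a * Y (D a x))"

definition opR :: "('a \<Rightarrow> 'a) \<Rightarrow> 'a \<Rightarrow> 'a" where
  "opR Y x = (\<Sum>a\<in>C. Y (D' a x) * a)"

lemma linear_D: "linear (D a)" and linear_D': "linear (D' a)"
  by (simp_all add: linear_lc linear_rc linear_\<phi>)

lemma D_mult: "D a (x * y) = D a x * y + x * D a y"
  and D'_mult: "D' a (x * y) = D' a x * y + x * D' a y"
  using lc_derivation rc_derivation linear_\<phi> deg1_functional_mult[OF deg_functional_\<phi>] by blast+

lemma D_H: "x \<in> H m \<Longrightarrow> D a x \<in> H (m - 1)" "x \<in> H 0 \<Longrightarrow> D a x = 0"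
  and D'_H: "x \<in> H m \<Longrightarrow> D' a x \<in> H (m - 1)" "x \<in> H 0 \<Longrightarrow> D' a x = 0"
  using lc_deg[OF deg_functional_\<phi>, of x m a] lc_deg[OF deg_functional_\<phi>, of x 0 a]
    rc_deg[OF deg_functional_\<phi>, of x m a] rc_deg[OF deg_functional_\<phi>, of x 0 a]
  by (cases "1 \<le> m"; auto simp: zero_H)+

lemma linear_opL: "linear Y \<Longrightarrow> linear (opL Y)"
  unfolding opL_def
  by (intro linear_compose_sum ballI linear_mult_left_fun)
    (use linear_compose[OF linear_D] in \<open>auto simp: o_def\<close>)

lemma linear_opR: "linear Y \<Longrightarrow> linear (opR Y)"
  unfolding opR_def
  by (intro linear_compose_sum ballI linear_mult_right_fun)
    (use linear_compose[OF linear_D'] in \<open>auto simp: o_def\<close>)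

lemma linear_opL_funpow: "linear Y \<Longrightarrow> linear ((opL ^^ k) Y)"
  and linear_opR_funpow: "linear Y \<Longrightarrow> linear ((opR ^^ k) Y)"
  by (induction k) (simp_all add: linear_opL linear_opR)

lemma conv_component_left:
  assumes "linear Y"
  shows "conv (component H 1) Y = opL Y"
proof
  fix x
  obtain ps where ps: "\<Delta> x = (\<Sum>(a, b)\<leftarrow>ps. tens [a, b])" by (rule comult_sum)
  have "conv (component H 1) Y x = (\<Sum>(a, b)\<leftarrow>ps. \<Sum>c\<in>C. c * (\<phi> c a *\<^sub>R Y b))"
    by (simp add: conv_sum[OF linear_component assms ps] component_1_eq sum_distrib_right del: One_nat_def)
  also have "\<dots> = (\<Sum>c\<in>C. \<Sum>(a, b)\<leftarrow>ps. c * (\<phi> c a *\<^sub>R Y b))"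
    by (induction ps) (auto simp: sum.distrib)
  also have "\<dots> = opL Y x"
    unfolding opL_def
    by (intro sum.cong refl)
      (simp add: lc_sum[OF linear_\<phi> ps] sum_list_linear[OF assms] case_prod_unfold
        linear_scale[OF assms] sum_list_linear[OF linear_mult_left])
  finally show "conv (component H 1) Y x = opL Y x" .
qed

lemma conv_component_right:
  assumes "linear Y"
  shows "conv Y (component H 1) = opR Y"
proof
  fix x
  obtain ps where ps: "\<Delta> x = (\<Sum>(a, b)\<leftarrow>ps. tens [a, b])" by (rule comult_sum)
  have "conv Y (component H 1) x = (\<Sum>(a, b)\<leftarrow>ps. \<Sum>c\<in>C. (\<phi> c b *\<^sub>R Y a) * c)"
    by (simp add: conv_sum[OF assms linear_component ps] component_1_eq sum_distrib_left del: One_nat_def)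
  also have "\<dots> = (\<Sum>c\<in>C. \<Sum>(a, b)\<leftarrow>ps. (\<phi> c b *\<^sub>R Y a) * c)"
    by (induction ps) (auto simp: sum.distrib)
  also have "\<dots> = opR Y x"
    unfolding opR_def
    by (intro sum.cong refl)
      (simp add: rc_sum[OF linear_\<phi> ps] sum_list_linear[OF assms] case_prod_unfold
        linear_scale[OF assms] sum_list_linear[OF linear_mult_right])
  finally show "conv Y (component H 1) x = opR Y x" .
qed

lemma conv_foldl_component:
  assumes "linear Z" "linear Y"
  shows "conv (foldl conv Z (replicate k (component H 1))) Y = conv Z ((opL ^^ k) Y)"
  using assms(1)
proof (induction k arbitrary: Z)
  case (Suc k)
  then show ?case
    by (simp add: linear_conv linear_component conv_assoc linear_opL_funpow assms(2) conv_component_left del: One_nat_def)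
qed simp

lemma foldl_conv_component:
  "linear Z \<Longrightarrow> foldl conv Z (replicate k (component H 1)) = (opR ^^ k) Z"
  by (induction k arbitrary: Z)
    (simp_all add: conv_component_right linear_opR funpow_swap1 del: One_nat_def)

text \<open>In the convolution algebra the operator is e^r p e^r up to a scalar, with e the
  projection to degree 1 and p the one to degree n - 2r; associativity lets the left powers be
  absorbed one by one into the middle factor.\<close>

lemma TaBr2R_opR_opL:
  assumes "1 \<le> r"
  shows "TaBr2R H \<Delta> r n x =
    (1 / falling n (2 * r)) *\<^sub>R (opR ^^ r) ((opL ^^ r) (component H (n - 2 * r))) x"
proof -
  \<comment> \<open>The left fold starts from the first of the projections, so r - 1 of the left
    ones remain in the list.\<close>
  obtain r' where r: "r = Suc r'" using assms by (cases r) auto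
  let ?e = "component H 1" and ?p = "component H (n - 2 * r)"
  let ?fs = "replicate r' ?e @ [?p] @ replicate r ?e"
  have "tensor_mult (comult_wc H \<Delta> (replicate r 1 @ [n - 2 * r] @ replicate r 1) x) =
      tensor_mult (tensor_map (?e # ?fs) ((comult_first \<Delta> ^^ length ?fs) (tens [x])))"
    by (simp add: comult_wc_def r)
  also have "\<dots> = foldl conv ?e ?fs x"
    by (rule mult_comult_eq_conv) (auto simp: linear_component)
  also have "foldl conv ?e ?fs = (opR ^^ r) ((opL ^^ r) ?p)"
  proof -
    have "conv (foldl conv ?e (replicate r' ?e)) ?p = (opL ^^ r) ?p"
      by (subst conv_foldl_component)
        (simp_all add: linear_component conv_component_left linear_opL_funpow r del: One_nat_def)
    then have "foldl conv ?e ?fs = foldl conv ((opL ^^ r) ?p) (replicate r ?e)"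
      by (simp del: replicate.simps)
    then show ?thesis
      by (simp only: foldl_conv_component linear_opL_funpow linear_component)
  qed
  finally show ?thesis by (simp add: TaBr2R_def)
qed

lemma linear_TaBr2R: "1 \<le> r \<Longrightarrow> linear (TaBr2R H \<Delta> r n)"
  by (subst ext[OF TaBr2R_opR_opL], assumption)
    (intro linear_compose_scale_right linear_opR_funpow linear_opL_funpow linear_component)

lemma opL_cong_H: "(\<And>x. x \<in> H m \<Longrightarrow> Y x = Y' x) \<Longrightarrow> x \<in> H (Suc m) \<Longrightarrow> opL Y x = opL Y' x"
  and opR_cong_H: "(\<And>x. x \<in> H m \<Longrightarrow> Y x = Y' x) \<Longrightarrow> x \<in> H (Suc m) \<Longrightarrow> opR Y x = opR Y' x"
  unfolding opL_def opR_def using D_H(1)[of x "Suc m"] D'_H(1)[of x "Suc m"] by auto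

lemma opL_funpow_cong_H:
  "(\<And>x. x \<in> H m \<Longrightarrow> Y x = Y' x) \<Longrightarrow> x \<in> H (k + m) \<Longrightarrow> (opL ^^ k) Y x = (opL ^^ k) Y' x"
  by (induction k arbitrary: x) (simp, simp, rule opL_cong_H, auto)

lemma opR_funpow_cong_H:
  "(\<And>x. x \<in> H m \<Longrightarrow> Y x = Y' x) \<Longrightarrow> x \<in> H (k + m) \<Longrightarrow> (opR ^^ k) Y x = (opR ^^ k) Y' x"
  by (induction k arbitrary: x) (simp, simp, rule opR_cong_H, auto)

text \<open>On \<open>H n\<close> the 2r contractions have lowered the degree to n - 2r before the
  middle projection acts, so it may be replaced by the identity. What remains depends on n only
  through the scalar.\<close>

lemma TaBr2R_eq:
  assumes "1 \<le> r" "2 * r \<le> n" "x \<in> H n"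
  shows "TaBr2R H \<Delta> r n x = (1 / falling n (2 * r)) *\<^sub>R (opR ^^ r) ((opL ^^ r) id) x"
proof -
  have "(opR ^^ r) ((opL ^^ r) (component H (n - 2 * r))) x = (opR ^^ r) ((opL ^^ r) id) x"
  proof (rule opR_funpow_cong_H)
    show "x \<in> H (r + (r + (n - 2 * r)))" using assms by simp
    show "(opL ^^ r) (component H (n - 2 * r)) y = (opL ^^ r) id y" if "y \<in> H (r + (n - 2 * r))" for y
      using that by (rule opL_funpow_cong_H[rotated]) (simp add: component_H)
  qed
  then show ?thesis by (simp add: TaBr2R_opR_opL[OF assms(1)])
qed

end

section \<open>Symmetrised products\<close>

text \<open>Distinct arrangements instead of permutations: removing the first letter then runs over
  \<open>set_mset M\<close> without multiplicities. The two sums differ by the order of a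
  stabiliser.\<close>

definition msym :: "'a::ring_1 multiset \<Rightarrow> 'a" where
  "msym M = (\<Sum>l\<in>permutations_of_multiset M. prod_list l)"

text \<open>The sum over the distinct arrangements \<open>l\<close> of \<open>M\<close> of the words obtained by inserting
  \<open>p\<close> after the first \<open>i\<close> letters of \<open>l\<close>.\<close>

primrec msand :: "nat \<Rightarrow> 'a::ring_1 multiset \<Rightarrow> 'a \<Rightarrow> 'a" where
  "msand 0 M p = p * msym M"
| "msand (Suc i) M p = (\<Sum>x\<in>set_mset M. x * msand i (M - {#x#}) p)"

lemma msym_empty [simp]: "msym {#} = 1"
  by (simp add: msym_def)

lemma sum_permutations_of_multiset:
  assumes "M \<noteq> {#}"
  shows "(\<Sum>l\<in>permutations_of_multiset M. f l) =
    (\<Sum>x\<in>set_mset M. \<Sum>l\<in>permutations_of_multiset (M - {#x#}). f (x # l))"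
  unfolding permutations_of_multiset_nonempty[OF assms]
  by (subst sum.UNION_disjoint) (auto simp: sum.reindex)

lemma msym_rec: "M \<noteq> {#} \<Longrightarrow> msym M = (\<Sum>x\<in>set_mset M. x * msym (M - {#x#}))"
  unfolding msym_def by (simp add: sum_permutations_of_multiset sum_distrib_left)

text \<open>Two letters are removed in succession; the pairs are symmetric because y remains after
  removing x exactly if x remains after removing y. All exchanges of first and last letters rest on
  this.\<close>

lemma sum_set_mset_swap:
  "(\<Sum>x\<in>set_mset M. \<Sum>y\<in>set_mset (M - {#x#}). f x y) =
    (\<Sum>y\<in>set_mset M. \<Sum>x\<in>set_mset (M - {#y#}). f x y)"
proof -
  let ?A = "set_mset M"
  have eq: "set_mset (M - {#x#}) = {y\<in>?A. y \<in># M - {#x#}}" for x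
    by (auto dest: in_diffD)
  have sym: "y \<in># M - {#x#} \<longleftrightarrow> x \<in># M - {#y#}" if "x \<in># M" "y \<in># M" for x y
    using that by (cases "x = y") (auto simp: in_diff_count)
  have "(\<Sum>x\<in>?A. \<Sum>y\<in>set_mset (M - {#x#}). f x y) = (\<Sum>x\<in>?A. \<Sum>y\<in>{y\<in>?A. y \<in># M - {#x#}}. f x y)"
    using eq by simp
  also have "\<dots> = (\<Sum>y\<in>?A. \<Sum>x\<in>{x\<in>?A. y \<in># M - {#x#}}. f x y)"
    by (rule sum.swap_restrict) auto
  also have "\<dots> = (\<Sum>y\<in>?A. \<Sum>x\<in>{x\<in>?A. x \<in># M - {#y#}}. f x y)"
    by (intro sum.cong refl) (use sym in auto)
  also have "\<dots> = (\<Sum>y\<in>?A. \<Sum>x\<in>set_mset (M - {#y#}). f x y)"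
    using eq by simp
  finally show ?thesis .
qed

lemma msym_rec_right: "M \<noteq> {#} \<Longrightarrow> msym M = (\<Sum>x\<in>set_mset M. msym (M - {#x#}) * x)"
proof (induction "size M" arbitrary: M rule: less_induct)
  case less
  show ?case
  proof (cases "\<exists>x. M = {#x#}")
    case True
    then show ?thesis by (auto simp: msym_def)
  next
    case False
    have ne: "M - {#x#} \<noteq> {#}" if "x \<in># M" for x
      using that False by (metis insert_DiffM)
    have "msym M = (\<Sum>x\<in>set_mset M. \<Sum>y\<in>set_mset (M - {#x#}). x * (msym (M - {#x#} - {#y#}) * y))"
      using less.prems ne by (subst msym_rec) (auto intro!: sum.cong simp: less.hyps size_Diff1_less sum_distrib_left)
    also have "\<dots> = (\<Sum>y\<in>set_mset M. \<Sum>x\<in>set_mset (M - {#y#}). x * (msym (M - {#x#} - {#y#}) * y))"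
      by (rule sum_set_mset_swap)
    also have "\<dots> = (\<Sum>y\<in>set_mset M. msym (M - {#y#}) * y)"
      using ne by (intro sum.cong refl)
        (subst msym_rec[OF ne], auto simp: sum_distrib_right mult.assoc add_mset_commute)
    finally show ?thesis .
  qed
qed

text \<open>Counterpart of the recursion at the right end. The condition \<open>i < size M\<close>
  ensures that a letter stands to the right of p; for \<open>i = size M\<close> the left side would
  be 0.\<close>

lemma msand_right:
  "i < size M \<Longrightarrow> (\<Sum>x\<in>set_mset M. msand i (M - {#x#}) p * x) = msand i M p"
proof (induction i arbitrary: M)
  case 0
  then show ?case by (subst msand.simps, subst msym_rec_right) (auto simp: sum_distrib_left mult.assoc)
next
  case (Suc i)
  have "(\<Sum>x\<in>set_mset M. msand (Suc i) (M - {#x#}) p * x) =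
    (\<Sum>x\<in>set_mset M. \<Sum>y\<in>set_mset (M - {#x#}). y * msand i (M - {#x#} - {#y#}) p * x)"
    by (simp add: sum_distrib_right)
  also have "\<dots> = (\<Sum>y\<in>set_mset M. \<Sum>x\<in>set_mset (M - {#y#}). y * msand i (M - {#x#} - {#y#}) p * x)"
    by (rule sum_set_mset_swap)
  also have "\<dots> = (\<Sum>y\<in>set_mset M. y * (\<Sum>x\<in>set_mset (M - {#y#}). msand i (M - {#y#} - {#x#}) p * x))"
    by (simp add: sum_distrib_left mult.assoc add_mset_commute)
  also have "\<dots> = msand (Suc i) M p"
    unfolding msand.simps
  proof (intro sum.cong refl arg_cong[of _ _ "(*) _"] Suc.IH)
    show "i < size (M - {#y#})" if "y \<in># M" for y
      using that Suc.prems by (simp add: size_Diff_singleton)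
  qed
  finally show ?case .
qed

lemma msand_size: "msand (size M) M p = msym M * p"
proof (induction "size M" arbitrary: M)
  case 0
  then show ?case by simp
next
  case (Suc k)
  then have "M \<noteq> {#}" by auto
  have "msand (size M) M p = (\<Sum>x\<in>set_mset M. x * msand k (M - {#x#}) p)"
    by (simp flip: Suc.hyps(2))
  also have "\<dots> = (\<Sum>x\<in>set_mset M. x * (msym (M - {#x#}) * p))"
  proof (intro sum.cong refl)
    fix x assume "x \<in># M"
    then have "k = size (M - {#x#})" using Suc.hyps(2) by (simp add: size_Diff_singleton)
    with Suc.hyps(1)[OF this] show "x * msand k (M - {#x#}) p = x * (msym (M - {#x#}) * p)" by simp
  qed
  also have "\<dots> = msym M * p"
    using msym_rec[OF \<open>M \<noteq> {#}\<close>] by (simp add: sum_distrib_right mult.assoc)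
  finally show ?case .
qed

lemma msand_eq_sum:
  "i \<le> size M \<Longrightarrow> msand i M p =
    (\<Sum>l\<in>permutations_of_multiset M. prod_list (take i l) * p * prod_list (drop i l))"
proof (induction i arbitrary: M)
  case 0
  then show ?case by (simp add: msym_def sum_distrib_left)
next
  case (Suc i)
  then have "M \<noteq> {#}" by auto
  have "msand (Suc i) M p = (\<Sum>x\<in>set_mset M. x *
      (\<Sum>l\<in>permutations_of_multiset (M - {#x#}). prod_list (take i l) * p * prod_list (drop i l)))"
    unfolding msand.simps
    by (intro sum.cong refl arg_cong[of _ _ "(*) _"] Suc.IH)
      (use Suc.prems in \<open>auto simp: size_Diff_singleton\<close>)
  then show ?case
    by (simp add: sum_permutations_of_multiset[OF \<open>M \<noteq> {#}\<close>] sum_distrib_left mult.assoc)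
qed

text \<open>All fibres of the map from permutations to arrangements are translates of the stabiliser.\<close>

lemma sum_permutes_eq:
  obtains N :: nat where "0 < N"
    "\<And>F :: 'a list \<Rightarrow> 'b::real_vector. (\<Sum>\<sigma> | \<sigma> permutes {..<length cs}. F (permute_list \<sigma> cs)) =
      real N *\<^sub>R (\<Sum>l\<in>permutations_of_multiset (mset cs). F l)"
proof -
  let ?P = "{\<sigma>. \<sigma> permutes {..<length cs}}"
  let ?N = "card {\<sigma>\<in>?P. permute_list \<sigma> cs = cs}"
  have fin: "finite ?P" by (rule finite_permutations) simp
  have "id \<in> {\<sigma>\<in>?P. permute_list \<sigma> cs = cs}" by (simp add: permutes_id)
  then have "{\<sigma>\<in>?P. permute_list \<sigma> cs = cs} \<noteq> {}" by blast
  moreover have "finite {\<sigma>\<in>?P. permute_list \<sigma> cs = cs}" using fin by simp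
  ultimately have pos: "0 < ?N" using card_gt_0_iff by blast
  have fibre: "card {\<sigma>\<in>?P. permute_list \<sigma> cs = l} = ?N" if "l \<in> permutations_of_multiset (mset cs)" for l
  proof -
    have "mset l = mset cs" using that by (rule permutations_of_multisetD)
    then obtain \<tau> where \<tau>: "\<tau> permutes {..<length cs}" "permute_list \<tau> cs = l"
      using mset_eq_permutation by blast
    have inv: "inv_into UNIV \<tau> permutes {..<length cs}" using \<tau>(1) by (rule permutes_inv)
    have inv_l: "permute_list (inv_into UNIV \<tau>) l = cs"
      using permute_list_compose[OF inv, of \<tau>] \<tau> by (simp add: permutes_inv_o)
    have "bij_betw (\<lambda>\<sigma>. \<sigma> \<circ> \<tau>) {\<sigma>\<in>?P. permute_list \<sigma> cs = cs} {\<sigma>\<in>?P. permute_list \<sigma> cs = l}"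
    proof (rule bij_betw_byWitness[where f' = "\<lambda>\<sigma>. \<sigma> \<circ> inv_into UNIV \<tau>"])
      show "\<forall>\<sigma>\<in>{\<sigma>\<in>?P. permute_list \<sigma> cs = cs}. (\<sigma> \<circ> \<tau>) \<circ> inv_into UNIV \<tau> = \<sigma>"
        by (simp add: comp_assoc permutes_inv_o[OF \<tau>(1)])
      show "\<forall>\<sigma>\<in>{\<sigma>\<in>?P. permute_list \<sigma> cs = l}. (\<sigma> \<circ> inv_into UNIV \<tau>) \<circ> \<tau> = \<sigma>"
        by (simp add: comp_assoc permutes_inv_o[OF \<tau>(1)])
      show "(\<lambda>\<sigma>. \<sigma> \<circ> \<tau>) ` {\<sigma>\<in>?P. permute_list \<sigma> cs = cs} \<subseteq> {\<sigma>\<in>?P. permute_list \<sigma> cs = l}"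
        using \<tau> by (auto simp: permute_list_compose intro: permutes_compose)
      show "(\<lambda>\<sigma>. \<sigma> \<circ> inv_into UNIV \<tau>) ` {\<sigma>\<in>?P. permute_list \<sigma> cs = l} \<subseteq> {\<sigma>\<in>?P. permute_list \<sigma> cs = cs}"
        using inv inv_l by (auto simp: permute_list_compose intro: permutes_compose)
    qed
    then show ?thesis by (rule bij_betw_same_card[symmetric])
  qed
  have "(\<Sum>\<sigma>\<in>?P. F (permute_list \<sigma> cs)) = real ?N *\<^sub>R (\<Sum>l\<in>permutations_of_multiset (mset cs). F l)"
    for F :: "'a list \<Rightarrow> 'b"
  proof -
    have img: "(\<lambda>\<sigma>. permute_list \<sigma> cs) ` ?P \<subseteq> permutations_of_multiset (mset cs)"
      by (auto intro!: permutations_of_multisetI)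
    have "(\<Sum>\<sigma>\<in>?P. F (permute_list \<sigma> cs)) =
      (\<Sum>l\<in>permutations_of_multiset (mset cs). \<Sum>\<sigma>\<in>{\<sigma>\<in>?P. permute_list \<sigma> cs = l}. F (permute_list \<sigma> cs))"
      by (rule sum.group[symmetric, OF fin finite_permutations_of_multiset img])
    also have "\<dots> = (\<Sum>l\<in>permutations_of_multiset (mset cs). real (card {\<sigma>\<in>?P. permute_list \<sigma> cs = l}) *\<^sub>R F l)"
      by (intro sum.cong refl) (simp add: sum_constant_scaleR)
    also have "\<dots> = real ?N *\<^sub>R (\<Sum>l\<in>permutations_of_multiset (mset cs). F l)"
      using fibre by (simp add: scaleR_sum_right)
    finally show ?thesis .
  qed
  then show thesis by (rule that[OF pos])
qed

section \<open>From permutations to distinct arrangements\<close>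

lemma perm_prod_permute:
  assumes "\<sigma> permutes {..<length cs}" "i \<le> length cs"
  shows "perm_prod cs \<sigma> [0..<i] = prod_list (take i (permute_list \<sigma> cs))"
    and "perm_prod cs \<sigma> [i..<length cs] = prod_list (drop i (permute_list \<sigma> cs))"
  using assms by (simp_all add: perm_prod_def permute_list_def take_map drop_map)

text \<open>Unites the two kinds of eigenvectors: for j < 2r all letters stand in front of p, which
  is the case i = j.\<close>

definition eig_coeff :: "nat \<Rightarrow> nat \<Rightarrow> nat \<Rightarrow> real" where
  "eig_coeff r j i = (if j < 2 * r then if i = j then 1 else 0
     else if i \<in> {r..j - r} then real (((j - r) choose i) * ((j - r) choose (i - r))) else 0)"

text \<open>The factor is the order of the stabiliser of \<open>cs\<close>. It is obtained once for
  all r and p and for \<open>sym_prod\<close>, so that all sums over permutations are replaced with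
  the same factor.\<close>

lemma eigvec_msand:
  obtains N :: nat where "0 < N"
    "\<And>r p. eigvec r cs p =
      real N *\<^sub>R (\<Sum>i\<le>length cs. eig_coeff r (length cs) i *\<^sub>R msand i (mset cs) (p::'a::real_algebra_1))"
    "sym_prod cs = real N *\<^sub>R msym (mset cs)"
proof -
  let ?P = "{\<sigma>. \<sigma> permutes {..<length cs}}" and ?j = "length cs"
  obtain N :: nat where N: "0 < N"
    "\<And>F :: 'a list \<Rightarrow> 'a. (\<Sum>\<sigma>\<in>?P. F (permute_list \<sigma> cs)) =
      real N *\<^sub>R (\<Sum>l\<in>permutations_of_multiset (mset cs). F l)"
    by (rule sum_permutes_eq[where 'b = 'a and cs = cs]) (rule that)
  have sp: "sym_prod cs = real N *\<^sub>R msym (mset cs)"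
  proof -
    have "sym_prod cs = (\<Sum>\<sigma>\<in>?P. prod_list (permute_list \<sigma> cs))"
      unfolding sym_prod_def by (intro sum.cong refl) (simp add: perm_prod_permute(1)[where i = ?j])
    then show ?thesis by (simp add: N(2) msym_def)
  qed
  have "eigvec r cs p = real N *\<^sub>R (\<Sum>i\<le>?j. eig_coeff r ?j i *\<^sub>R msand i (mset cs) p)" for r and p :: 'a
  proof (cases "?j < 2 * r")
    case True
    then have "(\<Sum>i\<le>?j. eig_coeff r ?j i *\<^sub>R msand i (mset cs) p) = (\<Sum>i\<le>?j. if i = ?j then msym (mset cs) * p else 0)"
      using msand_size[of "mset cs" p] by (intro sum.cong refl) (simp add: eig_coeff_def)
    with True show ?thesis by (simp add: eigvec_def sp)
  next
    case False
    have "eigvec r cs p = (\<Sum>i = r..?j - r. eig_coeff r ?j i *\<^sub>R real N *\<^sub>R msand i (mset cs) p)"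
      using False unfolding eigvec_def sym_sandwich_def Let_def if_not_P[OF False]
    proof (intro sum.cong refl)
      fix i assume i: "i \<in> {r..?j - r}"
      then have "i \<le> ?j" by auto
      have "(\<Sum>\<sigma>\<in>?P. c *\<^sub>R (perm_prod cs \<sigma> [0..<i] * p * perm_prod cs \<sigma> [i..<?j])) =
          c *\<^sub>R real N *\<^sub>R msand i (mset cs) p" for c :: real
      proof -
        have "(\<Sum>\<sigma>\<in>?P. c *\<^sub>R (perm_prod cs \<sigma> [0..<i] * p * perm_prod cs \<sigma> [i..<?j])) =
          c *\<^sub>R (\<Sum>\<sigma>\<in>?P. prod_list (take i (permute_list \<sigma> cs)) * p * prod_list (drop i (permute_list \<sigma> cs)))"
          unfolding scaleR_sum_right
          by (intro sum.cong refl) (use \<open>i \<le> ?j\<close> in \<open>simp add: perm_prod_permute\<close>)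
        also have "\<dots> = c *\<^sub>R real N *\<^sub>R msand i (mset cs) p"
          using \<open>i \<le> ?j\<close> by (simp add: N(2)[of "\<lambda>l. prod_list (take i l) * p * prod_list (drop i l)"] msand_eq_sum)
        finally show ?thesis .
      qed
      then show "(\<Sum>\<sigma>\<in>?P. real ((?j - r choose i) * (?j - r choose (i - r))) *\<^sub>R
          (perm_prod cs \<sigma> [0..<i] * p * perm_prod cs \<sigma> [i..<?j])) = eig_coeff r ?j i *\<^sub>R real N *\<^sub>R msand i (mset cs) p"
        using False i by (simp add: eig_coeff_def)
    qed
    also have "\<dots> = (\<Sum>i\<le>?j. eig_coeff r ?j i *\<^sub>R real N *\<^sub>R msand i (mset cs) p)"
      using False by (intro sum.mono_neutral_left) (auto simp: eig_coeff_def)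
    finally show ?thesis by (simp add: scaleR_sum_right mult.commute)
  qed
  then show thesis using sp by (rule that[OF N(1)])
qed

text \<open>The one property of the weights on which linear independence relies.\<close>

lemma eig_coeff_sum_pos: "0 < (\<Sum>i\<le>j. eig_coeff r j i)"
proof (cases "j < 2 * r")
  case True
  then show ?thesis by (simp add: eig_coeff_def)
next
  case False
  then have "eig_coeff r j r > 0" by (simp add: eig_coeff_def)
  moreover have "r \<in> {..j}" "\<And>i. 0 \<le> eig_coeff r j i" using False by (auto simp: eig_coeff_def)
  ultimately show ?thesis by (intro sum_pos2[of _ r]) auto
qed

text \<open>Deleting one occurrence of x from an arrangement of M leaves an arrangement of
  \<open>M - {#x#}\<close>, and each of those arises from the \<open>size M\<close> places at which
  x can be inserted.\<close>

lemma derivation_msym: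
  fixes D :: "'a::real_algebra_1 \<Rightarrow> 'a"
  assumes "linear D" and der: "\<And>x y. D (x * y) = D x * y + x * D y"
    and "\<And>x. x \<in># M \<Longrightarrow> D x = \<psi> x *\<^sub>R 1"
  shows "D (msym M) = real (size M) *\<^sub>R (\<Sum>x\<in>set_mset M. \<psi> x *\<^sub>R msym (M - {#x#}))"
  using assms(3)
proof (induction "size M" arbitrary: M)
  case 0
  have "D 1 = 0" using der[of 1 1] by simp
  with 0 show ?case by simp
next
  case (Suc k)
  then have "M \<noteq> {#}" by auto
  have k: "k = size (M - {#x#})" if "x \<in># M" for x
    using that Suc.hyps(2) by (simp add: size_Diff_singleton)
  have "D (msym M) = (\<Sum>x\<in>set_mset M. \<psi> x *\<^sub>R msym (M - {#x#}) +
      (\<Sum>y\<in>set_mset (M - {#x#}). real k *\<^sub>R \<psi> y *\<^sub>R (x * msym (M - {#x#} - {#y#}))))"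
    unfolding msym_rec[OF \<open>M \<noteq> {#}\<close>] linear_sum[OF assms(1)]
  proof (intro sum.cong refl)
    fix x assume x: "x \<in># M"
    have "D (msym (M - {#x#})) = real k *\<^sub>R (\<Sum>y\<in>set_mset (M - {#x#}). \<psi> y *\<^sub>R msym (M - {#x#} - {#y#}))"
      using Suc.hyps(1)[OF k[OF x]] Suc.prems k[OF x] by (auto dest: in_diffD)
    then show "D (x * msym (M - {#x#})) = \<psi> x *\<^sub>R msym (M - {#x#}) +
      (\<Sum>y\<in>set_mset (M - {#x#}). real k *\<^sub>R \<psi> y *\<^sub>R (x * msym (M - {#x#} - {#y#})))"
      using x by (simp add: der Suc.prems scaleR_sum_right sum_distrib_left)
  qed
  also have "\<dots> = (\<Sum>x\<in>set_mset M. \<psi> x *\<^sub>R msym (M - {#x#})) +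
      (\<Sum>y\<in>set_mset M. \<Sum>x\<in>set_mset (M - {#y#}). real k *\<^sub>R \<psi> y *\<^sub>R (x * msym (M - {#x#} - {#y#})))"
    using sum_set_mset_swap[of "\<lambda>x y. real k *\<^sub>R \<psi> y *\<^sub>R (x * msym (M - {#x#} - {#y#}))" M]
    by (simp only: sum.distrib)
  also have "(\<Sum>y\<in>set_mset M. \<Sum>x\<in>set_mset (M - {#y#}). real k *\<^sub>R \<psi> y *\<^sub>R (x * msym (M - {#x#} - {#y#}))) =
      real k *\<^sub>R (\<Sum>y\<in>set_mset M. \<psi> y *\<^sub>R msym (M - {#y#}))"
  proof (cases "k = 0")
    case False
    then have "msym (M - {#y#}) = (\<Sum>x\<in>set_mset (M - {#y#}). x * msym (M - {#x#} - {#y#}))" if "y \<in># M" for y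
      using k[OF that] by (subst msym_rec) (auto simp: add_mset_commute)
    then show ?thesis by (simp add: scaleR_sum_right)
  qed simp
  finally show ?case
    by (simp flip: Suc.hyps(2) add: scaleR_add_left)
qed

text \<open>As for \<open>msym\<close>, places of insertion are counted: i of them when the deleted
  letter stood before p, size M - i when it stood after p. The truncated \<open>i - 1\<close> at i =
  0 carries the coefficient 0.\<close>

lemma derivation_msand:
  fixes D :: "'a::real_algebra_1 \<Rightarrow> 'a"
  assumes "linear D" and der: "\<And>x y. D (x * y) = D x * y + x * D y" and "D p = 0"
    and "\<And>x. x \<in># M \<Longrightarrow> D x = \<psi> x *\<^sub>R 1" and "i \<le> size M"
  shows "D (msand i M p) = (\<Sum>x\<in>set_mset M. \<psi> x *\<^sub>R
    (real i *\<^sub>R msand (i - 1) (M - {#x#}) p + real (size M - i) *\<^sub>R msand i (M - {#x#}) p))"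
  using assms(4,5)
proof (induction i arbitrary: M)
  case 0
  then show ?case
    by (simp add: der assms(3) derivation_msym[OF assms(1,2), of M \<psi>] scaleR_sum_right sum_distrib_left mult.commute)
next
  case (Suc i)
  let ?t = "\<lambda>x y. real i *\<^sub>R (x * msand (i - 1) (M - {#x#} - {#y#}) p) +
    real (size M - Suc i) *\<^sub>R (x * msand i (M - {#x#} - {#y#}) p)"
  have "D (msand (Suc i) M p) = (\<Sum>x\<in>set_mset M. \<psi> x *\<^sub>R msand i (M - {#x#}) p +
      (\<Sum>y\<in>set_mset (M - {#x#}). \<psi> y *\<^sub>R ?t x y))"
    unfolding msand.simps linear_sum[OF assms(1)]
  proof (intro sum.cong refl)
    fix x assume x: "x \<in># M"
    have sz: "size (M - {#x#}) = size M - 1" using x by (simp add: size_Diff_singleton)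
    have "D (msand i (M - {#x#}) p) = (\<Sum>y\<in>set_mset (M - {#x#}). \<psi> y *\<^sub>R
      (real i *\<^sub>R msand (i - 1) (M - {#x#} - {#y#}) p +
       real (size M - Suc i) *\<^sub>R msand i (M - {#x#} - {#y#}) p))"
    proof -
      have 1: "D y = \<psi> y *\<^sub>R 1" if "y \<in># M - {#x#}" for y
        using that by (intro Suc.prems) (rule in_diffD)
      have 2: "i \<le> size (M - {#x#})" using Suc.prems(2) sz by simp
      have "size (M - {#x#}) - i = size M - Suc i" using sz by simp
      with Suc.IH[OF 1 2] show ?thesis by simp
    qed
    then show "D (x * msand i (M - {#x#}) p) = \<psi> x *\<^sub>R msand i (M - {#x#}) p +
      (\<Sum>y\<in>set_mset (M - {#x#}). \<psi> y *\<^sub>R ?t x y)"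
      unfolding der Suc.prems(1)[OF x] by (simp only: sum_distrib_left distrib_left mult_scaleR_right mult_scaleR_left mult_1_left)
  qed
  also have "\<dots> = (\<Sum>y\<in>set_mset M. \<psi> y *\<^sub>R msand i (M - {#y#}) p +
      (\<Sum>x\<in>set_mset (M - {#y#}). \<psi> y *\<^sub>R ?t x y))"
    using sum_set_mset_swap[of "\<lambda>x y. \<psi> y *\<^sub>R ?t x y" M] by (simp only: sum.distrib)
  also have "\<dots> = (\<Sum>y\<in>set_mset M. \<psi> y *\<^sub>R (real (Suc i) *\<^sub>R msand (Suc i - 1) (M - {#y#}) p +
      real (size M - Suc i) *\<^sub>R msand (Suc i) (M - {#y#}) p))"
  proof (intro sum.cong refl)
    fix y assume "y \<in># M"
    have "(\<Sum>x\<in>set_mset (M - {#y#}). ?t x y) =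
      real i *\<^sub>R (\<Sum>x\<in>set_mset (M - {#y#}). x * msand (i - 1) (M - {#y#} - {#x#}) p) +
      real (size M - Suc i) *\<^sub>R msand (Suc i) (M - {#y#}) p"
      by (simp add: sum.distrib scaleR_sum_right add_mset_commute)
    also have "real i *\<^sub>R (\<Sum>x\<in>set_mset (M - {#y#}). x * msand (i - 1) (M - {#y#} - {#x#}) p) =
      real i *\<^sub>R msand i (M - {#y#}) p"
      by (cases i) simp_all
    finally show "\<psi> y *\<^sub>R msand i (M - {#y#}) p + (\<Sum>x\<in>set_mset (M - {#y#}). \<psi> y *\<^sub>R ?t x y) =
      \<psi> y *\<^sub>R (real (Suc i) *\<^sub>R msand (Suc i - 1) (M - {#y#}) p +
        real (size M - Suc i) *\<^sub>R msand (Suc i) (M - {#y#}) p)"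
      unfolding scaleR_sum_right[symmetric] by (simp add: scaleR_add_left scaleR_add_right)
  qed
  finally show ?case .
qed

section \<open>Eigenvectors\<close>

text \<open>Splits off the leading factor rather than the last, to match the loss of one letter. At
  i = 0 both sides vanish, so the truncated \<open>i - 1\<close> does no harm.\<close>

lemma falling_Suc: "falling i (Suc k) = real i * falling (i - 1) k"
proof (cases i)
  case 0
  then show ?thesis by (auto simp: falling_def)
next
  case (Suc i')
  then show ?thesis by (simp add: falling_def prod.lessThan_Suc_shift del: prod.lessThan_Suc)
qed

lemma falling_eq_0: "i < k \<Longrightarrow> falling i k = 0"
  by (auto simp: falling_def)

lemma falling_fact: "k \<le> i \<Longrightarrow> falling i k = fact i / fact (i - k)"
proof (induction k)
  case 0
  then show ?case by (simp add: falling_def)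
next
  case (Suc k)
  then have "falling i (Suc k) = fact i / fact (i - k) * real (i - k)"
    by (simp add: falling_def of_nat_diff)
  also have "i - k = Suc (i - Suc k)" using Suc.prems by simp
  finally show ?case by (simp only: fact_Suc) (simp del: of_nat_Suc)
qed

lemma falling_pos: "k \<le> i \<Longrightarrow> 0 < falling i k"
  by (simp add: falling_fact)

lemma sum_Pascal:
  fixes F :: "nat \<Rightarrow> 'a::real_vector"
  shows "(\<Sum>k\<le>Suc N. real (Suc N choose k) *\<^sub>R F k) =
    (\<Sum>k\<le>N. real (N choose k) *\<^sub>R F (Suc k)) + (\<Sum>k\<le>N. real (N choose k) *\<^sub>R F k)"
proof -
  have "(\<Sum>k\<le>Suc N. real (Suc N choose k) *\<^sub>R F k) =
      F 0 + (\<Sum>k\<le>N. real (N choose k) *\<^sub>R F (Suc k)) + (\<Sum>k\<le>N. real (N choose Suc k) *\<^sub>R F (Suc k))"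
    by (subst sum.atMost_Suc_shift) (simp add: scaleR_add_left sum.distrib)
  moreover have "(\<Sum>k\<le>N. real (N choose k) *\<^sub>R F k) = (\<Sum>k\<le>Suc N. real (N choose k) *\<^sub>R F k)"
    by simp
  then have "(\<Sum>k\<le>N. real (N choose k) *\<^sub>R F k) = F 0 + (\<Sum>k\<le>N. real (N choose Suc k) *\<^sub>R F (Suc k))"
    by (simp only: sum.atMost_Suc_shift) simp
  ultimately show ?thesis by (simp only: add_ac)
qed

text \<open>Counts the ways to take N letters in succession from a word with i letters before p and
  j - i after it, k of them from the front: the binomial coefficient decides at which steps, the
  falling factorials which letters. Up to normalisation this is the hypergeometric
  distribution.\<close>

definition word_coeff :: "nat \<Rightarrow> nat \<Rightarrow> nat \<Rightarrow> nat \<Rightarrow> real" where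
  "word_coeff N j i k = real (N choose k) * (falling i k * falling (j - i) (N - k))"

lemma word_coeff_nonzero:
  assumes "word_coeff N j i k \<noteq> 0"
  shows "k \<le> i" "N - k \<le> j - i"
  using assms falling_eq_0[of i k] falling_eq_0[of "j - i" "N - k"]
  by (auto simp: word_coeff_def intro: leI)

text \<open>\<open>Y\<close> takes N letters out and puts a of them back at the left end, the others
  at the right end. All M are quantified over because an induction step applies \<open>Y\<close> to
  M with a letter removed.\<close>

definition word_action :: "('a::real_algebra_1 \<Rightarrow> 'a) \<Rightarrow> nat \<Rightarrow> nat \<Rightarrow> 'a set \<Rightarrow> 'a \<Rightarrow> bool" where
  "word_action Y N a V p \<longleftrightarrow> (\<forall>M i. set_mset M \<subseteq> V \<longrightarrow> i \<le> size M \<longrightarrow>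
     Y (msand i M p) = (\<Sum>k\<le>N. word_coeff N (size M) i k *\<^sub>R msand (i + a - k) M p))"

text \<open>One step of left (\<open>s = 1\<close>) or right (\<open>s = 0\<close>) multiplication.\<close>

lemma word_action_step:
  assumes Y: "linear Y" "word_action Y N a V p" and "a \<le> N"
    and B: "\<And>x. linear (B x)"
    and shift: "\<And>M l. l < size M \<Longrightarrow> (\<Sum>x\<in>set_mset M. B x (msand l (M - {#x#}) p)) = msand (l + s) M p"
    and Z: "\<And>M i. set_mset M \<subseteq> V \<Longrightarrow> i \<le> size M \<Longrightarrow> Z (msand i M p) =
      (\<Sum>x\<in>set_mset M. B x (Y (real i *\<^sub>R msand (i - 1) (M - {#x#}) p + real (size M - i) *\<^sub>R msand i (M - {#x#}) p)))"
  shows "word_action Z (Suc N) (a + s) V p"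
  unfolding word_action_def
proof (intro allI impI)
  fix M i assume M: "set_mset M \<subseteq> V" and i: "i \<le> size M"
  let ?j = "size M" and ?X = "set_mset M"
  define F where "F k = (falling i k * falling (?j - i) (Suc N - k)) *\<^sub>R msand (i + (a + s) - k) M p" for k
  have MV: "set_mset (M - {#x#}) \<subseteq> V" for x
    using M by (auto dest: in_diffD)
  have sz: "size (M - {#x#}) = ?j - 1" if "x \<in># M" for x
    using that by (simp add: size_Diff_singleton)
  have act: "Y (msand l (M - {#x#}) p) = (\<Sum>k\<le>N. word_coeff N (?j - 1) l k *\<^sub>R msand (l + a - k) (M - {#x#}) p)"
    if "x \<in># M" "l \<le> ?j - 1" for x l
    using Y(2)[unfolded word_action_def, rule_format, OF MV[of x], of l] that sz[OF that(1)] by simp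
  \<comment> \<open>Appending at the right end requires a letter after p, whence the bound on the
    index; terms outside it carry weight 0.\<close>
  have shifted: "(\<Sum>x\<in>?X. B x (\<Sum>k\<le>N. w k *\<^sub>R msand (l + a - k) (M - {#x#}) p)) =
      (\<Sum>k\<le>N. w k *\<^sub>R msand (l + a - k + s) M p)"
    if "\<And>k. k \<le> N \<Longrightarrow> w k \<noteq> 0 \<Longrightarrow> l + a - k < ?j" for w :: "nat \<Rightarrow> real" and l
  proof -
    have "(\<Sum>x\<in>?X. B x (\<Sum>k\<le>N. w k *\<^sub>R msand (l + a - k) (M - {#x#}) p)) =
      (\<Sum>k\<le>N. w k *\<^sub>R (\<Sum>x\<in>?X. B x (msand (l + a - k) (M - {#x#}) p)))"
      by (simp add: linear_sum[OF B] linear_scale[OF B] scaleR_sum_right) (rule sum.swap)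
    also have "\<dots> = (\<Sum>k\<le>N. w k *\<^sub>R msand (l + a - k + s) M p)"
    proof (intro sum.cong refl)
      fix k assume "k \<in> {..N}"
      then show "w k *\<^sub>R (\<Sum>x\<in>?X. B x (msand (l + a - k) (M - {#x#}) p)) = w k *\<^sub>R msand (l + a - k + s) M p"
        using that[of k] shift[of "l + a - k" M] by (cases "w k = 0") auto
    qed
    finally show ?thesis .
  qed
  \<comment> \<open>The letter deleted first stood before p, so k further removals in front make k +
    1 in all.\<close>
  have 1: "real i *\<^sub>R (\<Sum>x\<in>?X. B x (Y (msand (i - 1) (M - {#x#}) p))) = (\<Sum>k\<le>N. real (N choose k) *\<^sub>R F (Suc k))"
  proof (cases "i = 0")
    case True
    then show ?thesis by (simp add: F_def falling_Suc)
  next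
    case False
    have "(\<Sum>x\<in>?X. B x (Y (msand (i - 1) (M - {#x#}) p))) =
      (\<Sum>x\<in>?X. B x (\<Sum>k\<le>N. word_coeff N (?j - 1) (i - 1) k *\<^sub>R msand (i - 1 + a - k) (M - {#x#}) p))"
      using i by (intro sum.cong refl arg_cong[of _ _ "B _"] act) auto
    also have "\<dots> = (\<Sum>k\<le>N. word_coeff N (?j - 1) (i - 1) k *\<^sub>R msand (i - 1 + a - k + s) M p)"
      by (rule shifted) (use word_coeff_nonzero[of N "?j - 1" "i - 1"] False i \<open>a \<le> N\<close> in fastforce)
    finally have "real i *\<^sub>R (\<Sum>x\<in>?X. B x (Y (msand (i - 1) (M - {#x#}) p))) =
      (\<Sum>k\<le>N. (real i * word_coeff N (?j - 1) (i - 1) k) *\<^sub>R msand (i - 1 + a - k + s) M p)"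
      by (simp add: scaleR_sum_right)
    also have "\<dots> = (\<Sum>k\<le>N. real (N choose k) *\<^sub>R F (Suc k))"
    proof (intro sum.cong refl)
      fix k assume "k \<in> {..N}"
      have ij: "?j - 1 - (i - 1) = ?j - i" using False by simp
      show "(real i * word_coeff N (?j - 1) (i - 1) k) *\<^sub>R msand (i - 1 + a - k + s) M p = real (N choose k) *\<^sub>R F (Suc k)"
      proof (cases "k \<le> i - 1")
        case True
        then have "i - 1 + a - k + s = i + (a + s) - Suc k" using False by simp
        then show ?thesis
          by (simp only: F_def word_coeff_def ij falling_Suc[of i] diff_Suc_Suc scaleR_scaleR mult_ac)
      next
        case False
        then have "falling (i - 1) k = 0" by (intro falling_eq_0) simp
        then show ?thesis by (simp add: F_def word_coeff_def falling_Suc[of i])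
      qed
    qed
    finally show ?thesis .
  qed
  \<comment> \<open>The letter deleted first stood after p, and the count in front stays k. Pascal's
    rule will combine the two cases.\<close>
  have 2: "real (?j - i) *\<^sub>R (\<Sum>x\<in>?X. B x (Y (msand i (M - {#x#}) p))) = (\<Sum>k\<le>N. real (N choose k) *\<^sub>R F k)"
  proof (cases "i = ?j")
    case True
    then show ?thesis by (auto simp: F_def falling_Suc Suc_diff_le intro!: sum.neutral[symmetric])
  next
    case False
    with i have ij: "i \<le> ?j - 1" "i < ?j" by auto
    have "(\<Sum>x\<in>?X. B x (Y (msand i (M - {#x#}) p))) =
      (\<Sum>x\<in>?X. B x (\<Sum>k\<le>N. word_coeff N (?j - 1) i k *\<^sub>R msand (i + a - k) (M - {#x#}) p))"
      using ij by (intro sum.cong refl arg_cong[of _ _ "B _"] act) auto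
    also have "\<dots> = (\<Sum>k\<le>N. word_coeff N (?j - 1) i k *\<^sub>R msand (i + a - k + s) M p)"
      by (rule shifted) (use word_coeff_nonzero[of N "?j - 1" i] ij \<open>a \<le> N\<close> in fastforce)
    finally have "real (?j - i) *\<^sub>R (\<Sum>x\<in>?X. B x (Y (msand i (M - {#x#}) p))) =
      (\<Sum>k\<le>N. (real (?j - i) * word_coeff N (?j - 1) i k) *\<^sub>R msand (i + a - k + s) M p)"
      by (simp add: scaleR_sum_right)
    also have "\<dots> = (\<Sum>k\<le>N. real (N choose k) *\<^sub>R F k)"
    proof (intro sum.cong refl)
      fix k assume "k \<in> {..N}"
      then have fs: "falling (?j - i) (Suc N - k) = real (?j - i) * falling (?j - 1 - i) (N - k)"
        by (simp add: Suc_diff_le falling_Suc)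
      show "(real (?j - i) * word_coeff N (?j - 1) i k) *\<^sub>R msand (i + a - k + s) M p = real (N choose k) *\<^sub>R F k"
      proof (cases "k \<le> i")
        case True
        then have "i + a - k + s = i + (a + s) - k" by simp
        then show ?thesis unfolding F_def word_coeff_def fs by simp
      next
        case False
        then have "falling i k = 0" by (intro falling_eq_0) simp
        then show ?thesis by (simp add: F_def word_coeff_def)
      qed
    qed
    finally show ?thesis .
  qed
  have "Z (msand i M p) = (\<Sum>k\<le>N. real (N choose k) *\<^sub>R F (Suc k)) + (\<Sum>k\<le>N. real (N choose k) *\<^sub>R F k)"
    unfolding Z[OF M i] 1[symmetric] 2[symmetric]
    by (simp add: linear_add[OF Y(1)] linear_scale[OF Y(1)] linear_add[OF B] linear_scale[OF B]
        sum.distrib scaleR_sum_right)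
  also have "\<dots> = (\<Sum>k\<le>Suc N. real (Suc N choose k) *\<^sub>R F k)" by (rule sum_Pascal[symmetric])
  finally show "Z (msand i M p) = (\<Sum>k\<le>Suc N. word_coeff (Suc N) (size M) i k *\<^sub>R msand (i + (a + s) - k) M p)"
    by (simp only: F_def word_coeff_def scaleR_scaleR)
qed

text \<open>Vandermonde's identity makes the binomial weights stationary.\<close>

lemma eig_coeff_stationary:
  assumes "2 * r \<le> j" "i' \<le> j"
  shows "(\<Sum>i = r..j - r. eig_coeff r j i * (if i' \<le> i + r \<and> i \<le> i' + r then word_coeff (2 * r) j i (i + r - i') else 0)) =
    falling j (2 * r) * eig_coeff r j i'"
proof (cases "i' \<in> {r..j - r}")
  case False
  \<comment> \<open>After a step at least r letters stand on either side of p, so no weight reaches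
    an i' outside the range.\<close>
  have "word_coeff (2 * r) j i (i + r - i') = 0" if "i \<in> {r..j - r}" "i' \<le> i + r" "i \<le> i' + r" for i
  proof (rule ccontr)
    assume "word_coeff (2 * r) j i (i + r - i') \<noteq> 0"
    from word_coeff_nonzero[OF this] False that assms show False by auto
  qed
  with False assms show ?thesis by (auto simp: eig_coeff_def intro!: sum.neutral)
next
  case True
  \<comment> \<open>The factors not depending on i, set aside so that the weight at i times the
    transition count becomes a summand of Vandermonde's identity.\<close>
  define K :: real where "K = fact (j - r) * fact (j - r) / (fact (j - 2 * r) * fact (i' - r) * fact (j - r - i'))"
  have term_eq: "eig_coeff r j i * word_coeff (2 * r) j i (i + r - i') =
      K * (real (j - 2 * r choose (i - r)) * real (2 * r choose (i' - (i - r))))"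
    if "i \<in> {r..j - r}" "i' \<le> i + r" "i \<le> i' + r" for i
  proof -
    have e: "i - (i + r - i') = i' - r" "j - i - (2 * r - (i + r - i')) = j - r - i'"
      "j - r - (i - r) = j - i" "j - 2 * r - (i - r) = j - r - i" "2 * r - (i + r - i') = i' - (i - r)"
      using that True assms by auto
    have le: "i + r - i' \<le> i" "2 * r - (i + r - i') \<le> j - i" "i \<le> j - r" "i - r \<le> j - r"
      "i - r \<le> j - 2 * r" "i + r - i' \<le> 2 * r"
      using that True assms by auto
    have "real (2 * r choose (i + r - i')) = real (2 * r choose (i' - (i - r)))"
      using binomial_symmetric[OF le(6)] e(5) by simp
    then have "eig_coeff r j i * word_coeff (2 * r) j i (i + r - i') =
      (fact (j - r) / (fact i * fact (j - r - i))) * (fact (j - r) / (fact (i - r) * fact (j - i))) *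
      (real (2 * r choose (i' - (i - r))) * (fact i / fact (i' - r) * (fact (j - i) / fact (j - r - i'))))"
      using that assms le
      by (simp add: eig_coeff_def word_coeff_def falling_fact e binomial_fact[where 'a = real] add.commute)
    also have "\<dots> = K * (fact (j - 2 * r) / (fact (i - r) * fact (j - r - i)) * real (2 * r choose (i' - (i - r))))"
      by (simp add: K_def field_simps)
    also have "fact (j - 2 * r) / (fact (i - r) * fact (j - r - i)) = real (j - 2 * r choose (i - r))"
      by (simp only: binomial_fact[where 'a = real, OF le(5)] e)
    finally show ?thesis by (simp add: mult_ac)
  qed
  have "(\<Sum>i = r..j - r. eig_coeff r j i * (if i' \<le> i + r \<and> i \<le> i' + r then word_coeff (2 * r) j i (i + r - i') else 0)) =
    (\<Sum>i | i \<in> {r..j - r} \<and> i' \<le> i + r \<and> i \<le> i' + r. eig_coeff r j i * word_coeff (2 * r) j i (i + r - i'))"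
    by (rule sum.mono_neutral_cong_right) auto
  also have "\<dots> = (\<Sum>i | i \<in> {r..j - r} \<and> i' \<le> i + r \<and> i \<le> i' + r.
      K * (real (j - 2 * r choose (i - r)) * real (2 * r choose (i' - (i - r)))))"
    by (intro sum.cong refl term_eq) auto
  also have "\<dots> = (\<Sum>l | l \<le> j - 2 * r \<and> l \<le> i' \<and> i' - l \<le> 2 * r.
      K * (real (j - 2 * r choose l) * real (2 * r choose (i' - l))))"
    by (rule sum.reindex_bij_witness[of _ "\<lambda>l. l + r" "\<lambda>i. i - r"]) (use assms in auto)
  also have "\<dots> = (\<Sum>l\<le>i'. K * (real (j - 2 * r choose l) * real (2 * r choose (i' - l))))"
    by (rule sum.mono_neutral_left) (auto simp: not_le)
  also have "\<dots> = K * real (\<Sum>l\<le>i'. (j - 2 * r choose l) * (2 * r choose (i' - l)))"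
    by (simp add: sum_distrib_left)
  also have "(\<Sum>l\<le>i'. (j - 2 * r choose l) * (2 * r choose (i' - l))) = (j choose i')"
    using vandermonde[of "j - 2 * r" "2 * r" i'] assms(1) by simp
  also have "K * real (j choose i') = falling j (2 * r) * eig_coeff r j i'"
  proof -
    have "j - r - (i' - r) = j - i'" using True assms by auto
    then show ?thesis
      using True assms by (simp add: K_def eig_coeff_def falling_fact binomial_fact[where 'a = real] mult_ac)
  qed
  finally show ?thesis .
qed

text \<open>With fewer than 2r letters every word is annihilated. Otherwise the action on the
  \<open>msand i M p\<close> is a matrix indexed by the number of letters in front, and stationarity
  makes the weights an eigenvector of it.\<close>

lemma word_action_eigenvector:
  assumes Y: "linear Y" "word_action Y (2 * r) r V p" and M: "set_mset M \<subseteq> V"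
  defines "e \<equiv> (\<Sum>i\<le>size M. eig_coeff r (size M) i *\<^sub>R msand i M p)"
  shows "Y e = falling (size M) (2 * r) *\<^sub>R e"
proof (cases "size M < 2 * r")
  case True
  have "Y (msand i M p) = 0" if "i \<le> size M" for i
  proof -
    have "word_coeff (2 * r) (size M) i k = 0" for k
      using word_coeff_nonzero[of "2 * r" "size M" i k] that True by fastforce
    then show ?thesis using Y(2) M that by (simp add: word_action_def)
  qed
  then show ?thesis
    using True by (simp add: e_def linear_sum[OF Y(1)] linear_scale[OF Y(1)] falling_eq_0)
next
  case False
  let ?j = "size M"
  define A where "A i i' = (if i' \<le> i + r \<and> i \<le> i' + r then word_coeff (2 * r) ?j i (i + r - i') else 0)" for i i'
  have YA: "Y (msand i M p) = (\<Sum>i'\<le>?j. A i i' *\<^sub>R msand i' M p)" if "i \<in> {r..?j - r}" for i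
  proof -
    have "Y (msand i M p) = (\<Sum>k\<le>2 * r. word_coeff (2 * r) ?j i k *\<^sub>R msand (i + r - k) M p)"
      using Y(2) M that by (auto simp: word_action_def)
    also have "\<dots> = (\<Sum>i' = i - r..i + r. A i i' *\<^sub>R msand i' M p)"
      by (rule sum.reindex_bij_witness[of _ "\<lambda>i'. i + r - i'" "\<lambda>k. i + r - k"]) (use that in \<open>auto simp: A_def\<close>)
    also have "\<dots> = (\<Sum>i'\<le>?j. A i i' *\<^sub>R msand i' M p)"
      by (rule sum.mono_neutral_left) (use that False in \<open>auto simp: A_def\<close>)
    finally show ?thesis .
  qed
  have e: "e = (\<Sum>i = r..?j - r. eig_coeff r ?j i *\<^sub>R msand i M p)"
    unfolding e_def by (rule sum.mono_neutral_right) (use False in \<open>auto simp: eig_coeff_def\<close>)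
  have "Y e = (\<Sum>i = r..?j - r. eig_coeff r ?j i *\<^sub>R (\<Sum>i'\<le>?j. A i i' *\<^sub>R msand i' M p))"
    unfolding e linear_sum[OF Y(1)] linear_scale[OF Y(1)] by (intro sum.cong refl) (simp add: YA)
  also have "\<dots> = (\<Sum>i'\<le>?j. (\<Sum>i = r..?j - r. eig_coeff r ?j i * A i i') *\<^sub>R msand i' M p)"
    by (simp add: scaleR_sum_right scaleR_sum_left) (rule sum.swap)
  also have "\<dots> = (\<Sum>i'\<le>?j. (falling ?j (2 * r) * eig_coeff r ?j i') *\<^sub>R msand i' M p)"
    unfolding A_def using eig_coeff_stationary[of r ?j] False by (intro sum.cong refl) simp
  also have "\<dots> = falling ?j (2 * r) *\<^sub>R e"
    by (simp add: e_def scaleR_sum_right)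
  finally show ?thesis .
qed

section \<open>Symmetrised words in the Hopf algebra\<close>

context graded_connected_hopf_algebra
begin

lemma msym_graded:
  "(\<And>x. x \<in># M \<Longrightarrow> x \<in> H (d x)) \<Longrightarrow> msym M \<in> H (\<Sum>x\<in>#M. d x)"
proof (induction "size M" arbitrary: M)
  case 0
  then show ?case by (simp add: one_H)
next
  case (Suc k)
  then have "M \<noteq> {#}" by auto
  have "x * msym (M - {#x#}) \<in> H (\<Sum>x\<in>#M. d x)" if x: "x \<in># M" for x
  proof -
    have "msym (M - {#x#}) \<in> H (\<Sum>x\<in>#M - {#x#}. d x)"
      using Suc.hyps(2) x by (intro Suc.hyps(1) Suc.prems) (auto simp: size_Diff_singleton dest: in_diffD)
    from mult_graded[OF Suc.prems[OF x] this] show ?thesis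
      using x by (metis image_mset_add_mset insert_DiffM sum_mset.add_mset)
  qed
  then show ?case
    unfolding msym_rec[OF \<open>M \<noteq> {#}\<close>] by (intro subspace_sum subspace_H)
qed

lemma msand_graded:
  "set_mset M \<subseteq> H 1 \<Longrightarrow> p \<in> H m \<Longrightarrow> i \<le> size M \<Longrightarrow> msand i M p \<in> H (size M + m)"
proof (induction i arbitrary: M)
  case 0
  have "msym M \<in> H (size M)"
    using msym_graded[of M "\<lambda>_. 1"] 0 by auto
  from mult_graded[OF 0(2) this] show ?case by (simp add: add.commute)
next
  case (Suc i)
  have "x * msand i (M - {#x#}) p \<in> H (size M + m)" if x: "x \<in># M" for x
  proof -
    have "msand i (M - {#x#}) p \<in> H (size (M - {#x#}) + m)"
      using Suc.prems x by (intro Suc.IH) (auto simp: size_Diff_singleton dest: in_diffD)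
    moreover have "x \<in> H 1" using x Suc.prems by auto
    ultimately have "x * msand i (M - {#x#}) p \<in> H (1 + (size (M - {#x#}) + m))"
      by (intro mult_graded)
    also have "1 + (size (M - {#x#}) + m) = size M + m"
      using x by (metis add.assoc insert_DiffM plus_1_eq_Suc size_add_mset)
    finally show ?thesis .
  qed
  then show ?case unfolding msand.simps by (intro subspace_sum subspace_H)
qed

end

context H1_dual_basis
begin

lemma msand_D:
  assumes "set_mset M \<subseteq> H 1" "i \<le> size M"
  shows "D a p = 0 \<Longrightarrow> D a (msand i M p) = (\<Sum>x\<in>set_mset M. \<phi> a x *\<^sub>R
      (real i *\<^sub>R msand (i - 1) (M - {#x#}) p + real (size M - i) *\<^sub>R msand i (M - {#x#}) p))"
    and "D' a p = 0 \<Longrightarrow> D' a (msand i M p) = (\<Sum>x\<in>set_mset M. \<phi> a x *\<^sub>R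
      (real i *\<^sub>R msand (i - 1) (M - {#x#}) p + real (size M - i) *\<^sub>R msand i (M - {#x#}) p))"
  using assms H1_contraction[OF deg_functional_\<phi>]
  by (intro derivation_msand linear_D linear_D' D_mult D'_mult; auto)+

text \<open>A basis element a returns in front with coefficient \<phi>_a(x), and these terms sum to
  x: the letter that a contraction deletes is put back at the left end, and the basis disappears
  from the formula.\<close>

lemma opL_msand:
  assumes "linear Y" "set_mset M \<subseteq> H 1" "i \<le> size M" "\<And>a. D a p = 0"
  shows "opL Y (msand i M p) = (\<Sum>x\<in>set_mset M. x *
    Y (real i *\<^sub>R msand (i - 1) (M - {#x#}) p + real (size M - i) *\<^sub>R msand i (M - {#x#}) p))"
proof -
  let ?u = "\<lambda>x. real i *\<^sub>R msand (i - 1) (M - {#x#}) p + real (size M - i) *\<^sub>R msand i (M - {#x#}) p"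
  have "opL Y (msand i M p) = (\<Sum>a\<in>C. \<Sum>x\<in>set_mset M. (\<phi> a x *\<^sub>R a) * Y (?u x))"
    unfolding opL_def msand_D(1)[OF assms(2,3,4)]
    by (simp add: linear_sum[OF assms(1)] linear_scale[OF assms(1), of "\<phi> _ _"] sum_distrib_left)
  also have "\<dots> = (\<Sum>x\<in>set_mset M. (\<Sum>a\<in>C. \<phi> a x *\<^sub>R a) * Y (?u x))"
    by (subst sum.swap) (simp add: sum_distrib_right)
  also have "\<dots> = (\<Sum>x\<in>set_mset M. x * Y (?u x))"
    using assms(2) by (intro sum.cong refl) (simp add: \<phi>_expansion subset_iff)
  finally show ?thesis .
qed

lemma opR_msand:
  assumes "linear Y" "set_mset M \<subseteq> H 1" "i \<le> size M" "\<And>a. D' a p = 0"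
  shows "opR Y (msand i M p) = (\<Sum>x\<in>set_mset M.
    Y (real i *\<^sub>R msand (i - 1) (M - {#x#}) p + real (size M - i) *\<^sub>R msand i (M - {#x#}) p) * x)"
proof -
  let ?u = "\<lambda>x. real i *\<^sub>R msand (i - 1) (M - {#x#}) p + real (size M - i) *\<^sub>R msand i (M - {#x#}) p"
  have "opR Y (msand i M p) = (\<Sum>a\<in>C. \<Sum>x\<in>set_mset M. Y (?u x) * (\<phi> a x *\<^sub>R a))"
    unfolding opR_def msand_D(2)[OF assms(2,3,4)]
    by (simp add: linear_sum[OF assms(1)] linear_scale[OF assms(1), of "\<phi> _ _"] sum_distrib_right)
  also have "\<dots> = (\<Sum>x\<in>set_mset M. Y (?u x) * (\<Sum>a\<in>C. \<phi> a x *\<^sub>R a))"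
    by (subst sum.swap) (simp add: sum_distrib_left)
  also have "\<dots> = (\<Sum>x\<in>set_mset M. Y (?u x) * x)"
    using assms(2) by (intro sum.cong refl) (simp add: \<phi>_expansion subset_iff)
  finally show ?thesis .
qed

lemma word_action_opL:
  assumes "linear Y" "word_action Y N a (H 1) p" "a \<le> N" "\<And>a. D a p = 0"
  shows "word_action (opL Y) (Suc N) (Suc a) (H 1) p"
  using word_action_step[where B = "(*)" and s = 1, OF assms(1-3) linear_mult_left _ opL_msand[OF assms(1) _ _ assms(4)]]
  by simp

lemma word_action_opR:
  assumes "linear Y" "word_action Y N a (H 1) p" "a \<le> N" "\<And>a. D' a p = 0"
  shows "word_action (opR Y) (Suc N) a (H 1) p"
  using word_action_step[where B = "\<lambda>x y. y * x" and s = 0, OF assms(1-3) linear_mult_right _ opR_msand[OF assms(1) _ _ assms(4)]]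
  by (simp add: msand_right)

text \<open>From the identity, with N = a = 0, each \<open>opL\<close> raises both parameters and
  each \<open>opR\<close> raises N alone.\<close>

lemma word_action_opR_opL:
  assumes "\<And>a. D a p = 0" "\<And>a. D' a p = 0"
  shows "word_action ((opR ^^ r) ((opL ^^ r) id)) (2 * r) r (H 1) p"
proof -
  have id: "linear (id :: 'a \<Rightarrow> 'a)" by (simp add: linear_iff)
  have L: "word_action ((opL ^^ k) id) k k (H 1) p" for k
  proof (induction k)
    case 0
    show ?case by (simp add: word_action_def word_coeff_def falling_def)
  next
    case (Suc k)
    then show ?case using word_action_opL[OF linear_opL_funpow[OF id] Suc] assms by simp
  qed
  have "word_action ((opR ^^ k) ((opL ^^ r) id)) (r + k) r (H 1) p" for k
  proof (induction k)
    case 0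
    show ?case unfolding funpow_0 add_0_right by (rule L)
  next
    case (Suc k)
    then show ?case
      using word_action_opR[OF linear_opR_funpow[OF linear_opL_funpow[OF id]] Suc] assms by simp
  qed
  from this[of r] show ?thesis by (simp add: mult_2)
qed

lemma eigvec_eigenvector:
  assumes "1 \<le> r" "2 * r \<le> n" "p \<in> H m" "\<And>a. D a p = 0" "\<And>a. D' a p = 0"
    and "set cs \<subseteq> H 1" "length cs + m = n"
  shows "eigenvector_on (H n) (TaBr2R H \<Delta> r n) (\<beta> r n (length cs)) (eigvec r cs p)"
proof -
  let ?Y = "(opR ^^ r) ((opL ^^ r) id)" and ?j = "length cs"
  define e where "e = (\<Sum>i\<le>size (mset cs). eig_coeff r (size (mset cs)) i *\<^sub>R msand i (mset cs) p)"
  have linY: "linear ?Y"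
    by (intro linear_opR_funpow linear_opL_funpow) (simp add: linear_iff)
  obtain N :: nat where N: "\<And>r p. eigvec r cs p =
      real N *\<^sub>R (\<Sum>i\<le>length cs. eig_coeff r (length cs) i *\<^sub>R msand i (mset cs) (p::'a))"
    by (rule eigvec_msand[of cs]) blast
  have v: "eigvec r cs p = real N *\<^sub>R e"
    unfolding N e_def by simp
  have eH: "e \<in> H n"
    unfolding e_def assms(7)[symmetric]
    using msand_graded[of "mset cs" p m] assms(3,6)
    by (intro subspace_sum subspace_H subspace_scale) auto
  have "word_action ?Y (2 * r) r (H 1) p" by (rule word_action_opR_opL) (rule assms)+
  then have "?Y e = falling ?j (2 * r) *\<^sub>R e"
    using word_action_eigenvector[OF linY, of r "H 1" p "mset cs"] assms(6)
    by (simp add: e_def)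
  then have "TaBr2R H \<Delta> r n e = \<beta> r n ?j *\<^sub>R e"
    by (simp add: TaBr2R_eq[OF assms(1,2) eH] \<beta>_def)
  then show ?thesis
    using eH by (simp add: eigenvector_on_def v linear_scale[OF linear_TaBr2R[OF assms(1)]]
        subspace_scale subspace_H mult.commute)
qed

lemma \<phi>_component: "\<phi> a (component H 1 x) = \<phi> a x"
proof (rule linear_eq_on_H[where x = x])
  show "linear (\<lambda>x. \<phi> a (component H 1 x))"
    using linear_compose[OF linear_component linear_\<phi>] by (simp add: o_def)
  show "linear (\<phi> a)" by (rule linear_\<phi>)
  fix m x assume "x \<in> H m"
  then show "\<phi> a (component H 1 x) = \<phi> a x"
    by (cases "m = 1") (simp_all add: component_H \<phi>_off linear_0[OF linear_\<phi>] del: One_nat_def)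
qed

text \<open>Applying \<phi>_a to the factor of degree 1 of the vanishing tensor gives the component
  of degree m - 1 of the contraction, which is all of it since p is homogeneous.\<close>

lemma comult_wc_D_eq_0:
  assumes "p \<in> H m"
  shows "comult_wc H \<Delta> [1, m - 1] p = 0 \<Longrightarrow> D a p = 0"
    and "comult_wc H \<Delta> [m - 1, 1] p = 0 \<Longrightarrow> D' a p = 0"
proof -
  obtain ps where ps: "\<Delta> p = (\<Sum>(a, b)\<leftarrow>ps. tens [a, b])" by (rule comult_sum)
  have lin: "linear (tensor_map [component H i, component H k])" for i k
    by (rule linear_tensor_map) (auto simp: linear_component)
  have tm: "tensor_map [component H i, component H k] (tens [a, b]) = tens [component H i a, component H k b]"
    for i k a b
    by (subst tensor_map_tens) (auto simp: linear_component)
  have eq: "comult_wc H \<Delta> [i, k] p = (\<Sum>(a, b)\<leftarrow>ps. tens [component H i a, component H k b])" for i k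
    unfolding comult_wc_def
    by (simp add: comult_first_tens[OF linear_comult] append_comult[OF ps] sum_list_linear[OF lin]
        case_prod_unfold tm)
  note l = linear_add[OF linear_\<phi>] linear_scale[OF linear_\<phi>]
  show "D a p = 0" if z: "comult_wc H \<Delta> [1, m - 1] p = 0"
  proof -
    have "component H (m - 1) (D a p) = (\<Sum>(x, y)\<leftarrow>ps. \<phi> a (component H 1 x) *\<^sub>R component H (m - 1) y)"
      by (simp add: lc_sum[OF linear_\<phi> ps] sum_list_linear[OF linear_component] case_prod_unfold
          linear_scale[OF linear_component] \<phi>_component del: One_nat_def)
    also have "\<dots> = tensor_lift2 (\<lambda>x y. \<phi> a x *\<^sub>R y) (\<Sum>(a, b)\<leftarrow>map (\<lambda>(a, b). (component H 1 a, component H (m - 1) b)) ps. tens [a, b])"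
      by (subst tensor_lift2_sum) (simp_all add: linear_iff l algebra_simps o_def case_prod_unfold)
    also have "(\<Sum>(a, b)\<leftarrow>map (\<lambda>(a, b). (component H 1 a, component H (m - 1) b)) ps. tens [a, b]) = 0"
      using z by (simp add: eq o_def case_prod_unfold)
    also have "tensor_lift2 (\<lambda>x y. \<phi> a x *\<^sub>R y) 0 = 0"
      by (rule linear_0[OF linear_tensor_lift2]) (simp_all add: linear_iff l algebra_simps)
    finally show ?thesis using component_H[OF D_H(1)[OF assms, of a], of "m - 1"] by simp
  qed
  show "D' a p = 0" if z: "comult_wc H \<Delta> [m - 1, 1] p = 0"
  proof -
    have "component H (m - 1) (D' a p) = (\<Sum>(x, y)\<leftarrow>ps. \<phi> a (component H 1 y) *\<^sub>R component H (m - 1) x)"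
      by (simp add: rc_sum[OF linear_\<phi> ps] sum_list_linear[OF linear_component] case_prod_unfold
          linear_scale[OF linear_component] \<phi>_component del: One_nat_def)
    also have "\<dots> = tensor_lift2 (\<lambda>x y. \<phi> a y *\<^sub>R x) (\<Sum>(a, b)\<leftarrow>map (\<lambda>(a, b). (component H (m - 1) a, component H 1 b)) ps. tens [a, b])"
      by (subst tensor_lift2_sum) (simp_all add: linear_iff l algebra_simps o_def case_prod_unfold)
    also have "(\<Sum>(a, b)\<leftarrow>map (\<lambda>(a, b). (component H (m - 1) a, component H 1 b)) ps. tens [a, b]) = 0"
      using z by (simp add: eq o_def case_prod_unfold)
    also have "tensor_lift2 (\<lambda>x y. \<phi> a y *\<^sub>R x) 0 = 0"
      by (rule linear_0[OF linear_tensor_lift2]) (simp_all add: linear_iff l algebra_simps)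
    finally show ?thesis using component_H[OF D'_H(1)[OF assms, of a], of "m - 1"] by simp
  qed
qed

end

section \<open>Characteristic polynomials from flags\<close>

definition triangular_on :: "('a::real_vector \<Rightarrow> 'a) \<Rightarrow> 'a list \<Rightarrow> real list \<Rightarrow> bool" where
  "triangular_on T bs ls \<longleftrightarrow> length ls = length bs \<and>
     (\<forall>j<length bs. T (bs ! j) - ls ! j *\<^sub>R (bs ! j) \<in> span (set (take j bs)))"

text \<open>The basis and the diagonal entries are hidden so that a flag can be lengthened one
  subspace at a time, keeping only the product of linear factors; no quotient spaces are
  formed.\<close>

definition flag_poly :: "('a::real_vector \<Rightarrow> 'a) \<Rightarrow> 'a set \<Rightarrow> real poly \<Rightarrow> bool" where
  "flag_poly T U p \<longleftrightarrow>
     (\<exists>bs ls. ordered_basis bs U \<and> triangular_on T bs ls \<and> (\<Prod>l\<leftarrow>ls. [:- l, 1:]) = p)"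

lemma char_poly_triangular_on:
  assumes "ordered_basis bs V" "triangular_on T bs ls"
  shows "char_poly (matrix_of bs T) = (\<Prod>l\<leftarrow>ls. [:- l, 1:])"
proof -
  have ind: "independent (set bs)" and dist: "distinct bs"
    using assms(1) by (auto simp: ordered_basis_def)
  have len: "length ls = length bs" using assms(2) by (simp add: triangular_on_def)
  have entry: "representation (set bs) (T (bs ! j)) (bs ! i) = (if i = j then ls ! j else 0)"
    if "j < length bs" "i < length bs" "j \<le> i" for i j
  proof -
    let ?u = "T (bs ! j) - ls ! j *\<^sub>R (bs ! j)"
    have u: "?u \<in> span (set (take j bs))" using assms(2) that by (simp add: triangular_on_def)
    have sub: "set (take j bs) \<subseteq> set bs" by (rule set_take_subset)
    have "bs ! i \<notin> set (take j bs)"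
      using that dist by (auto simp: in_set_conv_nth nth_eq_iff_index_eq)
    then have "representation (set (take j bs)) ?u (bs ! i) = 0"
      using real_vector.representation_ne_zero by blast
    then have 0: "representation (set bs) ?u (bs ! i) = 0"
      using real_vector.representation_extend[OF ind u sub] by simp
    have mem: "bs ! j \<in> span (set bs)" "?u \<in> span (set bs)"
      using that u real_vector.span_mono[OF sub] by (auto intro: real_vector.span_base)
    have "representation (set bs) (T (bs ! j)) (bs ! i) =
        representation (set bs) (?u + ls ! j *\<^sub>R (bs ! j)) (bs ! i)"
      by simp
    also have "\<dots> = ls ! j * representation (set bs) (bs ! j) (bs ! i)"
      using mem 0 by (subst real_vector.representation_add[OF ind])
        (simp_all add: real_vector.representation_scale[OF ind] real_vector.span_scale)
    also have "\<dots> = (if i = j then ls ! j else 0)"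
      using that dist by (simp add: real_vector.representation_basis[OF ind] nth_eq_iff_index_eq)
    finally show ?thesis .
  qed
  let ?M = "matrix_of bs T"
  have "upper_triangular ?M"
    unfolding upper_triangular_def matrix_of_def by (auto simp: entry)
  moreover have "?M \<in> carrier_mat (length bs) (length bs)" by (simp add: matrix_of_def)
  moreover have "diag_mat ?M = ls"
    using len by (intro nth_equalityI) (auto simp: diag_mat_def matrix_of_def entry)
  ultimately show ?thesis
    using char_poly_upper_triangular[of ?M "length bs"] by simp
qed

lemma ordered_basis_dim: "ordered_basis bs V \<Longrightarrow> dim V = length bs"
  unfolding ordered_basis_def
  by (metis distinct_card real_vector.dim_eq_card_independent real_vector.dim_span)

lemma flag_poly_char_poly:
  assumes "flag_poly T V p" "linear T"
  shows "char_poly_on V T = p"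
proof -
  obtain bs ls where bs: "ordered_basis bs V" "triangular_on T bs ls" "(\<Prod>l\<leftarrow>ls. [:- l, 1:]) = p"
    using assms(1) by (auto simp: flag_poly_def)
  have V: "V = span (set bs)" using bs(1) by (simp add: ordered_basis_def)
  \<comment> \<open>Triangularity implies that \<open>V\<close> is invariant, as the comparison with
    the basis chosen by \<open>SOME\<close> requires.\<close>
  have "T b \<in> V" if "b \<in> set bs" for b
  proof -
    obtain j where j: "j < length bs" "b = bs ! j" using \<open>b \<in> set bs\<close> by (auto simp: in_set_conv_nth)
    then have "T b - ls ! j *\<^sub>R b \<in> V"
      using bs(2) real_vector.span_mono[OF set_take_subset[of j bs]] by (auto simp: triangular_on_def V)
    moreover have "ls ! j *\<^sub>R b \<in> V"
      using that by (simp add: V real_vector.span_base real_vector.span_scale)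
    ultimately show ?thesis
      using real_vector.span_add[of "T b - ls ! j *\<^sub>R b" "set bs" "ls ! j *\<^sub>R b"] by (simp add: V)
  qed
  then have "span (T ` set bs) \<subseteq> V"
    by (intro real_vector.span_minimal) (auto simp: V)
  then have TV: "T ` V \<subseteq> V"
    using linear_span_image[OF assms(2), of "set bs"] V by simp
  have "ordered_basis (SOME bs. ordered_basis bs V) V" using bs(1) by (rule someI)
  then show ?thesis
    unfolding char_poly_on_def
    using char_poly_matrix_of_cong[OF _ bs(1) assms(2) TV] char_poly_triangular_on[OF bs(1,2)] bs(3) by simp
qed

lemma flag_poly_degree:
  assumes "flag_poly T V p"
  shows "degree p = dim V"
proof -
  obtain bs ls where bs: "ordered_basis bs V" "triangular_on T bs ls" "(\<Prod>l\<leftarrow>ls. [:- l, 1:]) = p"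
    using assms(1) by (auto simp: flag_poly_def)
  have "(\<Prod>l\<leftarrow>ls. [:- l, 1:]) \<noteq> 0 \<and> degree (\<Prod>l\<leftarrow>ls. [:- l, 1:]) = length ls" for ls :: "real list"
    by (induction ls) (simp_all add: degree_mult_eq del: mult_pCons_left)
  with bs(3) have "degree p = length ls" by blast
  then show ?thesis
    using bs(2) ordered_basis_dim[OF bs(1)] by (simp add: triangular_on_def)
qed

lemma flag_poly_zero: "flag_poly T {0} 1"
  unfolding flag_poly_def
  by (intro exI[of _ "[]"]) (simp add: ordered_basis_def triangular_on_def real_vector.independent_empty)

section \<open>Lengthening flags; bases of quotient spaces\<close>

lemma subspace_span_eq: "subspace A \<Longrightarrow> B \<subseteq> A \<Longrightarrow> A \<subseteq> span B \<Longrightarrow> span B = A"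
  by (simp add: real_vector.span_minimal subset_antisym)

text \<open>T induces the scalar l on the quotient of U' by U, so any extension of the basis of U to
  one of U' is again triangular, with l as every new diagonal entry. The set \<open>F\<close> makes
  the extension finite.\<close>

lemma flag_poly_extend:
  fixes U U' F :: "'a::real_vector set"
  assumes "flag_poly T U p" "subspace U'" "U \<subseteq> U'" "finite F" "U' \<subseteq> span F"
    and T: "\<And>x. x \<in> U' \<Longrightarrow> T x - l *\<^sub>R x \<in> U"
  shows "flag_poly T U' (p * [:- l, 1:] ^ (dim U' - dim U))"
proof -
  obtain bs ls where bs: "ordered_basis bs U" "triangular_on T bs ls" "(\<Prod>l\<leftarrow>ls. [:- l, 1:]) = p"
    using assms(1) by (auto simp: flag_poly_def)
  have b: "distinct bs" "independent (set bs)" "span (set bs) = U"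
    using bs(1) by (auto simp: ordered_basis_def)
  have "set bs \<subseteq> U'" using b(3) assms(3) real_vector.span_superset by blast
  then obtain B where B: "set bs \<subseteq> B" "B \<subseteq> U'" "independent B" "U' \<subseteq> span B"
    using b(2) by (rule real_vector.maximal_independent_subset_extend)
  have "finite B"
    using real_vector.independent_span_bound[OF assms(4) B(3)] B(2) assms(5) by blast
  then obtain cs where cs: "set cs = B - set bs" "distinct cs"
    using finite_distinct_list[of "B - set bs"] by auto
  have sB: "span B = U'" using subspace_span_eq[OF assms(2) B(2,4)] .
  have ob: "ordered_basis (bs @ cs) U'"
    using b(1) cs B(1,3) sB by (auto simp: ordered_basis_def Un_absorb1)
  have len: "length ls = length bs" using bs(2) by (simp add: triangular_on_def)
  have "triangular_on T (bs @ cs) (ls @ replicate (length cs) l)"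
    unfolding triangular_on_def
  proof (intro conjI allI impI)
    show "length (ls @ replicate (length cs) l) = length (bs @ cs)" by (simp add: len)
    fix j assume j: "j < length (bs @ cs)"
    show "T ((bs @ cs) ! j) - (ls @ replicate (length cs) l) ! j *\<^sub>R ((bs @ cs) ! j) \<in> span (set (take j (bs @ cs)))"
    proof (cases "j < length bs")
      case True
      then show ?thesis using bs(2) len by (simp add: triangular_on_def nth_append)
    next
      case False
      then have "(bs @ cs) ! j = cs ! (j - length bs)" "cs ! (j - length bs) \<in> U'"
        "(ls @ replicate (length cs) l) ! j = l"
        using j cs(1) B(2) len nth_mem[of "j - length bs" cs] by (auto simp: nth_append)
      then have "T ((bs @ cs) ! j) - (ls @ replicate (length cs) l) ! j *\<^sub>R ((bs @ cs) ! j) \<in> span (set bs)"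
        using T b(3) by simp
      also have "span (set bs) \<subseteq> span (set (take j (bs @ cs)))"
        using False by (intro real_vector.span_mono) auto
      finally show ?thesis .
    qed
  qed
  moreover have "length cs = dim U' - dim U"
    using ordered_basis_dim[OF ob] ordered_basis_dim[OF bs(1)] by simp
  ultimately show ?thesis
    unfolding flag_poly_def using ob bs(3)
    by (intro exI[of _ "bs @ cs"] exI[of _ "ls @ replicate (length cs) l"])
      (simp add: prod_list_replicate)
qed

text \<open>A basis of the quotient of A by A0, given by representatives, with independence and
  generation stated modulo A0.\<close>

lemma complement_basis:
  fixes A0 A F :: "'a::real_vector set"
  assumes "subspace A0" "subspace A" "A0 \<subseteq> A" "finite F" "A \<subseteq> span F"
  obtains B where "finite B" "B \<subseteq> A" "card B + dim A0 = dim A"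
    "\<And>\<alpha>. (\<Sum>b\<in>B. \<alpha> b *\<^sub>R b) \<in> A0 \<Longrightarrow> \<forall>b\<in>B. \<alpha> b = 0"
    "\<And>x. x \<in> A \<Longrightarrow> \<exists>\<alpha>. x - (\<Sum>b\<in>B. \<alpha> b *\<^sub>R b) \<in> A0"
proof -
  obtain B0 where B0: "B0 \<subseteq> A0" "independent B0" "A0 \<subseteq> span B0"
    using real_vector.maximal_independent_subset by blast
  have "B0 \<subseteq> A" using B0(1) assms(3) by blast
  then obtain B where B: "B0 \<subseteq> B" "B \<subseteq> A" "independent B" "A \<subseteq> span B"
    using B0(2) by (rule real_vector.maximal_independent_subset_extend)
  have finB: "finite B"
    using real_vector.independent_span_bound[OF assms(4) B(3)] B(2) assms(5) by blast
  have s: "span B0 = A0" "span B = A"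
    using subspace_span_eq[OF assms(1) B0(1,3)] subspace_span_eq[OF assms(2) B(2,4)] by auto
  show thesis
  proof
    show "finite (B - B0)" "B - B0 \<subseteq> A" using finB B(2) by auto
    have "dim A = card B" "dim A0 = card B0"
      using s B(3) B0(2) real_vector.dim_eq_card_independent real_vector.dim_span by metis+
    then show "card (B - B0) + dim A0 = dim A"
      using finB B(1) by (simp add: card_Diff_subset finite_subset card_mono)
  next
    fix \<alpha> assume \<alpha>: "(\<Sum>b\<in>B - B0. \<alpha> b *\<^sub>R b) \<in> A0"
    show "\<forall>b\<in>B - B0. \<alpha> b = 0"
    proof (rule ccontr)
      assume "\<not> (\<forall>b\<in>B - B0. \<alpha> b = 0)"
      then obtain c where c: "c \<in> B" "c \<notin> B0" "\<alpha> c \<noteq> 0" by blast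
      have "(\<Sum>b\<in>B - B0. \<alpha> b *\<^sub>R b) = \<alpha> c *\<^sub>R c + (\<Sum>b\<in>B - B0 - {c}. \<alpha> b *\<^sub>R b)"
        using c finB by (intro sum.remove) auto
      then have "\<alpha> c *\<^sub>R c = (\<Sum>b\<in>B - B0. \<alpha> b *\<^sub>R b) - (\<Sum>b\<in>B - B0 - {c}. \<alpha> b *\<^sub>R b)" by simp
      moreover have "(\<Sum>b\<in>B - B0. \<alpha> b *\<^sub>R b) \<in> span (B - {c})"
        using \<alpha> c(2) B(1) real_vector.span_mono[of B0 "B - {c}"] s(1) by blast
      moreover have "(\<Sum>b\<in>B - B0 - {c}. \<alpha> b *\<^sub>R b) \<in> span (B - {c})"
        by (intro real_vector.span_sum real_vector.span_scale real_vector.span_base) auto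
      ultimately have "\<alpha> c *\<^sub>R c \<in> span (B - {c})" by (simp add: real_vector.span_diff)
      then have "c \<in> span (B - {c})"
        using real_vector.span_scale[of "\<alpha> c *\<^sub>R c" _ "inverse (\<alpha> c)"] c(3) by simp
      with B(3) c(1) show False by (auto simp: real_vector.dependent_def)
    qed
  next
    fix x assume "x \<in> A"
    then have "x \<in> span (B0 \<union> (B - B0))" using s(2) B(1) by (simp add: Un_absorb1)
    then obtain y z where yz: "y \<in> span B0" "z \<in> span (B - B0)" "x = y + z"
      unfolding real_vector.span_Un by blast
    obtain \<alpha> where "z = (\<Sum>b\<in>B - B0. \<alpha> b *\<^sub>R b)"
      using yz(2) finB by (auto simp: real_vector.span_finite)
    with yz s(1) have "x - (\<Sum>b\<in>B - B0. \<alpha> b *\<^sub>R b) \<in> A0" by simp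
    then show "\<exists>\<alpha>. x - (\<Sum>b\<in>B - B0. \<alpha> b *\<^sub>R b) \<in> A0" by blast
  qed
qed

lemma span_image_finite:
  assumes "finite \<Omega>" "z \<in> span (v ` \<Omega>)"
  obtains \<alpha> where "z = (\<Sum>i\<in>\<Omega>. \<alpha> i *\<^sub>R v i)"
proof -
  have "\<exists>\<alpha>. z = (\<Sum>i\<in>\<Omega>. \<alpha> i *\<^sub>R v i)"
    using assms(2)
  proof (induction rule: real_vector.span_induct_alt)
    case base
    then show ?case by (intro exI[of _ "\<lambda>_. 0"]) simp
  next
    case (step c x y)
    then obtain i \<alpha> where i: "i \<in> \<Omega>" "x = v i" "y = (\<Sum>i\<in>\<Omega>. \<alpha> i *\<^sub>R v i)" by auto
    have "c *\<^sub>R x = (\<Sum>k\<in>\<Omega>. (if k = i then c else 0) *\<^sub>R v k)"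
      using i(1,2) assms(1) by (simp add: if_distrib[of "\<lambda>c. c *\<^sub>R _"] cong: if_cong)
    then have "c *\<^sub>R x + y = (\<Sum>k\<in>\<Omega>. ((if k = i then c else 0) + \<alpha> k) *\<^sub>R v k)"
      unfolding i(3) scaleR_add_left sum.distrib by simp
    then show ?case by (intro exI[of _ "\<lambda>k. (if k = i then c else 0) + \<alpha> k"])
  qed
  with that show thesis by blast
qed

text \<open>The classes of the \<open>v i\<close> form a basis of the quotient of A by A0. An
  indexed family is used because the products to which this is applied are not known beforehand to
  be distinct.\<close>

lemma dim_eq_complement_family:
  fixes A0 A F :: "'a::real_vector set" and v :: "'i \<Rightarrow> 'a"
  assumes "subspace A0" "subspace A" "A0 \<subseteq> A" "finite F" "A \<subseteq> span F"
    and "finite \<Omega>" "v ` \<Omega> \<subseteq> A"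
    and ind: "\<And>\<alpha>. (\<Sum>i\<in>\<Omega>. \<alpha> i *\<^sub>R v i) \<in> A0 \<Longrightarrow> \<forall>i\<in>\<Omega>. \<alpha> i = 0"
    and gen: "\<And>x. x \<in> A \<Longrightarrow> \<exists>\<alpha>. x - (\<Sum>i\<in>\<Omega>. \<alpha> i *\<^sub>R v i) \<in> A0"
  shows "dim A = dim A0 + card \<Omega>"
proof -
  obtain B0 where B0: "B0 \<subseteq> A0" "independent B0" "A0 \<subseteq> span B0"
    using real_vector.maximal_independent_subset by blast
  have finB0: "finite B0"
    using real_vector.independent_span_bound[OF assms(4) B0(2)] B0(1) assms(3,5) by blast
  have s0: "span B0 = A0" using subspace_span_eq[OF assms(1) B0(1,3)] .
  have "independent (B0 \<union> v ` \<Omega>') \<and> card (B0 \<union> v ` \<Omega>') = card B0 + card \<Omega>'" if "\<Omega>' \<subseteq> \<Omega>" for \<Omega>'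
    using finite_subset[OF that assms(6)] that
  proof (induction \<Omega>')
    case empty
    then show ?case using B0(2) by simp
  next
    case (insert i \<Omega>')
    have "v i \<notin> span (B0 \<union> v ` \<Omega>')"
    proof
      assume "v i \<in> span (B0 \<union> v ` \<Omega>')"
      then obtain y z where yz: "y \<in> span B0" "z \<in> span (v ` \<Omega>')" "v i = y + z"
        unfolding real_vector.span_Un by blast
      obtain \<alpha> where \<alpha>: "z = (\<Sum>k\<in>\<Omega>'. \<alpha> k *\<^sub>R v k)"
        using span_image_finite[OF insert.hyps(1) yz(2)] .
      \<comment> \<open>A vector \<open>v i\<close> in the span of A0 and the earlier ones gives a
        combination that lies in A0 and has coefficient 1 at i.\<close>
      define \<gamma> where "\<gamma> k = (if k = i then 1 else if k \<in> \<Omega>' then - \<alpha> k else 0)" for k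
      have "(\<Sum>k\<in>\<Omega>. \<gamma> k *\<^sub>R v k) = (\<Sum>k\<in>insert i \<Omega>'. \<gamma> k *\<^sub>R v k)"
        using insert.prems assms(6) by (intro sum.mono_neutral_right) (auto simp: \<gamma>_def)
      also have "\<dots> = v i + (\<Sum>k\<in>\<Omega>'. \<gamma> k *\<^sub>R v k)"
        using insert.hyps by (simp add: \<gamma>_def)
      also have "(\<Sum>k\<in>\<Omega>'. \<gamma> k *\<^sub>R v k) = - z"
        unfolding \<alpha> sum_negf[symmetric] using insert.hyps by (intro sum.cong) (auto simp: \<gamma>_def)
      finally have "(\<Sum>k\<in>\<Omega>. \<gamma> k *\<^sub>R v k) = y" using yz(3) by simp
      then have "\<forall>k\<in>\<Omega>. \<gamma> k = 0" using ind yz(1) s0 by simp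
      with insert.prems show False by (auto simp: \<gamma>_def)
    qed
    note notin = this
    then have notin': "v i \<notin> B0 \<union> v ` \<Omega>'" by (meson real_vector.span_base)
    have fin: "finite (B0 \<union> v ` \<Omega>')" using finB0 insert.hyps by simp
    have IH: "independent (B0 \<union> v ` \<Omega>')" "card (B0 \<union> v ` \<Omega>') = card B0 + card \<Omega>'"
      using insert.IH insert.prems by auto
    have eq: "B0 \<union> v ` insert i \<Omega>' = insert (v i) (B0 \<union> v ` \<Omega>')" by simp
    show ?case
      unfolding eq using real_vector.independent_insertI[OF notin IH(1)]
        card_insert_disjoint[OF fin notin'] IH(2) card_insert_disjoint[OF insert.hyps]
      by simp
  qed
  from this[of \<Omega>] have B: "independent (B0 \<union> v ` \<Omega>)" "card (B0 \<union> v ` \<Omega>) = card B0 + card \<Omega>" by auto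
  have "A \<subseteq> span (B0 \<union> v ` \<Omega>)"
  proof
    fix x assume "x \<in> A"
    then obtain \<alpha> where "x - (\<Sum>i\<in>\<Omega>. \<alpha> i *\<^sub>R v i) \<in> A0" using gen by blast
    then have "x - (\<Sum>i\<in>\<Omega>. \<alpha> i *\<^sub>R v i) \<in> span (B0 \<union> v ` \<Omega>)"
      using s0 real_vector.span_mono[of B0 "B0 \<union> v ` \<Omega>"] by blast
    moreover have "(\<Sum>i\<in>\<Omega>. \<alpha> i *\<^sub>R v i) \<in> span (B0 \<union> v ` \<Omega>)"
      by (intro real_vector.span_sum real_vector.span_scale real_vector.span_base) auto
    ultimately show "x \<in> span (B0 \<union> v ` \<Omega>)"
      using real_vector.span_add by fastforce
  qed
  moreover have "B0 \<union> v ` \<Omega> \<subseteq> A"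
    using B0(1) assms(3,7) by (meson Un_least order_trans)
  ultimately have "span (B0 \<union> v ` \<Omega>) = A"
    by (intro subspace_span_eq[OF assms(2)])
  then have "dim A = card (B0 \<union> v ` \<Omega>)"
    using B(1) real_vector.dim_eq_card_independent real_vector.dim_span by metis
  moreover have "dim A0 = card B0"
    using s0 B0(2) real_vector.dim_eq_card_independent real_vector.dim_span by metis
  ultimately show ?thesis using B(2) by simp
qed

section \<open>The augmentation filtration\<close>

context graded_connected_hopf_algebra
begin

text \<open>The powers of the augmentation ideal I, the kernel of \<epsilon>, with the whole algebra
  as 0th power.\<close>

primrec Ipow :: "nat \<Rightarrow> 'a set" where
  "Ipow 0 = UNIV"
| "Ipow (Suc s) = span {x * y | x y. \<epsilon> x = 0 \<and> y \<in> Ipow s}"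

lemma subspace_Ipow: "subspace (Ipow s)"
  by (cases s) (simp_all add: real_vector.subspace_UNIV real_vector.subspace_span)

lemma Ipow_SucI: "\<epsilon> x = 0 \<Longrightarrow> y \<in> Ipow s \<Longrightarrow> x * y \<in> Ipow (Suc s)"
  by (auto intro: real_vector.span_base)

lemma Ipow_Suc_induct [consumes 1, case_names mult subspace]:
  assumes "z \<in> Ipow (Suc s)" "\<And>x y. \<epsilon> x = 0 \<Longrightarrow> y \<in> Ipow s \<Longrightarrow> P (x * y)" "subspace {z. P z}"
  shows "P z"
proof -
  have "span {x * y | x y. \<epsilon> x = 0 \<and> y \<in> Ipow s} \<subseteq> {z. P z}"
    by (rule real_vector.span_minimal) (use assms(2,3) in auto)
  with assms(1) show ?thesis by auto
qed

lemma Ipow_Suc_subset: "Ipow (Suc s) \<subseteq> Ipow s"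
proof (induction s)
  case (Suc s)
  have "z \<in> Ipow (Suc s)" if "z \<in> Ipow (Suc (Suc s))" for z
    using that
  proof (induction rule: Ipow_Suc_induct)
    case (mult x y)
    then show ?case using Suc by (intro Ipow_SucI) auto
  qed (simp add: subspace_Ipow del: Ipow.simps)
  then show ?case by blast
qed simp

lemma Ipow_mult: "x \<in> Ipow s \<Longrightarrow> y \<in> Ipow t \<Longrightarrow> x * y \<in> Ipow (s + t)"
proof (induction s arbitrary: x y)
  case 0
  show ?case
  proof (cases t)
    case (Suc t')
    have "x * y \<in> Ipow (Suc t')" using 0(2) unfolding Suc
    proof (induction rule: Ipow_Suc_induct)
      case (mult u v)
      then have "(x * u) * v \<in> Ipow (Suc t')" by (intro Ipow_SucI) (auto simp: counit_mult)
      then show ?case by (simp only: mult.assoc)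
    qed (rule subspace_vimage_linear[OF linear_mult_left subspace_Ipow])
    then show ?thesis by (simp add: Suc)
  qed simp
next
  case (Suc s)
  from Suc.prems(1) show ?case
  proof (induction rule: Ipow_Suc_induct)
    case (mult u v)
    then have "u * (v * y) \<in> Ipow (Suc (s + t))" by (intro Ipow_SucI Suc.IH Suc.prems)
    then show ?case by (simp only: mult.assoc add_Suc)
  qed (rule subspace_vimage_linear[OF linear_mult_right subspace_Ipow])
qed

lemma Ipow_1: "\<epsilon> x = 0 \<Longrightarrow> x \<in> Ipow 1"
  using Ipow_SucI[of x 1 0] by simp

lemma H_Ipow_1: "x \<in> H m \<Longrightarrow> m \<noteq> 0 \<Longrightarrow> x \<in> Ipow 1"
  by (intro Ipow_1 counit_graded)

lemma component_mult:
  "component H m (x * y) = (\<Sum>i\<le>m. component H i x * component H (m - i) y)"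
proof (rule linear_eq_on_H[where x = x])
  show "linear (\<lambda>x. component H m (x * y))"
    using linear_compose[OF linear_mult_right linear_component] by (simp add: o_def)
  show "linear (\<lambda>x. \<Sum>i\<le>m. component H i x * component H (m - i) y)"
    by (intro linear_compose_sum ballI linear_mult_right_fun linear_component)
  fix i x assume x: "x \<in> H i"
  show "component H m (x * y) = (\<Sum>i\<le>m. component H i x * component H (m - i) y)"
  proof (rule linear_eq_on_H[where x = y])
    show "linear (\<lambda>y. component H m (x * y))"
      using linear_compose[OF linear_mult_left linear_component] by (simp add: o_def)
    show "linear (\<lambda>y. \<Sum>i\<le>m. component H i x * component H (m - i) y)"
      by (intro linear_compose_sum ballI linear_mult_left_fun linear_component)
    fix j y assume y: "y \<in> H j"
    have "(\<Sum>k\<le>m. component H k x * component H (m - k) y) = (\<Sum>k\<le>m. if k = i then x * component H (m - i) y else 0)"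
      by (intro sum.cong refl) (simp add: component_H[OF x])
    also have "\<dots> = component H m (x * y)"
      by (auto simp: component_H[OF y] component_H[OF mult_graded[OF x y]])
    finally show "component H m (x * y) = (\<Sum>i\<le>m. component H i x * component H (m - i) y)" by simp
  qed
qed

lemma component_0_eq: "component H 0 x = \<epsilon> x *\<^sub>R 1"
proof (rule linear_eq_on_H[where x = x])
  show "linear (component H 0)" by (rule linear_component)
  show "linear (\<lambda>x. \<epsilon> x *\<^sub>R 1 :: 'a)" by (rule linear_scaleR_fun[OF linear_counit])
  fix m x assume "x \<in> H m"
  then show "component H 0 x = \<epsilon> x *\<^sub>R 1"
    using H0_eq[of x] counit_graded[of x m] by (cases "m = 0") (auto simp: component_H)
qed

text \<open>A product of s elements of I has no component below degree s, as
  \<open>component H 0\<close> is \<epsilon>. Hence the power n + 1 of I meets \<open>H n\<close> in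
  0.\<close>

lemma component_Ipow: "x \<in> Ipow s \<Longrightarrow> m < s \<Longrightarrow> component H m x = 0"
proof (induction s arbitrary: x m)
  case (Suc s)
  from Suc.prems(1) show ?case
  proof (induction rule: Ipow_Suc_induct)
    case (mult x y)
    have "component H i x * component H (m - i) y = 0" if "i \<le> m" for i
      using mult Suc.IH[of y "m - i"] Suc.prems(2) that by (cases "i = 0") (auto simp: component_0_eq)
    then show ?case by (auto simp: component_mult intro!: sum.neutral)
  next
    case subspace
    show ?case using subspace_vimage_linear[OF linear_component real_vector.subspace_single_0] by simp
  qed
qed simp

lemma Ipow_H: "x \<in> Ipow s \<Longrightarrow> x \<in> H n \<Longrightarrow> n < s \<Longrightarrow> x = 0"
  using component_Ipow[of x s n] component_H[of x n n] by simp

text \<open>By the Leibniz rule each term uses up only one of the factors from I.\<close>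

lemma derivation_Ipow_lower:
  assumes "linear \<delta>" "\<And>x y. \<delta> (x * y) = \<delta> x * y + x * \<delta> y"
  shows "x \<in> Ipow (Suc s) \<Longrightarrow> \<delta> x \<in> Ipow s"
proof (induction s arbitrary: x)
  case (Suc s)
  from Suc.prems show ?case
  proof (induction rule: Ipow_Suc_induct)
    case (mult x y)
    have "\<delta> x * y \<in> Ipow (0 + Suc s)" using mult by (intro Ipow_mult) auto
    moreover have "x * \<delta> y \<in> Ipow (Suc s)" using mult Suc.IH by (intro Ipow_SucI) auto
    ultimately show ?case
      unfolding assms(2) add_0 by (rule subspace_add[OF subspace_Ipow])
  qed (rule subspace_vimage_linear[OF assms(1) subspace_Ipow])
qed simp

text \<open>If \<delta> has values in I, a factor from I is replaced by another one and no power is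
  lost.\<close>

lemma derivation_Ipow_stable:
  assumes "linear \<delta>" "\<And>x y. \<delta> (x * y) = \<delta> x * y + x * \<delta> y" "\<And>x. \<epsilon> (\<delta> x) = 0"
  shows "x \<in> Ipow s \<Longrightarrow> \<delta> x \<in> Ipow s"
proof (induction s arbitrary: x)
  case (Suc s)
  from Suc.prems show ?case
  proof (induction rule: Ipow_Suc_induct)
    case (mult x y)
    then have "\<delta> x * y \<in> Ipow (Suc s)" "x * \<delta> y \<in> Ipow (Suc s)"
      using assms(3) Suc.IH by (auto intro!: Ipow_SucI simp del: Ipow.simps)
    then show ?case
      unfolding assms(2) by (rule subspace_add[OF subspace_Ipow])
  qed (rule subspace_vimage_linear[OF assms(1) subspace_Ipow])
qed simp

lemma msym_Ipow: "set_mset M \<subseteq> H 1 \<Longrightarrow> msym M \<in> Ipow (size M)"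
proof (induction "size M" arbitrary: M)
  case (Suc k)
  then have "M \<noteq> {#}" by auto
  have "x * msym (M - {#x#}) \<in> Ipow (Suc k)" if x: "x \<in># M" for x
  proof (rule Ipow_SucI)
    show "\<epsilon> x = 0" using Suc.prems x by (auto intro: counit_graded)
    have "k = size (M - {#x#})" using Suc.hyps(2) x by (simp add: size_Diff_singleton)
    with Suc.hyps(1)[OF this] show "msym (M - {#x#}) \<in> Ipow k"
      using Suc.prems by (auto dest: in_diffD)
  qed
  then show ?case
    unfolding msym_rec[OF \<open>M \<noteq> {#}\<close>] Suc.hyps(2)[symmetric] by (intro subspace_sum subspace_Ipow)
qed simp

end

section \<open>Contractions modulo higher powers of the augmentation ideal\<close>

context H1_dual_basis
begin

lemmas Ipow_add = subspace_add[OF subspace_Ipow]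
lemmas Ipow_diff = real_vector.subspace_diff[OF subspace_Ipow]
lemmas Ipow_scale = subspace_scale[OF subspace_Ipow]
lemmas Ipow_sum = subspace_sum[OF subspace_Ipow]

lemma D_Ipow: "x \<in> Ipow (Suc s) \<Longrightarrow> D a x \<in> Ipow s"
  by (rule derivation_Ipow_lower[OF linear_D D_mult])

text \<open>Two contractions lower the filtration by two; their commutator, itself a derivation,
  lowers it only by one, so it is 0 in the associated graded space.\<close>

lemma D_commute_Ipow: "x \<in> Ipow (Suc s) \<Longrightarrow> D a (D b x) - D b (D a x) \<in> Ipow s"
proof (rule derivation_Ipow_lower[where \<delta> = "\<lambda>x. D a (D b x) - D b (D a x)"])
  show "linear (\<lambda>x. D a (D b x) - D b (D a x))"
    using linear_compose[OF linear_D linear_D] by (intro linear_compose_sub) (simp_all add: o_def)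
qed (simp add: D_mult linear_add[OF linear_D] algebra_simps)

text \<open>The counit of either contraction is \<phi>_a(x), so the difference has values in
  I.\<close>

lemma D_diff_D': "x \<in> Ipow s \<Longrightarrow> D a x - D' a x \<in> Ipow s"
proof (rule derivation_Ipow_stable[where \<delta> = "\<lambda>x. D a x - D' a x"])
  show "linear (\<lambda>x. D a x - D' a x)" by (intro linear_compose_sub linear_D linear_D')
qed (simp_all add: D_mult D'_mult algebra_simps linear_diff[OF linear_counit] counit_lc counit_rc linear_\<phi>)

text \<open>Words and not multisets, since the contractions commute only modulo the filtration. The
  last letter acts first.\<close>

primrec Dw :: "'a list \<Rightarrow> 'a \<Rightarrow> 'a" where
  "Dw [] x = x"
| "Dw (a # w) x = D a (Dw w x)"

lemma Dw_append: "Dw (u @ v) x = Dw u (Dw v x)"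
  by (induction u) simp_all

lemma linear_Dw: "linear (Dw w)"
proof (induction w)
  case Nil
  show ?case using real_vector.linear_ident by simp
next
  case (Cons a w)
  show ?case using linear_compose[OF Cons linear_D] by (simp add: o_def)
qed

lemma Dw_Ipow: "x \<in> Ipow (s + length w) \<Longrightarrow> Dw w x \<in> Ipow s"
proof (induction w arbitrary: s)
  case (Cons a w)
  have "Dw w x \<in> Ipow (Suc s)" using Cons.prems by (intro Cons.IH) simp
  then show ?case by (simp add: D_Ipow del: Ipow.simps)
qed simp

lemma Dw_H: "x \<in> H m \<Longrightarrow> Dw w x \<in> H (m - length w)"
proof (induction w)
  case (Cons a w)
  then show ?case using D_H(1)[of "Dw w x" "m - length w" a] by simp
qed simp

lemma Dw_commute_D:
  "x \<in> Ipow (Suc s + length u) \<Longrightarrow> D a (Dw u x) - Dw u (D a x) \<in> Ipow (Suc s)"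
proof (induction u arbitrary: s)
  case Nil
  show ?case by (simp add: real_vector.subspace_0[OF subspace_Ipow] del: Ipow.simps)
next
  case (Cons b u)
  have "Dw u x \<in> Ipow (Suc (Suc s))" using Cons.prems by (intro Dw_Ipow) simp
  then have 1: "D a (D b (Dw u x)) - D b (D a (Dw u x)) \<in> Ipow (Suc s)" by (rule D_commute_Ipow)
  have "D a (Dw u x) - Dw u (D a x) \<in> Ipow (Suc (Suc s))" using Cons.prems by (intro Cons.IH) simp
  then have 2: "D b (D a (Dw u x) - Dw u (D a x)) \<in> Ipow (Suc s)" by (rule D_Ipow)
  from Ipow_add[OF 1 2] show ?case by (simp add: linear_diff[OF linear_D] del: Ipow.simps)
qed

text \<open>Modulo the next power only the multiset of letters matters: the letter a is moved to the
  front past u at the cost allowed by \<open>Dw_commute_D\<close>.\<close>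

lemma Dw_perm:
  "mset w = mset w' \<Longrightarrow> x \<in> Ipow (s + length w) \<Longrightarrow> Dw w x - Dw w' x \<in> Ipow (Suc s)"
proof (induction w arbitrary: w' s)
  case Nil
  then show ?case by (simp add: real_vector.subspace_0[OF subspace_Ipow] del: Ipow.simps)
next
  case (Cons a w)
  from Cons.prems(1) have "a \<in> set w'" by (metis list.set_intros(1) set_mset_mset)
  then obtain u v where w': "w' = u @ a # v" by (meson split_list)
  with Cons.prems(1) have m: "mset w = mset (u @ v)" by simp
  then have len: "length w = length u + length v" using mset_eq_length by fastforce
  have "Dw w x - Dw (u @ v) x \<in> Ipow (Suc (Suc s))"
    using Cons.prems(2) by (intro Cons.IH m) simp
  then have 1: "D a (Dw w x - Dw (u @ v) x) \<in> Ipow (Suc s)" by (rule D_Ipow)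
  have "Dw v x \<in> Ipow (Suc s + length u)"
    using Cons.prems(2) len by (intro Dw_Ipow) (simp add: add_ac)
  then have 2: "D a (Dw u (Dw v x)) - Dw u (D a (Dw v x)) \<in> Ipow (Suc s)" by (rule Dw_commute_D)
  from Ipow_add[OF 1 2] show ?case
    by (simp add: w' Dw_append linear_diff[OF linear_D] del: Ipow.simps)
qed

text \<open>On \<open>FV t k / FU t k\<close>, a subquotient of \<open>Ipow (t + k) / Ipow (t + k + 1)\<close>, the operators
  \<open>D a\<close> commute and words of length \<open>k\<close> in them determine an element.\<close>

definition FV :: "nat \<Rightarrow> nat \<Rightarrow> 'a set" where
  "FV t k = {x \<in> Ipow (t + k). \<forall>w. set w \<subseteq> C \<longrightarrow> length w = Suc k \<longrightarrow> Dw w x \<in> Ipow t}"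

definition FU :: "nat \<Rightarrow> nat \<Rightarrow> 'a set" where
  "FU t k = {x \<in> Ipow (t + k). \<forall>w. set w \<subseteq> C \<longrightarrow> length w = k \<longrightarrow> Dw w x \<in> Ipow (Suc t)}"

lemma subspace_FV: "subspace (FV t k)" and subspace_FU: "subspace (FU t k)"
  unfolding FV_def FU_def subspace_def
  by (auto simp del: Ipow.simps simp: linear_0[OF linear_Dw] linear_add[OF linear_Dw]
      linear_scale[OF linear_Dw] real_vector.subspace_0[OF subspace_Ipow] Ipow_add Ipow_scale)

lemma FU_subset_FV: "FU t k \<subseteq> FV t k"
proof
  fix x assume x: "x \<in> FU t k"
  have "Dw w x \<in> Ipow t" if w: "set w \<subseteq> C" "length w = Suc k" for w
  proof -
    obtain a w' where w': "w = a # w'" using w by (cases w) auto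
    have "Dw w' x \<in> Ipow (Suc t)" using x w by (auto simp: FU_def w' simp del: Ipow.simps)
    then show ?thesis unfolding w' Dw.simps by (rule D_Ipow)
  qed
  with x show "x \<in> FV t k" by (simp add: FU_def FV_def del: Ipow.simps)
qed

text \<open>With the next two lemmas this links the subquotients into one chain:
  \<open>Ipow (Suc s)\<close> = \<open>FU s 0\<close> \<subseteq> \<open>FV s 0\<close> =
  \<open>FU (s - 1) 1\<close> \<subseteq> \<open>FV (s - 1) 1\<close>, and so on up to
  \<open>FV 0 s\<close> = \<open>Ipow s\<close>.\<close>

lemma FU_Suc: "FU t (Suc k) = FV (Suc t) k"
  by (simp add: FU_def FV_def del: Ipow.simps)

lemma FU_0: "FU s 0 = Ipow (Suc s)"
  using Ipow_Suc_subset[of s] by (auto simp: FU_def simp del: Ipow.simps)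

lemma FV_0: "FV 0 s = Ipow s"
  by (auto simp: FV_def)

lemma Dw_FV: "x \<in> FV t k \<Longrightarrow> set w \<subseteq> C \<Longrightarrow> length w = k \<Longrightarrow> Dw w x \<in> FV t 0"
proof -
  assume x: "x \<in> FV t k" "set w \<subseteq> C" "length w = k"
  have "Dw w x \<in> Ipow t" using x by (intro Dw_Ipow) (simp add: FV_def)
  moreover have "Dw v (Dw w x) \<in> Ipow t" if "set v \<subseteq> C" "length v = Suc 0" for v
    using x that unfolding Dw_append[symmetric] by (simp add: FV_def)
  ultimately show ?thesis by (simp add: FV_def)
qed

lemma D_FV: "x \<in> FV t (Suc k) \<Longrightarrow> a \<in> C \<Longrightarrow> D a x \<in> FV t k"
proof -
  assume x: "x \<in> FV t (Suc k)" "a \<in> C"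
  have "D a x \<in> Ipow (t + k)" using x by (intro D_Ipow) (simp add: FV_def del: Ipow.simps)
  moreover have "Dw w (D a x) \<in> Ipow t" if "set w \<subseteq> C" "length w = Suc k" for w
  proof -
    have "Dw (w @ [a]) x \<in> Ipow t" using x that by (simp add: FV_def del: Dw.simps)
    then show ?thesis by (simp add: Dw_append)
  qed
  ultimately show ?thesis by (simp add: FV_def)
qed

text \<open>Words of length k tell elements of \<open>FV t k\<close> apart modulo
  \<open>FU t k\<close>, so the last clause says that \<open>Y\<close> induces the scalar
  \<open>f k\<close> on that quotient.\<close>

definition acts_as :: "('a \<Rightarrow> 'a) \<Rightarrow> (nat \<Rightarrow> real) \<Rightarrow> bool" where
  "acts_as Y f \<longleftrightarrow> linear Y \<and> (\<forall>s. \<forall>x\<in>Ipow s. Y x \<in> Ipow s) \<and>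
     (\<forall>t k. \<forall>x\<in>FV t k. \<forall>w. set w \<subseteq> C \<longrightarrow> length w = k \<longrightarrow> Dw w (Y x) - f k *\<^sub>R Dw w x \<in> Ipow (Suc t))"

lemma acts_asD:
  assumes "acts_as Y f"
  shows "linear Y" "x \<in> Ipow s \<Longrightarrow> Y x \<in> Ipow s"
    "x \<in> FV t k \<Longrightarrow> set w \<subseteq> C \<Longrightarrow> length w = k \<Longrightarrow> Dw w (Y x) - f k *\<^sub>R Dw w x \<in> Ipow (Suc t)"
  using assms unfolding acts_as_def by blast+

text \<open>Invariance at (t, k) comes from the scalar clause at (t - 1, k + 1), as
  \<open>FV t k\<close> = \<open>FU (t - 1) (k + 1)\<close>; for t = 0 the condition on words is
  void.\<close>

lemma acts_as_FV:
  assumes "acts_as Y f" "x \<in> FV t k"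
  shows "Y x \<in> FV t k"
proof -
  have "Dw w (Y x) \<in> Ipow t" if w: "set w \<subseteq> C" "length w = Suc k" for w
  proof (cases t)
    case (Suc t')
    have x': "x \<in> FV t' (Suc k)"
      using assms(2) FU_subset_FV[of t' "Suc k"] by (auto simp: Suc FU_Suc)
    have "Dw w (Y x) - f (Suc k) *\<^sub>R Dw w x \<in> Ipow t"
      using acts_asD(3)[OF assms(1) x' w] by (simp add: Suc)
    moreover have "f (Suc k) *\<^sub>R Dw w x \<in> Ipow t"
      using assms(2) w by (intro Ipow_scale) (simp add: FV_def)
    ultimately show ?thesis using Ipow_add by fastforce
  qed simp
  moreover have "Y x \<in> Ipow (t + k)"
    using acts_asD(2)[OF assms(1)] assms(2) by (simp add: FV_def)
  ultimately show ?thesis by (simp add: FV_def)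
qed

section \<open>The operator on the subquotients\<close>

abbreviation remove_nth :: "nat \<Rightarrow> 'b list \<Rightarrow> 'b list" where
  "remove_nth i w \<equiv> take i w @ drop (Suc i) w"

text \<open>\<open>B\<close> stands for multiplication by an element a of \<open>H 1\<close> on
  either side: each contraction of the word either passes a or is used up by it.\<close>

lemma Dw_Leibniz:
  assumes "linear B" "\<And>b y. D b (B y) = \<phi> b a *\<^sub>R y + B (D b y)"
  shows "Dw w (B y) = B (Dw w y) + (\<Sum>i<length w. \<phi> (w ! i) a *\<^sub>R Dw (remove_nth i w) y)"
proof (induction w)
  case (Cons b w)
  have "Dw (b # w) (B y) = D b (B (Dw w y) + (\<Sum>i<length w. \<phi> (w ! i) a *\<^sub>R Dw (remove_nth i w) y))"
    using Cons by simp
  also have "\<dots> = B (Dw (b # w) y) + (\<phi> b a *\<^sub>R Dw w y +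
      (\<Sum>i<length w. \<phi> (w ! i) a *\<^sub>R Dw (b # remove_nth i w) y))"
    by (simp add: linear_add[OF linear_D] linear_sum[OF linear_D] linear_scale[OF linear_D] assms(2))
  also have "\<phi> b a *\<^sub>R Dw w y + (\<Sum>i<length w. \<phi> (w ! i) a *\<^sub>R Dw (b # remove_nth i w) y) =
      (\<Sum>i<length (b # w). \<phi> ((b # w) ! i) a *\<^sub>R Dw (remove_nth i (b # w)) y)"
    by (simp add: sum.lessThan_Suc_shift del: sum.lessThan_Suc)
  finally show ?case .
qed simp

lemma mset_remove_nth: "i < length w \<Longrightarrow> mset (remove_nth i w @ [w ! i]) = mset w"
proof -
  assume "i < length w"
  then have "mset w = mset (take i w @ w ! i # drop (Suc i) w)" by (simp add: id_take_nth_drop[symmetric])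
  then show ?thesis by simp
qed

text \<open>A word w of length k is applied to B_a Y D_a x. If no contraction meets a, then k + 1 of
  them have acted on x and the term is of higher order. If the i-th one cancels a, then a = w_i, and
  moving D_a back to its place leaves f (k - 1) times the word applied to x; there are k choices of
  i. As \<open>Z\<close> is given only modulo \<open>Ipow (Suc s)\<close>, left contractions may
  stand in for right ones.\<close>

lemma acts_as_step:
  assumes Y: "acts_as Y f" and "linear Z"
    and B: "\<And>a. linear (B a)" "\<And>a b y. a \<in> C \<Longrightarrow> D b (B a y) = \<phi> b a *\<^sub>R y + B a (D b y)"
      "\<And>a s y. a \<in> C \<Longrightarrow> y \<in> Ipow s \<Longrightarrow> B a y \<in> Ipow (Suc s)"
    and Z: "\<And>s x. x \<in> Ipow s \<Longrightarrow> Z x - (\<Sum>a\<in>C. B a (Y (D a x))) \<in> Ipow (Suc s)"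
  shows "acts_as Z (\<lambda>k. real k * f (k - 1))"
proof -
  have BI: "(\<Sum>a\<in>C. B a (Y (D a x))) \<in> Ipow s" if "x \<in> Ipow s" for x s
  proof (cases s)
    case (Suc s')
    then show ?thesis
      using that by (auto intro!: Ipow_sum B(3) acts_asD(2)[OF Y] D_Ipow simp del: Ipow.simps)
  qed simp
  have "Z x \<in> Ipow s" if "x \<in> Ipow s" for x s
    using Ipow_add[OF subsetD[OF Ipow_Suc_subset Z[OF that]] BI[OF that]] by simp
  moreover have "Dw w (Z x) - (real k * f (k - 1)) *\<^sub>R Dw w x \<in> Ipow (Suc t)"
    if x: "x \<in> FV t k" and w: "set w \<subseteq> C" "length w = k" for t k x w
  proof -
    have xI: "x \<in> Ipow (t + k)" using x by (simp add: FV_def)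
    have "Dw w (Z x - (\<Sum>a\<in>C. B a (Y (D a x)))) \<in> Ipow (Suc t)"
      using Z[OF xI] w by (intro Dw_Ipow) (simp del: Ipow.simps)
    moreover have "Dw w (\<Sum>a\<in>C. B a (Y (D a x))) - (real k * f (k - 1)) *\<^sub>R Dw w x \<in> Ipow (Suc t)"
    proof -
      \<comment> \<open>The k + 1 contractions of an element of \<open>FV t k\<close> end in
        \<open>Ipow t\<close>, and \<open>B\<close> gains one power.\<close>
      have low: "(\<Sum>a\<in>C. B a (Dw w (Y (D a x)))) \<in> Ipow (Suc t)"
      proof (intro Ipow_sum B(3))
        fix a assume a: "a \<in> C"
        show "Dw w (Y (D a x)) \<in> Ipow t"
        proof (cases k)
          case 0
          have "D a x \<in> Ipow t"
            using x a unfolding FV_def 0 by (auto dest!: spec[of _ "[a]"])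
          with 0 w show ?thesis by (simp add: acts_asD(2)[OF Y])
        next
          case (Suc k')
          then have "D a x \<in> FV t k'" using x a D_FV by simp
          from acts_as_FV[OF Y this] show ?thesis using w Suc by (simp add: FV_def)
        qed
      qed
      \<comment> \<open>\<open>Y\<close> meets an element of \<open>FV t (k - 1)\<close>, whence
        \<open>f (k - 1)\<close>; restoring the order of the letters costs an element of
        \<open>Ipow (Suc t)\<close>.\<close>
      have mid: "Dw (remove_nth i w) (Y (D (w ! i) x)) - f (k - 1) *\<^sub>R Dw w x \<in> Ipow (Suc t)" if i: "i < k" for i
      proof -
        obtain k' where k': "k = Suc k'" using i by (cases k) auto
        have wi: "w ! i \<in> C" "set (remove_nth i w) \<subseteq> C" "length (remove_nth i w) = k'"
          using w i k' set_take_subset[of i w] set_drop_subset[of "Suc i" w] by auto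
        have "D (w ! i) x \<in> FV t k'" using D_FV x wi(1) k' by simp
        from acts_asD(3)[OF Y this wi(2,3)]
        have 1: "Dw (remove_nth i w) (Y (D (w ! i) x)) - f (k - 1) *\<^sub>R Dw (remove_nth i w) (D (w ! i) x) \<in> Ipow (Suc t)"
          by (simp add: k' del: Ipow.simps)
        have "Dw (remove_nth i w @ [w ! i]) x - Dw w x \<in> Ipow (Suc t)"
          by (rule Dw_perm[OF mset_remove_nth]) (use w i wi(3) xI k' in simp_all)
        then have 2: "f (k - 1) *\<^sub>R (Dw (remove_nth i w) (D (w ! i) x) - Dw w x) \<in> Ipow (Suc t)"
          by (intro Ipow_scale) (simp add: Dw_append del: Ipow.simps)
        from Ipow_add[OF 1 2] show ?thesis by (simp add: algebra_simps del: Ipow.simps)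
      qed
      have "Dw w (\<Sum>a\<in>C. B a (Y (D a x))) = (\<Sum>a\<in>C. B a (Dw w (Y (D a x)))) +
          (\<Sum>a\<in>C. \<Sum>i<k. \<phi> (w ! i) a *\<^sub>R Dw (remove_nth i w) (Y (D a x)))"
        by (simp add: linear_sum[OF linear_Dw] Dw_Leibniz[OF B(1,2)] w(2) sum.distrib)
      also have "(\<Sum>a\<in>C. \<Sum>i<k. \<phi> (w ! i) a *\<^sub>R Dw (remove_nth i w) (Y (D a x))) =
          (\<Sum>i<k. \<Sum>a\<in>C. \<phi> (w ! i) a *\<^sub>R Dw (remove_nth i w) (Y (D a x)))"
        by (rule sum.swap)
      also have "\<dots> = (\<Sum>i<k. Dw (remove_nth i w) (Y (D (w ! i) x)))"
      proof (intro sum.cong refl)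
        fix i assume "i \<in> {..<k}"
        then have "w ! i \<in> C" using w by auto
        then have "(\<Sum>a\<in>C. \<phi> (w ! i) a *\<^sub>R Dw (remove_nth i w) (Y (D a x))) =
            (\<Sum>a\<in>C. if a = w ! i then Dw (remove_nth i w) (Y (D a x)) else 0)"
          by (intro sum.cong refl) (simp add: \<phi>_C)
        with \<open>w ! i \<in> C\<close> show "(\<Sum>a\<in>C. \<phi> (w ! i) a *\<^sub>R Dw (remove_nth i w) (Y (D a x))) =
            Dw (remove_nth i w) (Y (D (w ! i) x))"
          by (simp add: finite_C)
      qed
      finally have eq: "Dw w (\<Sum>a\<in>C. B a (Y (D a x))) - (real k * f (k - 1)) *\<^sub>R Dw w x =
        (\<Sum>a\<in>C. B a (Dw w (Y (D a x)))) +
        (\<Sum>i<k. Dw (remove_nth i w) (Y (D (w ! i) x)) - f (k - 1) *\<^sub>R Dw w x)"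
        by (simp add: sum_subtractf sum_constant_scaleR del: sum_constant)
      show ?thesis
        unfolding eq by (intro Ipow_add low Ipow_sum mid) simp
    qed
    ultimately show ?thesis
      using Ipow_add[of "Dw w (Z x - (\<Sum>a\<in>C. B a (Y (D a x))))" "Suc t"]
      by (fastforce simp: linear_diff[OF linear_Dw] simp del: Ipow.simps)
  qed
  ultimately show ?thesis
    unfolding acts_as_def using assms(2) by blast
qed

lemma acts_as_opL:
  assumes "acts_as Y f"
  shows "acts_as (opL Y) (\<lambda>k. real k * f (k - 1))"
proof (rule acts_as_step[OF assms linear_opL[OF acts_asD(1)[OF assms]] linear_mult_left])
  show "D b (a * y) = \<phi> b a *\<^sub>R y + a * D b y" if "a \<in> C" for a b y
    using C_H1 that by (simp add: D_mult H1_contraction[OF deg_functional_\<phi>] subset_iff)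
  show "a * y \<in> Ipow (Suc s)" if "a \<in> C" "y \<in> Ipow s" for a s y
    using C_H1 that by (intro Ipow_SucI) (auto intro: counit_graded)
  show "opL Y x - (\<Sum>a\<in>C. a * Y (D a x)) \<in> Ipow (Suc s)" for s x
    by (simp add: opL_def real_vector.subspace_0[OF subspace_Ipow] del: Ipow.simps)
qed

text \<open>\<open>Dw\<close> is built from left contractions only. Replacing D' by D under
  \<open>opR\<close> changes the result by terms in \<open>Ipow (Suc s)\<close>, because D - D'
  preserves the filtration and multiplication by \<open>a\<close> raises it.\<close>

lemma acts_as_opR:
  assumes "acts_as Y f"
  shows "acts_as (opR Y) (\<lambda>k. real k * f (k - 1))"
proof (rule acts_as_step[OF assms linear_opR[OF acts_asD(1)[OF assms]] linear_mult_right])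
  note lin = acts_asD(1)[OF assms]
  have CI: "y * a \<in> Ipow (Suc s)" if "a \<in> C" "y \<in> Ipow s" for a s y
    using Ipow_mult[OF that(2) H_Ipow_1[of a 1]] C_H1 that(1) by (auto simp del: Ipow.simps)
  then show "y * a \<in> Ipow (Suc s)" if "a \<in> C" "y \<in> Ipow s" for a s y
    using that by blast
  show "D b (y * a) = \<phi> b a *\<^sub>R y + D b y * a" if "a \<in> C" for a b y
    using C_H1 that by (simp add: D_mult H1_contraction[OF deg_functional_\<phi>] subset_iff)
  show "opR Y x - (\<Sum>a\<in>C. Y (D a x) * a) \<in> Ipow (Suc s)" if "x \<in> Ipow s" for s x
  proof -
    have "opR Y x - (\<Sum>a\<in>C. Y (D a x) * a) = - (\<Sum>a\<in>C. Y (D a x - D' a x) * a)"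
      by (simp add: opR_def linear_diff[OF lin] sum_subtractf left_diff_distrib)
    moreover have "(\<Sum>a\<in>C. Y (D a x - D' a x) * a) \<in> Ipow (Suc s)"
      by (intro Ipow_sum CI acts_asD(2)[OF assms] D_diff_D' that)
    ultimately show ?thesis
      using real_vector.subspace_neg[OF subspace_Ipow] by (simp del: Ipow.simps)
  qed
qed

text \<open>The recursion from f to k f (k - 1) adds one factor to the falling factorial at each of
  the 2r steps. To leading order, left and right steps have the same effect.\<close>

lemma acts_as_opR_opL: "acts_as ((opR ^^ r) ((opL ^^ r) id)) (\<lambda>k. falling k (2 * r))"
proof -
  have id: "acts_as id (\<lambda>k. falling k 0)"
    unfolding acts_as_def using real_vector.linear_id
    by (simp add: falling_def real_vector.subspace_0[OF subspace_Ipow] del: Ipow.simps)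
  have L: "acts_as ((opL ^^ j) id) (\<lambda>k. falling k j)" for j
  proof (induction j)
    case 0
    show ?case unfolding funpow_0 by (rule id)
  next
    case (Suc j)
    show ?case using acts_as_opL[OF Suc] by (simp add: falling_Suc)
  qed
  have "acts_as ((opR ^^ j) ((opL ^^ r) id)) (\<lambda>k. falling k (r + j))" for j
  proof (induction j)
    case 0
    show ?case unfolding funpow_0 add_0_right by (rule L)
  next
    case (Suc j)
    show ?case using acts_as_opR[OF Suc] by (simp add: falling_Suc)
  qed
  from this[of r] show ?thesis by (simp add: mult_2)
qed

lemma TaBr2R_FV:
  assumes "1 \<le> r" "2 * r \<le> n" "x \<in> FV t k" "x \<in> H n"
  shows "TaBr2R H \<Delta> r n x - \<beta> r n k *\<^sub>R x \<in> FU t k"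
proof -
  let ?Y = "(opR ^^ r) ((opL ^^ r) id)"
  have "?Y x \<in> Ipow (t + k)" "x \<in> Ipow (t + k)"
    using acts_asD(2)[OF acts_as_opR_opL] assms(3) by (auto simp: FV_def)
  then have "?Y x - falling k (2 * r) *\<^sub>R x \<in> Ipow (t + k)" by (intro Ipow_diff Ipow_scale)
  moreover have "Dw w (?Y x - falling k (2 * r) *\<^sub>R x) \<in> Ipow (Suc t)" if "set w \<subseteq> C" "length w = k" for w
    using acts_asD(3)[OF acts_as_opR_opL assms(3) that]
    by (simp only: linear_diff[OF linear_Dw] linear_scale[OF linear_Dw])
  ultimately have "?Y x - falling k (2 * r) *\<^sub>R x \<in> FU t k"
    by (simp add: FU_def del: Ipow.simps)
  then have "(1 / falling n (2 * r)) *\<^sub>R (?Y x - falling k (2 * r) *\<^sub>R x) \<in> FU t k"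
    by (rule subspace_scale[OF subspace_FU])
  then show ?thesis
    by (simp add: TaBr2R_eq[OF assms(1,2,4)] \<beta>_def scaleR_diff_right)
qed

end

section \<open>Multiplicities\<close>

lemma funpow_invariant: "P x \<Longrightarrow> (\<And>x. P x \<Longrightarrow> P (f x)) \<Longrightarrow> P ((f ^^ k) x)"
  by (induction k) simp_all

text \<open>The multiplicity of one element is split off, giving a factor 1 + X + X^2 + ... for
  each. The coefficient ring is general because the series occurs in x over the reals and in y over
  power series.\<close>

lemma Abs_fps_card_multisets_of_size:
  assumes "finite A"
  shows "Abs_fps (\<lambda>k. of_nat (card (multisets_of_size A k))) = (Abs_fps (\<lambda>_. 1) :: 'b::comm_ring_1 fps) ^ card A"
  using assms
proof (induction A)
  case empty
  have "card (multisets_of_size {} k) = (if k = 0 then 1 else 0)" for k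
    by simp
  then show ?case by (intro fps_ext) simp
next
  case (insert a A)
  have "card (multisets_of_size (insert a A) k) = (\<Sum>m = 0..k. card (multisets_of_size A (k - m)))" for k
    using bij_betw_same_card[OF bij_betw_multisets_of_size_insert[OF insert.hyps(2)]] insert.hyps(1)
    by (simp add: card_SigmaI finite_multisets_of_size flip: bij_betw_same_card)
  then have "Abs_fps (\<lambda>k. of_nat (card (multisets_of_size (insert a A) k))) =
      (Abs_fps (\<lambda>_. 1) :: 'b fps) * Abs_fps (\<lambda>k. of_nat (card (multisets_of_size A k)))"
    by (intro fps_ext) (simp add: fps_mult_nth)
  then show ?case using insert by simp
qed

section \<open>Taylor expansion along degree 1\<close>

context H1_dual_basis
begin

lemma D_msym:
  assumes "a \<in> C" "set_mset M \<subseteq> C"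
  shows "D a (msym M) = real (size M) *\<^sub>R (if a \<in># M then msym (M - {#a#}) else 0)"
proof -
  have "D a (msym M) = real (size M) *\<^sub>R (\<Sum>x\<in>set_mset M. \<phi> a x *\<^sub>R msym (M - {#x#}))"
    using assms(2) C_H1 H1_contraction[OF deg_functional_\<phi>]
    by (intro derivation_msym linear_D D_mult) auto
  also have "(\<Sum>x\<in>set_mset M. \<phi> a x *\<^sub>R msym (M - {#x#})) = (\<Sum>x\<in>set_mset M. if x = a then msym (M - {#x#}) else 0)"
    using assms by (intro sum.cong refl) (auto simp: \<phi>_C)
  finally show ?thesis by (simp del: scaleR_eq_0_iff)
qed

text \<open>Words in the contractions are dual to symmetrised products up to m!. As \<open>e\<close>
  lies in \<open>FV t 0\<close>, a contraction that meets \<open>e\<close> leaves it in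
  \<open>Ipow t\<close>, one power deeper than expected, so such terms are of higher order.\<close>

lemma Dw_msym:
  assumes e: "e \<in> FV t 0"
  shows "M \<in> multisets_of_size C m \<Longrightarrow> set w \<subseteq> C \<Longrightarrow> length w = m \<Longrightarrow>
    Dw w (msym M * e) - (if mset w = M then fact m else 0) *\<^sub>R e \<in> Ipow (Suc t)"
proof (induction m arbitrary: M w)
  case 0
  then show ?case by (simp add: real_vector.subspace_0[OF subspace_Ipow] del: Ipow.simps)
next
  case (Suc m)
  then obtain w0 a where w: "w = w0 @ [a]" by (metis length_Suc_conv_rev)
  have a: "a \<in> C" and w0: "set w0 \<subseteq> C" "length w0 = m" using Suc.prems(2,3) w by auto
  have M: "set_mset M \<subseteq> C" "size M = Suc m" using Suc.prems(1) by (auto simp: multisets_of_size_def)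
  have De: "D a e \<in> Ipow t" using e a by (auto simp: FV_def dest!: spec[of _ "[a]"])
  have "msym M * D a e \<in> Ipow (Suc m + t)"
    using Ipow_mult[OF msym_Ipow De, of M] M C_H1 by auto
  then have "Dw w0 (msym M * D a e) \<in> Ipow (Suc t)" using w0 by (intro Dw_Ipow) (simp add: add.commute)
  moreover have "Dw w0 (D a (msym M) * e) - (if mset w = M then fact (Suc m) else 0) *\<^sub>R e \<in> Ipow (Suc t)"
  proof (cases "a \<in># M")
    case True
    then have M': "M - {#a#} \<in> multisets_of_size C m"
      using M by (auto simp: multisets_of_size_def size_Diff_singleton dest: in_diffD)
    have iff: "mset w = M \<longleftrightarrow> mset w0 = M - {#a#}"
      using True by (auto simp: w)
    have "real (Suc m) *\<^sub>R (Dw w0 (msym (M - {#a#}) * e) - (if mset w0 = M - {#a#} then fact m else 0) *\<^sub>R e) \<in> Ipow (Suc t)"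
      by (intro Ipow_scale Suc.IH[OF M'] w0)
    then show ?thesis
      using True by (cases "mset w0 = M - {#a#}")
        (simp_all add: D_msym[OF a M(1)] M(2) linear_scale[OF linear_Dw] iff scaleR_diff_right
          del: Ipow.simps of_nat_Suc)
  next
    case False
    then have "mset w \<noteq> M" using w by auto
    with False show ?thesis
      by (simp add: D_msym[OF a M(1)] linear_0[OF linear_Dw] real_vector.subspace_0[OF subspace_Ipow] del: Ipow.simps)
  qed
  ultimately show ?case
    unfolding w Dw_append Dw.simps D_mult linear_add[OF linear_Dw]
    using Ipow_add by (fastforce simp: algebra_simps w simp del: Ipow.simps)
qed

lemma msym_mult_FV:
  assumes "M \<in> multisets_of_size C k" "e \<in> FV t 0"
  shows "msym M * e \<in> FV t k"
proof -
  have M: "set_mset M \<subseteq> H 1" "size M = k" using assms(1) C_H1 by (auto simp: multisets_of_size_def)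
  have eI: "e \<in> Ipow t" using assms(2) by (simp add: FV_def)
  have "Dw w (msym M * e) \<in> Ipow t" if w: "set w \<subseteq> C" "length w = Suc k" for w
  proof -
    obtain a v where v: "w = a # v" using w by (cases w) auto
    let ?c = "(if mset v = M then fact k else 0) :: real"
    have "Dw v (msym M * e) - ?c *\<^sub>R e \<in> Ipow (Suc t)"
      using Dw_msym[OF assms(2,1)] w v by auto
    then have "D a (Dw v (msym M * e) - ?c *\<^sub>R e) \<in> Ipow t" by (rule D_Ipow)
    moreover have "?c *\<^sub>R D a e \<in> Ipow t"
      using assms(2) w v by (intro Ipow_scale) (auto simp: FV_def dest!: spec[of _ "[a]"])
    ultimately have "D a (Dw v (msym M * e) - ?c *\<^sub>R e) + ?c *\<^sub>R D a e \<in> Ipow t" by (rule Ipow_add)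
    then show ?thesis by (simp add: v linear_diff[OF linear_D] linear_scale[OF linear_D])
  qed
  moreover have "msym M * e \<in> Ipow (t + k)"
    using Ipow_mult[OF msym_Ipow[OF M(1)] eI] M(2) by (simp add: add.commute)
  ultimately show ?thesis by (simp add: FV_def)
qed

text \<open>\<open>FU t 0\<close> is \<open>Ipow (Suc t)\<close>: this is the dimension in degree m
  of the joint kernel of the contractions on the quotient of \<open>Ipow t\<close> by
  \<open>Ipow (Suc t)\<close>.\<close>

definition ker_dim :: "nat \<Rightarrow> nat \<Rightarrow> nat" where
  "ker_dim m t = dim (FV t 0 \<inter> H m) - dim (FU t 0 \<inter> H m)"

lemma subspace_FV_H: "subspace (FV t k \<inter> H m)" and subspace_FU_H: "subspace (FU t k \<inter> H m)"
  by (intro real_vector.subspace_inter subspace_FV subspace_FU subspace_H)+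

text \<open>The quotient of \<open>FV t k\<close> by \<open>FU t k\<close> is the k-th symmetric
  power of \<open>H 1\<close> tensored with the joint kernel: the products
  \<open>msym M * b\<close>, with b from a basis of the kernel, represent a basis.\<close>

lemma dim_FV_H:
  assumes "k \<le> n"
  shows "dim (FV t k \<inter> H n) = dim (FU t k \<inter> H n) + card (multisets_of_size C k) * ker_dim (n - k) t"
proof -
  obtain F where F: "finite F" "span F = H n" using finite_dimensional by blast
  obtain F' where F': "finite F'" "span F' = H (n - k)" using finite_dimensional by blast
  have sub: "FU t 0 \<inter> H (n - k) \<subseteq> FV t 0 \<inter> H (n - k)" "finite F'" "FV t 0 \<inter> H (n - k) \<subseteq> span F'"
    using FU_subset_FV[of t 0] F' by auto
  obtain B where B: "finite B" "B \<subseteq> FV t 0 \<inter> H (n - k)"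
    "card B + dim (FU t 0 \<inter> H (n - k)) = dim (FV t 0 \<inter> H (n - k))"
    "\<And>\<alpha>. (\<Sum>b\<in>B. \<alpha> b *\<^sub>R b) \<in> FU t 0 \<inter> H (n - k) \<Longrightarrow> \<forall>b\<in>B. \<alpha> b = 0"
    "\<And>x. x \<in> FV t 0 \<inter> H (n - k) \<Longrightarrow> \<exists>\<alpha>. x - (\<Sum>b\<in>B. \<alpha> b *\<^sub>R b) \<in> FU t 0 \<inter> H (n - k)"
    by (rule complement_basis[OF subspace_FU_H[of t 0 "n - k"] subspace_FV_H[of t 0 "n - k"] sub]) (rule that)
  let ?Ms = "multisets_of_size C k" and ?v = "\<lambda>(M, b). msym M * b"
  have finMs: "finite ?Ms" using finite_C by (rule finite_multisets_of_size)
  have vA: "msym M * b \<in> FV t k \<inter> H n" if "M \<in> ?Ms" "b \<in> B" for M b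
  proof -
    have "msym M \<in> H (\<Sum>x\<in>#M. 1)"
      using that(1) C_H1 by (intro msym_graded) (auto simp: multisets_of_size_def)
    then have "msym M \<in> H k" using that(1) by (auto simp: multisets_of_size_def)
    from mult_graded[OF this, of b "n - k"] that assms B(2) show ?thesis
      using msym_mult_FV[OF that(1), of b t] by auto
  qed
  \<comment> \<open>A word singles out the coefficients at its own multiset of letters, up to the
    factor k!.\<close>
  have Dw_sum: "Dw w (\<Sum>M\<in>?Ms. \<Sum>b\<in>B. \<alpha> (M, b) *\<^sub>R (msym M * b)) - (\<Sum>b\<in>B. (fact k * \<alpha> (mset w, b)) *\<^sub>R b) \<in> Ipow (Suc t)"
    if w: "set w \<subseteq> C" "length w = k" for w and \<alpha> :: "'a multiset \<times> 'a \<Rightarrow> real"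
  proof -
    have wM: "mset w \<in> ?Ms" using w by (simp add: multisets_of_size_def)
    have "(\<Sum>M\<in>?Ms. \<Sum>b\<in>B. \<alpha> (M, b) *\<^sub>R (Dw w (msym M * b) - (if mset w = M then fact k else 0) *\<^sub>R b)) \<in> Ipow (Suc t)"
      by (intro Ipow_sum Ipow_scale Dw_msym) (use B(2) w in auto)
    also have "(\<Sum>M\<in>?Ms. \<Sum>b\<in>B. \<alpha> (M, b) *\<^sub>R (Dw w (msym M * b) - (if mset w = M then fact k else 0) *\<^sub>R b)) =
      Dw w (\<Sum>M\<in>?Ms. \<Sum>b\<in>B. \<alpha> (M, b) *\<^sub>R (msym M * b)) -
      (\<Sum>M\<in>?Ms. if mset w = M then \<Sum>b\<in>B. (fact k * \<alpha> (M, b)) *\<^sub>R b else 0)"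
      by (simp add: linear_sum[OF linear_Dw] linear_scale[OF linear_Dw] scaleR_diff_right sum_subtractf)
        (intro sum.cong refl, auto simp: mult.commute)
    finally show ?thesis using wM finMs by (simp del: Ipow.simps)
  qed
  have pairs: "(\<Sum>i\<in>?Ms \<times> B. \<alpha> i *\<^sub>R ?v i) = (\<Sum>M\<in>?Ms. \<Sum>b\<in>B. \<alpha> (M, b) *\<^sub>R (msym M * b))"
    for \<alpha> :: "'a multiset \<times> 'a \<Rightarrow> real"
    by (simp add: sum.cartesian_product case_prod_unfold)
  have "dim (FV t k \<inter> H n) = dim (FU t k \<inter> H n) + card (?Ms \<times> B)"
  proof (rule dim_eq_complement_family[OF subspace_FU_H subspace_FV_H _ F(1), where v = ?v])
    show "FU t k \<inter> H n \<subseteq> FV t k \<inter> H n" using FU_subset_FV by blast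
    show "FV t k \<inter> H n \<subseteq> span F" using F(2) by simp
    show "finite (?Ms \<times> B)" using finMs B(1) by simp
    show "?v ` (?Ms \<times> B) \<subseteq> FV t k \<inter> H n" using vA by auto
  next
    fix \<alpha> assume "(\<Sum>i\<in>?Ms \<times> B. \<alpha> i *\<^sub>R ?v i) \<in> FU t k \<inter> H n"
    then have U: "(\<Sum>M\<in>?Ms. \<Sum>b\<in>B. \<alpha> (M, b) *\<^sub>R (msym M * b)) \<in> FU t k" by (simp add: pairs)
    have "\<alpha> (M, b) = 0" if M: "M \<in> ?Ms" "b \<in> B" for M b
    proof -
      obtain w where w: "mset w = M" using ex_mset by blast
      then have w': "set w \<subseteq> C" "length w = k" using M(1) by (auto simp: multisets_of_size_def)
      have "Dw w (\<Sum>M\<in>?Ms. \<Sum>b\<in>B. \<alpha> (M, b) *\<^sub>R (msym M * b)) \<in> Ipow (Suc t)"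
        using U w' by (simp add: FU_def del: Ipow.simps)
      from Ipow_diff[OF this Dw_sum[OF w', of \<alpha>]]
      have "(\<Sum>b\<in>B. (fact k * \<alpha> (M, b)) *\<^sub>R b) \<in> Ipow (Suc t)" by (simp add: w del: Ipow.simps)
      moreover have "(\<Sum>b\<in>B. (fact k * \<alpha> (M, b)) *\<^sub>R b) \<in> H (n - k)"
        using B(2) by (intro subspace_sum subspace_H subspace_scale) auto
      ultimately have "\<forall>b\<in>B. fact k * \<alpha> (M, b) = 0" by (intro B(4)) (simp add: FU_0 del: Ipow.simps)
      with M(2) show ?thesis by auto
    qed
    then show "\<forall>i\<in>?Ms \<times> B. \<alpha> i = 0" by auto
  next
    fix x assume x: "x \<in> FV t k \<inter> H n"
    obtain word where word: "\<And>M :: 'a multiset. mset (word M) = M" by (metis ex_mset)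
    have word': "set (word M) \<subseteq> C" "length (word M) = k" if "M \<in> ?Ms" for M
      using that word[of M] by (auto simp: multisets_of_size_def simp flip: set_mset_mset size_mset)
    have "\<exists>\<alpha>. Dw (word M) x - (\<Sum>b\<in>B. \<alpha> b *\<^sub>R b) \<in> FU t 0 \<inter> H (n - k)" if "M \<in> ?Ms" for M
      using Dw_FV[of x t k "word M"] Dw_H[of x n "word M"] word'[OF that] x by (intro B(5)) auto
    then obtain \<gamma> where \<gamma>: "\<And>M. M \<in> ?Ms \<Longrightarrow> Dw (word M) x - (\<Sum>b\<in>B. \<gamma> M b *\<^sub>R b) \<in> FU t 0 \<inter> H (n - k)"
      by metis
    \<comment> \<open>Taylor coefficients: the coordinates of the derivative along M, divided by
      k!.\<close>
    define \<alpha> where "\<alpha> = (\<lambda>(M, b). \<gamma> M b / fact k)"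
    let ?s = "\<Sum>M\<in>?Ms. \<Sum>b\<in>B. \<alpha> (M, b) *\<^sub>R (msym M * b)"
    have s: "?s \<in> FV t k \<inter> H n"
      by (intro subspace_sum subspace_FV_H subspace_scale vA)
    have "Dw w (x - ?s) \<in> Ipow (Suc t)" if w: "set w \<subseteq> C" "length w = k" for w
    proof -
      let ?M = "mset w"
      have M: "?M \<in> ?Ms" using w by (simp add: multisets_of_size_def)
      have 1: "Dw w x - Dw (word ?M) x \<in> Ipow (Suc t)"
        using x w by (intro Dw_perm) (simp_all add: word FV_def)
      have 2: "Dw (word ?M) x - (\<Sum>b\<in>B. \<gamma> ?M b *\<^sub>R b) \<in> Ipow (Suc t)"
        using \<gamma>[OF M] by (simp add: FU_0 del: Ipow.simps)
      have 3: "Dw w ?s - (\<Sum>b\<in>B. \<gamma> ?M b *\<^sub>R b) \<in> Ipow (Suc t)"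
        using Dw_sum[OF w, of \<alpha>] by (simp add: \<alpha>_def del: Ipow.simps)
      from Ipow_diff[OF Ipow_add[OF 1 2] 3] show ?thesis
        by (simp add: linear_diff[OF linear_Dw] del: Ipow.simps)
    qed
    moreover have "x - ?s \<in> FV t k \<inter> H n"
      using x s by (rule real_vector.subspace_diff[OF subspace_FV_H])
    ultimately have "x - ?s \<in> FU t k \<inter> H n"
      by (simp add: FU_def FV_def del: Ipow.simps)
    then show "\<exists>\<alpha>. x - (\<Sum>i\<in>?Ms \<times> B. \<alpha> i *\<^sub>R ?v i) \<in> FU t k \<inter> H n"
      unfolding pairs by blast
  qed
  moreover have "card B = ker_dim (n - k) t" using B(3) by (simp add: ker_dim_def)
  ultimately show ?thesis by (simp add: card_cartesian_product)
qed

text \<open>The sum stops at m because for t > m the space \<open>Ipow t\<close> has no element of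
  degree m other than 0.\<close>

definition ker_series :: "nat \<Rightarrow> nat" where
  "ker_series m = (\<Sum>t\<le>m. ker_dim m t)"

section \<open>Characteristic polynomial and generating series\<close>

abbreviation cC :: "nat \<Rightarrow> nat" where "cC k \<equiv> card (multisets_of_size C k)"

text \<open>Stated for any operator that is scalar on all subquotients, because it is used for the
  identity as well. The chain of the \<open>FV t k\<close> starts at \<open>Ipow (Suc n)\<close>,
  which meets \<open>H n\<close> in 0.\<close>

lemma flag_poly_H:
  assumes T: "\<And>t k x. x \<in> FV t k \<inter> H n \<Longrightarrow> T x - l k *\<^sub>R x \<in> FU t k \<inter> H n"
  shows "flag_poly T (H n) (\<Prod>k\<le>n. [:- l k, 1:] ^ (cC k * ker_series (n - k)))"
proof -
  let ?L = "\<lambda>s k. [:- l k, 1:] ^ (cC k * ker_dim (n - k) (s - k))"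
  obtain F where F: "finite F" "span F = H n" using finite_dimensional by blast
  have step: "flag_poly T (FV (s - k) k \<inter> H n) (q * ?L s k)"
    if q: "flag_poly T (FU (s - k) k \<inter> H n) q" and "k \<le> s" "s \<le> n" for k q s
  proof -
    have "flag_poly T (FV (s - k) k \<inter> H n) (q * [:- l k, 1:] ^ (dim (FV (s - k) k \<inter> H n) - dim (FU (s - k) k \<inter> H n)))"
      by (rule flag_poly_extend[OF q subspace_FV_H _ F(1) _ T]) (use FU_subset_FV F(2) in auto)
    then show ?thesis using dim_FV_H[of k n "s - k"] that by simp
  qed
  \<comment> \<open>One passage from \<open>Ipow (Suc s)\<close> to \<open>Ipow s\<close>, through
    the polynomial degrees k = 0, ..., s in this order.\<close>
  have level: "flag_poly T (Ipow s \<inter> H n) (p * (\<Prod>k\<le>s. ?L s k))"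
    if p: "flag_poly T (Ipow (Suc s) \<inter> H n) p" and "s \<le> n" for s p
  proof -
    have "flag_poly T (FV (s - k) k \<inter> H n) (p * (\<Prod>k'\<le>k. ?L s k'))" if "k \<le> s" for k
      using that
    proof (induction k)
      case 0
      show ?case using step[of s 0 p] p \<open>s \<le> n\<close> by (simp add: FU_0 del: Ipow.simps)
    next
      case (Suc k)
      have "FU (s - Suc k) (Suc k) = FV (s - k) k" using Suc.prems by (simp add: FU_Suc Suc_diff_Suc)
      with Suc have "flag_poly T (FU (s - Suc k) (Suc k) \<inter> H n) (p * (\<Prod>k'\<le>k. ?L s k'))" by simp
      from step[OF this Suc.prems \<open>s \<le> n\<close>] show ?case by (simp add: mult.assoc)
    qed
    from this[of s] show ?thesis by (simp add: FV_0)
  qed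
  have "flag_poly T (Ipow s \<inter> H n) (\<Prod>s'\<in>{s..n}. \<Prod>k\<le>s'. ?L s' k)" if "s \<le> Suc n" for s
    using that
  proof (induction s rule: inc_induct)
    case base
    have "Ipow (Suc n) \<inter> H n = {0}"
      using Ipow_H[of _ "Suc n" n] real_vector.subspace_0[OF subspace_Ipow, of "Suc n"] zero_H by blast
    then show ?case using flag_poly_zero by simp
  next
    case (step s)
    from level[OF step.IH] step.hyps show ?case
      by (simp add: atLeastAtMost_insertL[of s n, symmetric] mult.commute)
  qed
  from this[of 0] have "flag_poly T (H n) (\<Prod>s\<in>{0..n}. \<Prod>k\<le>s. ?L s k)"
    by simp
  \<comment> \<open>Regrouping by k: with t = s - k the dimensions of the kernel add up to
    \<open>ker_series\<close>.\<close>
  also have "(\<Prod>s\<in>{0..n}. \<Prod>k\<le>s. ?L s k) = (\<Prod>s\<in>{..n}. \<Prod>k\<in>{k\<in>{..n}. k \<le> s}. ?L s k)"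
    by (intro prod.cong) auto
  also have "\<dots> = (\<Prod>k\<in>{..n}. \<Prod>s\<in>{s\<in>{..n}. k \<le> s}. ?L s k)"
    by (rule prod.swap_restrict) auto
  also have "\<dots> = (\<Prod>k\<le>n. [:- l k, 1:] ^ (cC k * ker_series (n - k)))"
  proof (intro prod.cong refl)
    fix k assume "k \<in> {..n}"
    have "(\<Sum>s\<in>{s\<in>{..n}. k \<le> s}. ker_dim (n - k) (s - k)) = (\<Sum>t\<le>n - k. ker_dim (n - k) t)"
      by (rule sum.reindex_bij_witness[of _ "\<lambda>t. t + k" "\<lambda>s. s - k"]) (use \<open>k \<in> {..n}\<close> in auto)
    then show "(\<Prod>s\<in>{s\<in>{..n}. k \<le> s}. ?L s k) = [:- l k, 1:] ^ (cC k * ker_series (n - k))"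
      by (simp add: ker_series_def power_sum[symmetric] sum_distrib_left[symmetric])
  qed
  finally show ?thesis .
qed

lemma TaBr2R_H:
  assumes "1 \<le> r" "2 * r \<le> n" "x \<in> H n"
  shows "TaBr2R H \<Delta> r n x \<in> H n"
proof -
  define good where "good Y \<longleftrightarrow> linear Y \<and> (\<forall>m. \<forall>x\<in>H m. Y x \<in> H m)" for Y :: "'a \<Rightarrow> 'a"
  have goodL: "good (opL Y)" if "good Y" for Y
    unfolding good_def
  proof (intro conjI allI ballI)
    show "linear (opL Y)" using that linear_opL by (simp add: good_def)
    fix m x assume x: "x \<in> H m"
    show "opL Y x \<in> H m"
    proof (cases m)
      case 0
      with x that show ?thesis by (auto simp: opL_def D_H(2) good_def linear_0 zero_H)
    next
      case (Suc m')
      then have "a * Y (D a x) \<in> H (1 + m')" if "a \<in> C" for a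
        using C_H1 that \<open>good Y\<close> D_H(1)[OF x] by (intro mult_graded) (auto simp: good_def)
      then show ?thesis unfolding opL_def Suc by (intro subspace_sum subspace_H) simp
    qed
  qed
  have goodR: "good (opR Y)" if "good Y" for Y
    unfolding good_def
  proof (intro conjI allI ballI)
    show "linear (opR Y)" using that linear_opR by (simp add: good_def)
    fix m x assume x: "x \<in> H m"
    show "opR Y x \<in> H m"
    proof (cases m)
      case 0
      with x that show ?thesis by (auto simp: opR_def D'_H(2) good_def linear_0 zero_H)
    next
      case (Suc m')
      then have "Y (D' a x) * a \<in> H (m' + 1)" if "a \<in> C" for a
        using C_H1 that \<open>good Y\<close> D'_H(1)[OF x] by (intro mult_graded) (auto simp: good_def)
      then show ?thesis unfolding opR_def Suc by (intro subspace_sum subspace_H) simp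
    qed
  qed
  have "good id" by (simp add: good_def linear_iff)
  then have "good ((opL ^^ r) id)" by (rule funpow_invariant[where P = good, OF _ goodL])
  then have "good ((opR ^^ r) ((opL ^^ r) id))" by (rule funpow_invariant[where P = good, OF _ goodR])
  then show ?thesis
    using assms by (auto simp: TaBr2R_eq good_def intro!: subspace_scale subspace_H)
qed

lemma char_poly_TaBr2R:
  assumes "1 \<le> r" "2 * r \<le> n"
  shows "char_poly_on (H n) (TaBr2R H \<Delta> r n) = (\<Prod>k\<le>n. [:- \<beta> r n k, 1:] ^ (cC k * ker_series (n - k)))"
proof (rule flag_poly_char_poly[OF flag_poly_H linear_TaBr2R[OF assms(1)]])
  fix t k x assume x: "x \<in> FV t k \<inter> H n"
  then have "TaBr2R H \<Delta> r n x - \<beta> r n k *\<^sub>R x \<in> FU t k"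
    by (intro TaBr2R_FV assms) auto
  moreover have "TaBr2R H \<Delta> r n x - \<beta> r n k *\<^sub>R x \<in> H n"
    using TaBr2R_H[OF assms] x by (intro real_vector.subspace_diff subspace_H subspace_scale) auto
  ultimately show "TaBr2R H \<Delta> r n x - \<beta> r n k *\<^sub>R x \<in> FU t k \<inter> H n" by blast
qed

text \<open>The identity is the scalar 1 on every subquotient, and the degree of its characteristic
  polynomial is the dimension.\<close>

lemma dim_H_eq: "dim (H n) = (\<Sum>k\<le>n. cC k * ker_series (n - k))"
proof -
  have "flag_poly (\<lambda>x. x) (H n) (\<Prod>k\<le>n. [:- 1, 1:] ^ (cC k * ker_series (n - k)))"
    by (rule flag_poly_H) (simp add: real_vector.subspace_0[OF subspace_FU] zero_H)
  from flag_poly_degree[OF this] show ?thesis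
    by (simp add: power_sum[symmetric] degree_power_eq)
qed

text \<open>By \<open>dim_H_eq\<close> the Hilbert series of \<open>H\<close> is (1 - x)^(-d) K(x),
  where d = dim \<open>H 1\<close> and K is the series of \<open>ker_series\<close>. Multiplying by
  (1 - x)^d leaves K, and (1 - y)^(-d) supplies the numbers \<open>cC k\<close>.\<close>

lemma series_coeff_eq:
  assumes "k \<le> n"
  shows "series_coeff H (n - k) k = real (cC k * ker_series (n - k))"
proof -
  let ?F = "Abs_fps (\<lambda>_. 1) :: real fps" and ?G = "Abs_fps (\<lambda>_. 1) :: real fps fps"
  let ?Hs = "Abs_fps (\<lambda>m. real (dim (H m)))" and ?K = "Abs_fps (\<lambda>m. real (ker_series m))"
  let ?d = "dim (H 1)"
  have d: "?d = card C"
    using independent_C span_C real_vector.dim_eq_card_independent real_vector.dim_span by metis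
  have F: "Abs_fps (\<lambda>k. real (cC k)) = ?F ^ ?d" and G: "Abs_fps (\<lambda>k. of_nat (cC k)) = ?G ^ ?d"
    using Abs_fps_card_multisets_of_size[OF finite_C] d by metis+
  have inv: "(1 - fps_X) * ?F = 1"
    by (rule fps_ext) (simp add: left_diff_distrib)
  have "?Hs = ?F ^ ?d * ?K"
    unfolding F[symmetric] by (rule fps_ext) (simp add: fps_mult_nth dim_H_eq atLeast0AtMost)
  then have "(1 - fps_X) ^ ?d * ?Hs = ((1 - fps_X) * ?F) ^ ?d * ?K"
    by (simp add: power_mult_distrib mult.assoc)
  then have K: "(1 - fps_X) ^ ?d * ?Hs = ?K" by (simp add: inv)
  have "1 - fps_const fps_X = (fps_const (1 - fps_X) :: real fps fps)"
    by (simp add: fps_const_sub[symmetric] del: fps_const_sub)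
  then have "multiplicity_series H = fps_const ((1 - fps_X) ^ ?d) * ?G ^ ?d * fps_const ?Hs"
    by (simp add: multiplicity_series_def fps_fps_divide_one_minus_X power_mult_distrib
        fps_const_power[symmetric] del: fps_const_power)
  also have "\<dots> = fps_const ((1 - fps_X) ^ ?d * ?Hs) * ?G ^ ?d"
    by (simp add: mult_ac fps_const_mult[symmetric] del: fps_const_mult)
  finally have "multiplicity_series H = fps_const ?K * Abs_fps (\<lambda>k. of_nat (cC k))"
    by (simp only: K G)
  then have "fps_nth (multiplicity_series H) k = ?K * of_nat (cC k)" by simp
  also have "\<dots> = fps_const (real (cC k)) * ?K" by (simp add: fps_of_nat)
  finally show ?thesis by (simp add: series_coeff_def)
qed

text \<open>In degree 1 the dimension formula reads |C| = K_1 + |C| K_0 with K_0 = 1. This is why n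
  - 1 is missing from \<open>eigen_index\<close>.\<close>

lemma ker_series_1: "ker_series 1 = 0"
proof -
  have "dim (H 0) = 1"
    unfolding connected by (simp add: real_vector.dim_span real_vector.dim_eq_card_independent)
  then have 0: "ker_series 0 = 1" using dim_H_eq[of 0] by simp
  have "cC 1 = card C"
  proof -
    have "multisets_of_size C 1 = (\<lambda>x. {#x#}) ` C"
      by (auto simp: multisets_of_size_def dest!: size_1_singleton_mset[unfolded One_nat_def])
    then show ?thesis by (simp add: card_image inj_on_def)
  qed
  moreover have "dim (H 1) = card C"
    using independent_C span_C real_vector.dim_eq_card_independent real_vector.dim_span by metis
  ultimately show "ker_series 1 = 0" using dim_H_eq[of 1] 0 by (simp add: atMost_Suc)
qed

end

section \<open>Roots of the characteristic polynomial and coincidences among them\<close>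

lemma order_prod_linear_power:
  assumes "finite A"
  shows "order a (\<Prod>k\<in>A. [:- b k, 1 :: real:] ^ N k) = (\<Sum>k\<in>A. if b k = a then N k else 0)"
  using assms
proof (induction A)
  case (insert k A)
  have ord: "order a ([:- b k, 1:] ^ N k) = (if b k = a then N k else 0)"
    by (auto simp: order_power_n_n intro: order_0I)
  have "[:- b k, 1:] ^ N k * (\<Prod>k\<in>A. [:- b k, 1:] ^ N k) \<noteq> 0"
    using insert.hyps(1) by simp
  from order_mult[OF this] show ?case using insert ord by simp
qed simp

lemma poly_map_of_real_prod:
  "poly (map_poly complex_of_real (\<Prod>k\<in>A. [:- b k, 1:] ^ N k)) z = (\<Prod>k\<in>A. (z - of_real (b k)) ^ N k)"
proof -
  have mult: "map_poly complex_of_real (p * q) = map_poly complex_of_real p * map_poly complex_of_real q" for p q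
    by (rule poly_eqI) (simp add: coeff_map_poly coeff_mult)
  have pow: "poly (map_poly complex_of_real ([:- c, 1:] ^ m)) z = (z - of_real c) ^ m" for c m
  proof (induction m)
    case (Suc m)
    have "poly (map_poly complex_of_real [:- c, 1:]) z = z - of_real c" by (simp add: map_poly_pCons)
    with Suc show ?case by (simp add: mult del: mult_pCons_left)
  qed simp
  show ?thesis
  proof (cases "finite A")
    case True
    then show ?thesis
    proof (induction A)
      case (insert k A)
      then show ?case by (simp add: mult pow)
    qed simp
  qed simp
qed

text \<open>With m = m' + 1, the values at i and i + 1 share the factor \<open>falling i m'\<close>,
  multiplied by i - m' and by i + 1 respectively.\<close>

lemma falling_strict_mono:
  assumes "1 \<le> m" "m \<le> i" "i < j"
  shows "falling i m < falling j m"
  using assms(3,2)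
proof (induction rule: strict_inc_induct)
  case (base i)
  obtain m' where m: "m = Suc m'" using assms(1) by (cases m) auto
  have "falling i m = falling i m' * (real i - real m')" by (simp add: m falling_def)
  also have "\<dots> < real (Suc i) * falling i m'"
    using falling_pos[of m' i] base m by (simp add: mult.commute)
  also have "\<dots> = falling (Suc i) m" by (simp add: m falling_Suc)
  finally show ?case using base by simp
next
  case (step i)
  obtain m' where m: "m = Suc m'" using assms(1) by (cases m) auto
  have "falling i m = falling i m' * (real i - real m')" by (simp add: m falling_def)
  also have "\<dots> < real (Suc i) * falling i m'"
    using falling_pos[of m' i] step.prems m by (simp add: mult.commute)
  also have "\<dots> = falling (Suc i) m" by (simp add: m falling_Suc)
  finally show ?case using step by simp
qed

lemma \<beta>_eq_iff:
  assumes "1 \<le> r" "2 * r \<le> n" "2 * r \<le> j"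
  shows "\<beta> r n k = \<beta> r n j \<longleftrightarrow> k = j"
proof
  assume "\<beta> r n k = \<beta> r n j"
  then have eq: "falling k (2 * r) = falling j (2 * r)"
    using falling_pos[OF assms(2)] by (simp add: \<beta>_def)
  have "2 * r \<le> k"
    using eq falling_pos[OF assms(3)] falling_eq_0[of k "2 * r"] by (cases "k < 2 * r") auto
  then show "k = j"
    using falling_strict_mono[of "2 * r" k j] falling_strict_mono[of "2 * r" j k] eq assms
    by (cases k j rule: linorder_cases) auto
qed simp

lemma \<beta>_eq_0_iff:
  assumes "2 * r \<le> n"
  shows "\<beta> r n k = 0 \<longleftrightarrow> k < 2 * r"
  using falling_pos[OF assms] falling_eq_0[of k "2 * r"] falling_pos[of "2 * r" k]
  by (cases "k < 2 * r") (auto simp: \<beta>_def)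

lemma inj_on_\<beta>: "1 \<le> r \<Longrightarrow> 2 * r \<le> n \<Longrightarrow> inj_on (\<beta> r n) (eigen_index r n)"
proof (rule inj_onI)
  fix i j assume r: "1 \<le> r" "2 * r \<le> n" and "i \<in> eigen_index r n" "j \<in> eigen_index r n" "\<beta> r n i = \<beta> r n j"
  then have "i = 0 \<or> 2 * r \<le> i" "j = 0 \<or> 2 * r \<le> j" by (auto simp: eigen_index_def)
  moreover have "\<beta> r n 0 = 0" using r by (simp add: \<beta>_eq_0_iff)
  ultimately show "i = j"
    using \<open>\<beta> r n i = \<beta> r n j\<close> \<beta>_eq_iff[OF r, of i j] \<beta>_eq_iff[OF r, of j i] \<beta>_eq_0_iff[OF r(2)] by metis
qed

context H1_dual_basis
begin

text \<open>The \<beta>_k with k < 2r all vanish and are collected at j = 0; the others are nonzero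
  and distinct.\<close>

lemma eigen_mult_eq:
  assumes "1 \<le> r" "2 * r \<le> n" "j \<in> eigen_index r n"
  shows "eigen_mult H r n j = real (\<Sum>k\<le>n. if \<beta> r n k = \<beta> r n j then cC k * ker_series (n - k) else 0)"
proof (cases "j = 0")
  case True
  have iff: "\<beta> r n k = \<beta> r n 0 \<longleftrightarrow> k < 2 * r" for k
    using \<beta>_eq_0_iff[OF assms(2)] assms(1) by (metis mult_is_0 neq0_conv not_one_le_zero zero_neq_numeral)
  have "(\<Sum>k\<le>n. if \<beta> r n k = \<beta> r n 0 then cC k * ker_series (n - k) else 0) =
      (\<Sum>k<2 * r. cC k * ker_series (n - k))"
    by (rule sum.mono_neutral_cong_right) (use assms in \<open>auto simp: iff\<close>)
  then show ?thesis
    using True assms by (simp add: eigen_mult_def series_coeff_eq)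
next
  case False
  then have "2 * r \<le> j" "j \<le> n" using assms by (auto simp: eigen_index_def)
  then have "(\<Sum>k\<le>n. if \<beta> r n k = \<beta> r n j then cC k * ker_series (n - k) else 0) = cC j * ker_series (n - j)"
    by (simp add: \<beta>_eq_iff[OF assms(1,2)])
  then show ?thesis
    using False \<open>j \<le> n\<close> by (simp add: eigen_mult_def series_coeff_eq)
qed

lemma multiplicity_TaBr2R:
  assumes "1 \<le> r" "2 * r \<le> n" "j \<in> eigen_index r n"
  shows "real (multiplicity_on (H n) (TaBr2R H \<Delta> r n) (\<beta> r n j)) = eigen_mult H r n j"
  unfolding multiplicity_on_def char_poly_TaBr2R[OF assms(1,2)] eigen_mult_eq[OF assms]
  by (simp add: order_prod_linear_power)

lemma eigenvalues_TaBr2R: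
  assumes "1 \<le> r" "2 * r \<le> n"
  shows "eigenvalues_on (H n) (TaBr2R H \<Delta> r n) =
    {of_real (\<beta> r n j) | j. j \<in> eigen_index r n \<and> eigen_mult H r n j \<noteq> 0}"
proof -
  let ?N = "\<lambda>k. cC k * ker_series (n - k)"
  have ev: "eigenvalues_on (H n) (TaBr2R H \<Delta> r n) = {of_real (\<beta> r n k) | k. k \<le> n \<and> ?N k \<noteq> 0}"
    unfolding eigenvalues_on_def char_poly_TaBr2R[OF assms] poly_map_of_real_prod
    by (auto simp: prod_zero_iff)
  have "\<exists>j. \<beta> r n k = \<beta> r n j \<and> j \<in> eigen_index r n \<and> eigen_mult H r n j \<noteq> 0"
    if k: "k \<le> n" "?N k \<noteq> 0" for k
  proof -
    \<comment> \<open>Index 0 represents all k < 2r; the value k = n - 1 has multiplicity 0 by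
      \<open>ker_series_1\<close>.\<close>
    define j where "j = (if k < 2 * r then 0 else k)"
    have "k \<noteq> n - 1" using k(2) assms ker_series_1 by auto
    then have j: "\<beta> r n k = \<beta> r n j" "j \<in> eigen_index r n"
      using k(1) assms \<beta>_eq_0_iff[OF assms(2), of k] \<beta>_eq_0_iff[OF assms(2), of 0]
      by (auto simp: j_def eigen_index_def)
    moreover have "(if \<beta> r n k = \<beta> r n j then ?N k else 0) \<le> (\<Sum>k\<le>n. if \<beta> r n k = \<beta> r n j then ?N k else 0)"
      using k(1) by (intro member_le_sum[of k "{..n}" "\<lambda>k. if \<beta> r n k = \<beta> r n j then ?N k else 0"]) auto
    then have "eigen_mult H r n j \<noteq> 0"
      unfolding eigen_mult_eq[OF assms j(2)] of_nat_eq_0_iff if_P[OF j(1)] using k(2)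
      by (intro notI) (simp only: le_zero_eq)
    ultimately show ?thesis by blast
  qed
  note fwd = this
  have bwd: "\<exists>k. \<beta> r n j = \<beta> r n k \<and> k \<le> n \<and> ?N k \<noteq> 0"
    if j: "j \<in> eigen_index r n" "eigen_mult H r n j \<noteq> 0" for j
  proof -
    have "(\<Sum>k\<le>n. if \<beta> r n k = \<beta> r n j then ?N k else 0) \<noteq> 0"
      using j(2) unfolding eigen_mult_eq[OF assms j(1)] of_nat_eq_0_iff .
    then obtain k where "k \<in> {..n}" "(if \<beta> r n k = \<beta> r n j then ?N k else 0) \<noteq> 0"
      by (rule sum.not_neutral_contains_not_neutral)
    then show ?thesis by (intro exI[of _ k]) (auto split: if_splits)
  qed
  show ?thesis
    unfolding ev
  proof (intro equalityI subsetI)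
    fix z :: complex assume "z \<in> {of_real (\<beta> r n k) | k. k \<le> n \<and> ?N k \<noteq> 0}"
    then obtain k where k: "z = of_real (\<beta> r n k)" "k \<le> n" "?N k \<noteq> 0" by blast
    from fwd[OF k(2,3)] obtain j where "\<beta> r n k = \<beta> r n j" "j \<in> eigen_index r n" "eigen_mult H r n j \<noteq> 0"
      by blast
    with k(1) show "z \<in> {of_real (\<beta> r n j) | j. j \<in> eigen_index r n \<and> eigen_mult H r n j \<noteq> 0}" by auto
  next
    fix z :: complex assume "z \<in> {of_real (\<beta> r n j) | j. j \<in> eigen_index r n \<and> eigen_mult H r n j \<noteq> 0}"
    then obtain j where j: "z = of_real (\<beta> r n j)" "j \<in> eigen_index r n" "eigen_mult H r n j \<noteq> 0" by blast
    from bwd[OF j(2,3)] obtain k where "\<beta> r n j = \<beta> r n k" "k \<le> n" "?N k \<noteq> 0" by blast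
    with j(1) show "z \<in> {of_real (\<beta> r n k) | k. k \<le> n \<and> ?N k \<noteq> 0}" by auto
  qed
qed

end

section \<open>Symmetrised products of primitive elements are independent\<close>

lemma independent_familyI:
  assumes "\<And>J a. finite J \<Longrightarrow> J \<subseteq> I \<Longrightarrow> (\<Sum>i\<in>J. a i *\<^sub>R f i) = 0 \<Longrightarrow> \<forall>i\<in>J. a i = (0 :: real)"
  shows "independent_family f I"
proof -
  have inj: "inj_on f I"
  proof (rule inj_onI, rule ccontr)
    fix i j assume ij: "i \<in> I" "j \<in> I" "f i = f j" "i \<noteq> j"
    have "(\<Sum>k\<in>{i, j}. (if k = i then 1 else - 1) *\<^sub>R f k) = 0" using ij by simp
    from assms[OF _ _ this] ij show False by auto
  qed
  have "independent (f ` I)"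
    unfolding real_vector.dependent_explicit
  proof clarify
    fix t u v assume t: "finite t" "t \<subseteq> f ` I" "(\<Sum>v\<in>t. u v *\<^sub>R v) = 0" "v \<in> t" "u v \<noteq> 0"
    obtain J where J: "J \<subseteq> I" "inj_on f J" "t = f ` J"
      using t(2) inj by (meson subset_image_inj)
    have "finite J" using t(1) J by (simp add: finite_image_iff)
    moreover have "(\<Sum>i\<in>J. u (f i) *\<^sub>R f i) = 0" using t(3) J by (simp add: sum.reindex)
    ultimately have "\<forall>i\<in>J. u (f i) = 0" by (intro assms[of J "\<lambda>i. u (f i)"] J(1))
    with t(4,5) J(3) show False by auto
  qed
  with inj show ?thesis by (simp add: independent_family_def)
qed

lemma msand_scale: "msand i M (c *\<^sub>R p) = c *\<^sub>R msand i M (p :: 'a::real_algebra_1)"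
  by (induction i arbitrary: M) (simp_all add: scaleR_sum_right)

lemma eigvec_mset_msand:
  obtains c :: real where "0 < c" "\<And>r. eigvec_mset r (C, Q) =
    c *\<^sub>R (\<Sum>i\<le>size C. eig_coeff r (size C) i *\<^sub>R msand i C (msym Q :: 'a::real_algebra_1))"
proof -
  obtain cs where cs: "mset cs = C" using ex_mset by blast
  obtain ps where ps: "mset ps = Q" using ex_mset by blast
  obtain N :: nat where N: "0 < N" "\<And>r p. eigvec r cs p =
      real N *\<^sub>R (\<Sum>i\<le>length cs. eig_coeff r (length cs) i *\<^sub>R msand i (mset cs) (p::'a))"
    by (rule eigvec_msand[of cs]) (rule that)
  obtain N' :: nat where N': "0 < N'" "sym_prod ps = real N' *\<^sub>R msym (mset ps)"
    by (rule eigvec_msand[of ps]) (rule that)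
  have "eigvec_mset r (C, Q) =
    (real N * real N') *\<^sub>R (\<Sum>i\<le>size C. eig_coeff r (size C) i *\<^sub>R msand i C (msym Q))" for r
    unfolding cs[symmetric] ps[symmetric] eigvec_mset_eq
    by (simp add: N(2) N'(2) msand_scale scaleR_sum_right mult_ac)
  with N(1) N'(1) show thesis by (intro that[of "real N * real N'"]) simp_all
qed

section \<open>A graded basis of the primitive elements and its dual functionals\<close>

locale primitive_basis = graded_connected_hopf_algebra H \<Delta> \<epsilon> S
  for H :: "nat \<Rightarrow> 'a::real_algebra_1 set" and \<Delta> \<epsilon> S +
  fixes P :: "'a set"
  assumes graded_basis_P: "graded_basis H (primitives \<Delta>) P"
begin

lemma independent_P: "independent P" and span_P: "span P = primitives \<Delta>"
  using graded_basis_P by (auto simp: graded_basis_def)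

lemma P_primitive: "q \<in> P \<Longrightarrow> q \<in> primitives \<Delta>"
  using span_P real_vector.span_base by blast

lemma P_nonzero: "q \<in> P \<Longrightarrow> q \<noteq> 0"
  using independent_P real_vector.dependent_zero by blast

lemma one_not_primitive: "1 \<notin> primitives \<Delta>"
proof
  assume "1 \<in> primitives \<Delta>"
  then have "lc \<epsilon> 1 = \<epsilon> 1 *\<^sub>R 1 + \<epsilon> 1 *\<^sub>R 1" by (rule lc_primitive[OF linear_counit])
  then show False by (simp add: lc_counit counit_one)
qed

lemma deg_eq:
  assumes "x \<in> H m" "x \<noteq> 0"
  shows "deg H x = m"
  unfolding deg_def by (rule the_equality, rule assms(1), rule H_unique[OF _ assms])

lemma P_H_deg: "q \<in> P \<Longrightarrow> q \<in> H (deg H q)"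
proof -
  assume q: "q \<in> P"
  then obtain m where "q \<in> H m" using graded_basis_P by (auto simp: graded_basis_def)
  with deg_eq[OF this P_nonzero[OF q]] show ?thesis by simp
qed

lemma P_not_H0: "q \<in> P \<Longrightarrow> q \<notin> H 0"
proof
  assume q: "q \<in> P" "q \<in> H 0"
  then have q1: "q = \<epsilon> q *\<^sub>R 1" using H0_eq by blast
  then have "\<epsilon> q \<noteq> 0" using P_nonzero[OF q(1)] by auto
  moreover have "\<epsilon> q *\<^sub>R 1 \<in> span P" using q(1) q1 real_vector.span_base by metis
  ultimately have "(1 :: 'a) \<in> span P"
    using real_vector.span_scale[of "\<epsilon> q *\<^sub>R 1" P "inverse (\<epsilon> q)"] by simp
  then show False using one_not_primitive span_P by simp
qed

lemma deg_P_pos: "q \<in> P \<Longrightarrow> 0 < deg H q"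
  using P_H_deg[of q] P_not_H0[of q] by (cases "deg H q") auto

text \<open>Functionals dual to \<open>P\<close>, cut down to the degree of q: then they vanish at 1
  and their contractions are homogeneous.\<close>

definition \<chi> :: "'a \<Rightarrow> 'a \<Rightarrow> real" where
  "\<chi> = (SOME \<chi>. \<forall>q\<in>P. deg_functional (deg H q) (\<chi> q) \<and> (\<forall>q'\<in>P. \<chi> q q' = (if q' = q then 1 else 0)))"

lemma \<chi>: "q \<in> P \<Longrightarrow> deg_functional (deg H q) (\<chi> q)"
  and \<chi>_P: "q \<in> P \<Longrightarrow> q' \<in> P \<Longrightarrow> \<chi> q q' = (if q' = q then 1 else 0)"
proof -
  obtain \<psi> :: "'a \<Rightarrow> 'a \<Rightarrow> real" where \<psi>: "\<And>e. linear (\<psi> e)" "\<And>e x. x \<in> P \<Longrightarrow> \<psi> e x = (if x = e then 1 else 0)"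
    using dual_functionals[OF independent_P] by blast
  have "\<psi> q (component H (deg H q) q') = (if q' = q then 1 else 0)" if "q \<in> P" "q' \<in> P" for q q'
    using component_H[OF P_H_deg[OF that(2)], of "deg H q"] \<psi>(2)[OF that(2), of q] linear_0[OF \<psi>(1)]
    by auto
  then have "\<exists>\<chi>. \<forall>q\<in>P. deg_functional (deg H q) (\<chi> q) \<and> (\<forall>q'\<in>P. \<chi> q q' = (if q' = q then 1 else 0))"
    using deg_functional_component[OF \<psi>(1)]
    by (intro exI[of _ "\<lambda>q x. \<psi> q (component H (deg H q) x)"]) auto
  from someI_ex[OF this] show "q \<in> P \<Longrightarrow> deg_functional (deg H q) (\<chi> q)"
    "q \<in> P \<Longrightarrow> q' \<in> P \<Longrightarrow> \<chi> q q' = (if q' = q then 1 else 0)"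
    unfolding \<chi>_def[symmetric] by auto
qed

lemma linear_\<chi>: "q \<in> P \<Longrightarrow> linear (\<chi> q)"
  using \<chi> by (simp add: deg_functional_def)

lemma \<chi>_one: "q \<in> P \<Longrightarrow> \<chi> q 1 = 0"
  using deg_functional_one[OF \<chi> deg_P_pos] .

text \<open>The strict bound on the length gives \<open>words 0 = {0}\<close> and matches the
  numbering of the coradical filtration below.\<close>

definition words :: "nat \<Rightarrow> 'a set" where
  "words k = span {prod_list l | l. set l \<subseteq> P \<and> length l < k}"

lemma subspace_words: "subspace (words k)"
  by (simp add: words_def real_vector.subspace_span)

lemma words_0: "words 0 = {0}"
  by (simp add: words_def)

lemma words_mono: "j \<le> k \<Longrightarrow> words j \<subseteq> words k"
  unfolding words_def by (rule real_vector.span_mono) fastforce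

lemma prod_list_words: "set l \<subseteq> P \<Longrightarrow> length l < k \<Longrightarrow> prod_list l \<in> words k"
  unfolding words_def by (rule real_vector.span_base) blast

lemma words_induct [consumes 1, case_names word subspace]:
  assumes "x \<in> words k" "\<And>l. set l \<subseteq> P \<Longrightarrow> length l < k \<Longrightarrow> Q (prod_list l)" "subspace {x. Q x}"
  shows "Q x"
proof -
  have "words k \<subseteq> {x. Q x}"
    unfolding words_def by (rule real_vector.span_minimal) (use assms(2,3) in auto)
  with assms(1) show ?thesis by auto
qed

lemma mult_words: "x \<in> primitives \<Delta> \<Longrightarrow> u \<in> words k \<Longrightarrow> x * u \<in> words (Suc k)"
proof -
  assume x: "x \<in> primitives \<Delta>" and u: "u \<in> words k"
  have q: "q * u \<in> words (Suc k)" if "q \<in> P" for q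
    using u
  proof (induction rule: words_induct)
    case (word l)
    then show ?case using prod_list_words[of "q # l" "Suc k"] that by simp
  next
    case subspace
    show ?case
      using real_vector.subspace_sums subspace_words linear_mult_left[of q]
      by (auto simp: subspace_def linear_0 linear_add linear_scale)
  qed
  have "span P \<subseteq> {x. x * u \<in> words (Suc k)}"
    by (rule real_vector.span_minimal)
      (use q subspace_words in \<open>auto simp: subspace_def distrib_right\<close>)
  with x show ?thesis by (auto simp: span_P)
qed

text \<open>\<psi> composed with multiplication by q is split into \<psi>(q) \<epsilon>, which acts
  as a scalar, and a remainder vanishing at 1. Functionals vanishing at 1 are those whose
  contraction shortens words.\<close>

lemma lc_mult_split:
  assumes "linear \<psi>" "q \<in> primitives \<Delta>"
  shows "lc \<psi> (q * u) = \<psi> q *\<^sub>R u + lc (\<lambda>x. \<psi> (q * x) - \<psi> q * \<epsilon> x) u + q * lc \<psi> u"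
    and "linear (\<lambda>x. \<psi> (q * x) - \<psi> q * \<epsilon> x)" "\<psi> (q * 1) - \<psi> q * \<epsilon> 1 = 0"
proof -
  have 1: "linear (\<lambda>x. \<psi> (q * x))" "linear (\<lambda>x. \<psi> q * \<epsilon> x)"
    by (simp_all add: linear_iff linear_add[OF assms(1)] linear_scale[OF assms(1)]
        linear_add[OF linear_counit] linear_scale[OF linear_counit] algebra_simps)
  then show "linear (\<lambda>x. \<psi> (q * x) - \<psi> q * \<epsilon> x)" by (rule linear_compose_sub)
  show "lc \<psi> (q * u) = \<psi> q *\<^sub>R u + lc (\<lambda>x. \<psi> (q * x) - \<psi> q * \<epsilon> x) u + q * lc \<psi> u"
    by (simp add: lc_diff[OF 1] lc_scale[OF linear_counit] lc_counit lc_primitive_mult[OF assms])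
  show "\<psi> (q * 1) - \<psi> q * \<epsilon> 1 = 0" by (simp add: counit_one)
qed

text \<open>The induction runs over all functionals vanishing at 1, because the remainder in
  \<open>lc_mult_split\<close> is a new one.\<close>

lemma lc_prod_list:
  "linear \<psi> \<Longrightarrow> \<psi> 1 = 0 \<Longrightarrow> set l \<subseteq> P \<Longrightarrow> lc \<psi> (prod_list l) \<in> words (length l)"
proof (induction l arbitrary: \<psi>)
  case Nil
  then show ?case by (simp add: lc_one words_0)
next
  case (Cons q l)
  have q: "q \<in> primitives \<Delta>" using Cons.prems P_primitive by simp
  note split = lc_mult_split[OF Cons.prems(1) q]
  have "prod_list l \<in> words (Suc (length l))" using Cons.prems by (intro prod_list_words) auto
  moreover have "lc (\<lambda>x. \<psi> (q * x) - \<psi> q * \<epsilon> x) (prod_list l) \<in> words (Suc (length l))"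
    using Cons.IH[OF split(2,3)] Cons.prems(3) words_mono[of "length l" "Suc (length l)"] by auto
  moreover have "q * lc \<psi> (prod_list l) \<in> words (Suc (length l))"
    using Cons by (intro mult_words q) auto
  ultimately show ?case
    using subspace_words by (simp add: split(1) subspace_add subspace_scale)
qed

lemma lc_words:
  assumes "linear \<psi>" "\<psi> 1 = 0" "u \<in> words (Suc k)"
  shows "lc \<psi> u \<in> words k"
  using assms(3)
proof (induction rule: words_induct)
  case (word l)
  then show ?case using lc_prod_list[OF assms(1,2) word(1)] words_mono[of "length l" k] by auto
next
  case subspace
  show ?case
    using subspace_words[of k] linear_lc[OF assms(1)]
    by (auto simp: subspace_def linear_0 linear_add linear_scale)
qed

lemma msym_words: "set_mset M \<subseteq> P \<Longrightarrow> msym M \<in> words (Suc (size M))"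
  unfolding msym_def
  by (intro subspace_sum subspace_words prod_list_words)
    (auto dest: permutations_of_multisetD simp flip: set_mset_mset size_mset)

text \<open>To leading order, contraction with \<open>\<chi> q\<close> deletes q like a derivation:
  the scalar parts of \<open>lc_mult_split\<close> give the leading term, and the remainders lose
  one letter more.\<close>

lemma lc_msym:
  assumes "q \<in> P"
  shows "set_mset M \<subseteq> P \<Longrightarrow> lc (\<chi> q) (msym M) -
    (if q \<in># M then real (size M) *\<^sub>R msym (M - {#q#}) else 0) \<in> words (size M - 1)"
proof (induction "size M" arbitrary: M)
  case 0
  then show ?case using assms by (simp add: lc_one linear_\<chi> \<chi>_one words_0)
next
  case (Suc k)
  then have "M \<noteq> {#}" by auto
  have k: "k = size (M - {#x#})" if "x \<in># M" for x
    using that Suc.hyps(2) by (simp add: size_Diff_singleton)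
  let ?\<psi> = "\<lambda>x y. \<chi> q (x * y) - \<chi> q x * \<epsilon> y"
  define g where "g R = (if q \<in># R then real (size R) *\<^sub>R msym (R - {#q#}) else 0)" for R
  define err where "err x = lc (\<chi> q) (msym (M - {#x#})) - g (M - {#x#})" for x
  have err: "x * err x \<in> words k" if x: "x \<in># M" for x
  proof -
    have "err x \<in> words (k - 1)"
      unfolding err_def g_def k[OF x] using Suc.prems k[OF x]
      by (intro Suc.hyps(1)) (auto dest: in_diffD)
    then have "x * err x \<in> (if k = 0 then {0} else words k)"
      using mult_words[of x "err x" "k - 1"] P_primitive Suc.prems x by (auto simp: words_0)
    then show ?thesis using subspace_words by (auto split: if_splits simp: real_vector.subspace_0)
  qed
  have low: "lc (?\<psi> x) (msym (M - {#x#})) \<in> words k" if x: "x \<in># M" for x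
  proof -
    have "x \<in> primitives \<Delta>" using x Suc.prems P_primitive by auto
    note split = lc_mult_split(2,3)[OF linear_\<chi>[OF assms] this]
    have "msym (M - {#x#}) \<in> words (Suc k)"
      using msym_words[of "M - {#x#}"] k[OF x] Suc.prems by (auto dest: in_diffD)
    then show ?thesis by (intro lc_words split)
  qed
  have step: "lc (\<chi> q) (x * msym (M - {#x#})) = \<chi> q x *\<^sub>R msym (M - {#x#}) + x * g (M - {#x#}) +
      (lc (?\<psi> x) (msym (M - {#x#})) + x * err x)" if x: "x \<in># M" for x
  proof -
    have "x \<in> primitives \<Delta>" using x Suc.prems P_primitive by auto
    from lc_mult_split(1)[OF linear_\<chi>[OF assms] this] show ?thesis
      by (simp add: err_def algebra_simps)
  qed
  \<comment> \<open>The terms in which q is the first letter; \<open>main2\<close> collects those in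
    which it stands later.\<close>
  have main1: "(\<Sum>x\<in>set_mset M. \<chi> q x *\<^sub>R msym (M - {#x#})) = (if q \<in># M then msym (M - {#q#}) else 0)"
  proof -
    have "(\<Sum>x\<in>set_mset M. \<chi> q x *\<^sub>R msym (M - {#x#})) = (\<Sum>x\<in>set_mset M. if x = q then msym (M - {#q#}) else 0)"
      using Suc.prems assms by (intro sum.cong refl) (auto simp: \<chi>_P)
    then show ?thesis by simp
  qed
  have main2: "(\<Sum>x\<in>set_mset M. x * g (M - {#x#})) = (if q \<in># M then real k *\<^sub>R msym (M - {#q#}) else 0)"
  proof (cases "q \<in># M")
    case False
    then show ?thesis by (auto simp: g_def dest: in_diffD intro!: sum.neutral)
  next
    case True
    have sym: "q \<in># M - {#x#} \<longleftrightarrow> x \<in># M - {#q#}" if "x \<in># M" for x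
      using that True by (cases "x = q") (auto simp: in_diff_count)
    have "(\<Sum>x\<in>set_mset M. x * g (M - {#x#})) = (\<Sum>x\<in>set_mset (M - {#q#}). real k *\<^sub>R (x * msym (M - {#q#} - {#x#})))"
    proof (rule sum.mono_neutral_cong_right)
      show "set_mset (M - {#q#}) \<subseteq> set_mset M" by (auto dest: in_diffD)
      show "\<forall>x\<in>set_mset M - set_mset (M - {#q#}). x * g (M - {#x#}) = 0"
        using sym by (auto simp: g_def)
      fix x assume x: "x \<in> set_mset (M - {#q#})"
      then have "x \<in># M" by (auto dest: in_diffD)
      then show "x * g (M - {#x#}) = real k *\<^sub>R (x * msym (M - {#q#} - {#x#}))"
        using sym x k by (simp add: g_def add_mset_commute)
    qed simp
    also have "\<dots> = real k *\<^sub>R msym (M - {#q#})"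
    proof (cases "k = 0")
      case False
      then have "M - {#q#} \<noteq> {#}" using k[OF True] by auto
      then show ?thesis by (simp add: msym_rec[of "M - {#q#}"] scaleR_sum_right)
    qed simp
    finally show ?thesis using True by simp
  qed
  have "lc (\<chi> q) (msym M) - g M = (\<Sum>x\<in>set_mset M. lc (?\<psi> x) (msym (M - {#x#})) + x * err x)"
  proof -
    have "lc (\<chi> q) (msym M) = (\<Sum>x\<in>set_mset M. lc (\<chi> q) (x * msym (M - {#x#})))"
      unfolding msym_rec[OF \<open>M \<noteq> {#}\<close>] by (rule linear_sum[OF linear_lc[OF linear_\<chi>[OF assms]]])
    also have "\<dots> = (\<Sum>x\<in>set_mset M. \<chi> q x *\<^sub>R msym (M - {#x#})) + (\<Sum>x\<in>set_mset M. x * g (M - {#x#})) +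
        (\<Sum>x\<in>set_mset M. lc (?\<psi> x) (msym (M - {#x#})) + x * err x)"
      unfolding sum.distrib[symmetric] by (intro sum.cong refl step)
    also have "(\<Sum>x\<in>set_mset M. \<chi> q x *\<^sub>R msym (M - {#x#})) + (\<Sum>x\<in>set_mset M. x * g (M - {#x#})) = g M"
      unfolding main1 main2 by (simp add: g_def Suc.hyps(2)[symmetric] scaleR_add_left)
    finally show ?thesis by simp
  qed
  also have "\<dots> \<in> words k"
    by (intro subspace_sum subspace_add subspace_words low err)
  finally show ?case by (simp add: g_def Suc.hyps(2)[symmetric])
qed

text \<open>Independence modulo shorter words. Contraction with a letter q of \<open>Q0\<close>
  keeps, to leading order, only the Q containing q, replaced by \<open>Q - {#q#}\<close>; this
  replacement is injective, so the induction applies.\<close>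

lemma msym_independent_top:
  "finite \<Q> \<Longrightarrow> (\<And>Q. Q \<in> \<Q> \<Longrightarrow> set_mset Q \<subseteq> P \<and> size Q = k) \<Longrightarrow>
    (\<Sum>Q\<in>\<Q>. a Q *\<^sub>R msym Q) \<in> words k \<Longrightarrow> Q0 \<in> \<Q> \<Longrightarrow> a Q0 = 0"
proof (induction k arbitrary: \<Q> a Q0)
  case 0
  then have "Q0 = {#}" "\<Q> = {{#}}" by fastforce+
  with 0(3) show ?case by (simp add: words_0)
next
  case (Suc k)
  obtain q where q: "q \<in># Q0" using Suc.prems(2,4) by fastforce
  then have qP: "q \<in> P" using Suc.prems(2,4) by auto
  let ?\<R> = "{Q \<in> \<Q>. q \<in># Q}"
  note lin = linear_lc[OF linear_\<chi>[OF qP]]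
  let ?g = "\<lambda>Q. if q \<in># Q then real (size Q) *\<^sub>R msym (Q - {#q#}) else 0"
  have 1: "lc (\<chi> q) (\<Sum>Q\<in>\<Q>. a Q *\<^sub>R msym Q) \<in> words k"
    by (rule lc_words[OF linear_\<chi>[OF qP] \<chi>_one[OF qP] Suc.prems(3)])
  have 2: "(\<Sum>Q\<in>\<Q>. a Q *\<^sub>R (lc (\<chi> q) (msym Q) - ?g Q)) \<in> words k"
  proof (intro subspace_sum subspace_scale subspace_words)
    fix Q assume "Q \<in> \<Q>"
    then have "set_mset Q \<subseteq> P" "size Q - 1 = k" using Suc.prems(2) by auto
    then show "lc (\<chi> q) (msym Q) - ?g Q \<in> words k" using lc_msym[OF qP, of Q] by simp
  qed
  have "(\<Sum>Q\<in>\<Q>. a Q *\<^sub>R ?g Q) = lc (\<chi> q) (\<Sum>Q\<in>\<Q>. a Q *\<^sub>R msym Q) -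
      (\<Sum>Q\<in>\<Q>. a Q *\<^sub>R (lc (\<chi> q) (msym Q) - ?g Q))"
    by (simp only: linear_sum[OF lin] linear_scale[OF lin] scaleR_diff_right sum_subtractf diff_diff_eq2 add_diff_cancel_left')
  then have "(\<Sum>Q\<in>\<Q>. a Q *\<^sub>R ?g Q) \<in> words k"
    using real_vector.subspace_diff[OF subspace_words 1 2] by simp
  also have "(\<Sum>Q\<in>\<Q>. a Q *\<^sub>R (if q \<in># Q then real (size Q) *\<^sub>R msym (Q - {#q#}) else 0)) =
      (\<Sum>Q\<in>?\<R>. (a Q * real (Suc k)) *\<^sub>R msym (Q - {#q#}))"
    using Suc.prems(1,2) by (intro sum.mono_neutral_cong_right) auto
  also have "\<dots> = (\<Sum>R\<in>(\<lambda>Q. Q - {#q#}) ` ?\<R>. (a (add_mset q R) * real (Suc k)) *\<^sub>R msym R)"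
  proof (subst sum.reindex)
    show "inj_on (\<lambda>Q. Q - {#q#}) ?\<R>" by (rule inj_onI) (metis (mono_tags, lifting) insert_DiffM mem_Collect_eq)
  qed auto
  finally have "(\<Sum>R\<in>(\<lambda>Q. Q - {#q#}) ` ?\<R>. (a (add_mset q R) * real (Suc k)) *\<^sub>R msym R) \<in> words k" .
  then have "a (add_mset q (Q0 - {#q#})) * real (Suc k) = 0"
  proof (rule Suc.IH[rotated 2])
    show "finite ((\<lambda>Q. Q - {#q#}) ` ?\<R>)" using Suc.prems(1) by simp
    show "set_mset R \<subseteq> P \<and> size R = k" if "R \<in> (\<lambda>Q. Q - {#q#}) ` ?\<R>" for R
      using that Suc.prems(2) by (force simp: size_Diff_singleton dest: in_diffD)
    show "Q0 - {#q#} \<in> (\<lambda>Q. Q - {#q#}) ` ?\<R>" using q Suc.prems(4) by blast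
  qed
  with q show ?case by simp
qed

text \<open>The part of largest size is a combination of shorter words, so its coefficients vanish;
  then the size descends.\<close>

lemma msym_independent:
  assumes "finite \<Q>" "\<And>Q. Q \<in> \<Q> \<Longrightarrow> set_mset Q \<subseteq> P" "(\<Sum>Q\<in>\<Q>. a Q *\<^sub>R msym Q) = 0" "Q0 \<in> \<Q>"
  shows "a Q0 = 0"
proof -
  have "a Q0 = 0" if "\<And>Q. Q \<in> \<Q> \<Longrightarrow> size Q < m" for m
    using assms that
  proof (induction m arbitrary: \<Q> Q0)
    case (Suc m)
    let ?T = "{Q \<in> \<Q>. size Q = m}"
    have split: "(\<Sum>Q\<in>\<Q>. a Q *\<^sub>R msym Q) = (\<Sum>Q\<in>?T. a Q *\<^sub>R msym Q) + (\<Sum>Q\<in>\<Q> - ?T. a Q *\<^sub>R msym Q)"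
      using Suc.prems(1) by (subst sum.subset_diff[of ?T]) auto
    have low: "(\<Sum>Q\<in>\<Q> - ?T. a Q *\<^sub>R msym Q) \<in> words m"
    proof (intro subspace_sum subspace_scale subspace_words)
      fix Q assume "Q \<in> \<Q> - ?T"
      then have "Suc (size Q) \<le> m" "set_mset Q \<subseteq> P" using Suc.prems(2,5) by fastforce+
      then show "msym Q \<in> words m" using msym_words words_mono by blast
    qed
    have "(\<Sum>Q\<in>?T. a Q *\<^sub>R msym Q) = - (\<Sum>Q\<in>\<Q> - ?T. a Q *\<^sub>R msym Q)"
      using split Suc.prems(3) by (simp add: eq_neg_iff_add_eq_0)
    then have "(\<Sum>Q\<in>?T. a Q *\<^sub>R msym Q) \<in> words m"
      using low real_vector.subspace_neg[OF subspace_words] by simp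
    then have top: "a Q = 0" if "Q \<in> ?T" for Q
      by (rule msym_independent_top[rotated 2, OF _ that]) (use Suc.prems(1,2) in auto)
    show ?case
    proof (cases "Q0 \<in> ?T")
      case False
      have "(\<Sum>Q\<in>\<Q> - ?T. a Q *\<^sub>R msym Q) = 0" using split Suc.prems(3) top by simp
      moreover have "size Q < m" if "Q \<in> \<Q> - ?T" for Q
        using that Suc.prems(5) by (fastforce simp: less_Suc_eq)
      ultimately show ?thesis
        using False Suc.prems by (intro Suc.IH[of "\<Q> - ?T"]) auto
    qed (rule top)
  qed blast
  moreover have "size Q < Suc (Max (size ` \<Q>))" if "Q \<in> \<Q>" for Q
    using assms(1) that by (simp add: less_Suc_eq_le)
  ultimately show ?thesis by blast
qed

text \<open>For q of degree 1 the contraction is an exact derivation, and it annihilates every other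
  basis element.\<close>

lemma lc_\<chi>_msym_higher:
  assumes "q \<in> P" "deg H q = 1" "set_mset Q \<subseteq> P - H 1"
  shows "lc (\<chi> q) (msym Q) = 0"
proof -
  have d: "deg_functional 1 (\<chi> q)" using \<chi>[OF assms(1)] assms(2) by simp
  have "lc (\<chi> q) (msym Q) = real (size Q) *\<^sub>R (\<Sum>x\<in>set_mset Q. 0 *\<^sub>R msym (Q - {#x#}))"
  proof (rule derivation_msym)
    show "linear (lc (\<chi> q))" by (rule linear_lc[OF linear_\<chi>[OF assms(1)]])
    show "lc (\<chi> q) (x * y) = lc (\<chi> q) x * y + x * lc (\<chi> q) y" for x y
      by (rule lc_derivation[OF linear_\<chi>[OF assms(1)] deg1_functional_mult[OF d]])
    fix x assume "x \<in># Q"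
    then have "x \<in> P" "x \<noteq> q" using assms P_H_deg[OF assms(1)] by auto
    then show "lc (\<chi> q) x = 0 *\<^sub>R 1"
      using lc_primitive[OF linear_\<chi>[OF assms(1)] P_primitive] \<chi>_P assms(1) \<chi>_one by auto
  qed
  then show ?thesis by simp
qed

text \<open>Contracting with \<open>\<chi> q\<close> turns one weighted sum of words \<open>msand i C\<close> into another with the
  same total weight up to a factor, so that no particular weights need to be considered.\<close>

lemma msand_independent:
  fixes a :: "'a multiset \<times> 'a multiset \<Rightarrow> real"
  assumes "\<And>j. j \<le> k \<Longrightarrow> (\<Sum>i\<le>j. \<alpha> j i) \<noteq> (0 :: real)" "finite \<J>"
    "\<And>C Q. (C, Q) \<in> \<J> \<Longrightarrow> set_mset C \<subseteq> P \<inter> H 1 \<and> set_mset Q \<subseteq> P - H 1 \<and> size C \<le> k"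
    "(\<Sum>(C, Q)\<in>\<J>. a (C, Q) *\<^sub>R (\<Sum>i\<le>size C. \<alpha> (size C) i *\<^sub>R msand i C (msym Q))) = 0"
    "(C0, Q0) \<in> \<J>"
  shows "a (C0, Q0) = 0"
  using assms
proof (induction k arbitrary: \<alpha> a \<J> C0 Q0)
  \<comment> \<open>Once the coefficients at nonempty C are known to vanish, the sum reduces to
    symmetrised products of primitives alone.\<close>
  have base: "a (C0, Q0) = 0"
    if J: "finite \<J>" "\<And>C Q. (C, Q) \<in> \<J> \<Longrightarrow> set_mset C \<subseteq> P \<inter> H 1 \<and> set_mset Q \<subseteq> P - H 1"
      and 0: "(\<Sum>(C, Q)\<in>\<J>. a (C, Q) *\<^sub>R (\<Sum>i\<le>size C. \<alpha> (size C) i *\<^sub>R msand i C (msym Q))) = 0"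
      and \<alpha>: "(\<Sum>i\<le>0. \<alpha> 0 i) \<noteq> 0" and vanish: "\<And>C Q. (C, Q) \<in> \<J> \<Longrightarrow> C \<noteq> {#} \<Longrightarrow> a (C, Q) = 0"
      and mem: "(C0, Q0) \<in> \<J>"
    for \<J> :: "('a multiset \<times> 'a multiset) set" and a :: "'a multiset \<times> 'a multiset \<Rightarrow> real"
      and \<alpha> :: "nat \<Rightarrow> nat \<Rightarrow> real" and C0 Q0
  proof (cases "C0 = {#}")
    case True
    let ?\<Q> = "{Q. ({#}, Q) \<in> \<J>}"
    have img: "?\<Q> = snd ` {p \<in> \<J>. fst p = {#}}" by force
    have fin: "finite ?\<Q>" unfolding img using J(1) by simp
    have "(\<Sum>(C, Q)\<in>\<J>. a (C, Q) *\<^sub>R (\<Sum>i\<le>size C. \<alpha> (size C) i *\<^sub>R msand i C (msym Q))) =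
      (\<Sum>(C, Q)\<in>Pair {#} ` ?\<Q>. a (C, Q) *\<^sub>R (\<Sum>i\<le>size C. \<alpha> (size C) i *\<^sub>R msand i C (msym Q)))"
    proof (intro sum.mono_neutral_right ballI J(1))
      fix p assume p: "p \<in> \<J> - Pair {#} ` ?\<Q>"
      obtain C Q where CQ: "p = (C, Q)" by (cases p)
      with p have "(C, Q) \<in> \<J>" "C \<noteq> {#}" by auto
      then show "(case p of (C, Q) \<Rightarrow> a (C, Q) *\<^sub>R (\<Sum>i\<le>size C. \<alpha> (size C) i *\<^sub>R msand i C (msym Q))) = 0"
        by (simp add: CQ vanish)
    qed auto
    also have "\<dots> = (\<Sum>Q\<in>?\<Q>. (a ({#}, Q) * \<alpha> 0 0) *\<^sub>R msym Q)"
      by (subst sum.reindex) (auto simp: inj_on_def)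
    finally have "(\<Sum>Q\<in>?\<Q>. (a ({#}, Q) * \<alpha> 0 0) *\<^sub>R msym Q) = 0" using 0 by simp
    moreover have "set_mset Q \<subseteq> P" if "Q \<in> ?\<Q>" for Q using J(2) that by fastforce
    ultimately have "a ({#}, Q0) * \<alpha> 0 0 = 0"
      using fin mem True by (intro msym_independent[of ?\<Q> "\<lambda>Q. a ({#}, Q) * \<alpha> 0 0" Q0]) auto
    with \<alpha> True show ?thesis by simp
  qed (rule vanish[OF mem])
  {
    case 0
    show ?case
    proof (rule base[OF "0.prems"(2)])
      show "(\<Sum>i\<le>0. \<alpha> 0 i) \<noteq> 0" using "0.prems"(1)[of 0] by simp
      show "a (C, Q) = 0" if "(C, Q) \<in> \<J>" "C \<noteq> {#}" for C Q using "0.prems"(3)[OF that(1)] that(2) by simp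
    qed (use "0.prems" in auto)
  next
    case (Suc k)
    have vanish: "a (C1, Q1) = 0" if mem: "(C1, Q1) \<in> \<J>" "C1 \<noteq> {#}" for C1 Q1
    proof -
      obtain q where q: "q \<in># C1" using mem(2) by blast
      then have qP: "q \<in> P" "q \<in> H 1" using Suc.prems(3)[OF mem(1)] by auto
      then have dq: "deg H q = 1" using deg_eq P_nonzero by blast
      have d: "deg_functional 1 (\<chi> q)" using \<chi>[OF qP(1)] dq by simp
      note lin = linear_lc[OF linear_\<chi>[OF qP(1)]]
      \<comment> \<open>The weights after one contraction, collected from
        \<open>derivation_msand\<close> at words with one letter less.\<close>
      define \<alpha>' where "\<alpha>' j i = \<alpha> (Suc j) (Suc i) * real (Suc i) + \<alpha> (Suc j) i * real (Suc j - i)" for j i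
      have der: "lc (\<chi> q) (\<Sum>i\<le>size C. \<alpha> (size C) i *\<^sub>R msand i C (msym Q)) =
        (if q \<in># C then \<Sum>i\<le>size C - 1. \<alpha>' (size C - 1) i *\<^sub>R msand i (C - {#q#}) (msym Q) else 0)"
        if CQ: "(C, Q) \<in> \<J>" for C Q
      proof -
        have CP: "set_mset C \<subseteq> P \<inter> H 1" "set_mset Q \<subseteq> P - H 1" using Suc.prems(3)[OF CQ] by auto
        let ?u = "\<lambda>i x. real i *\<^sub>R msand (i - 1) (C - {#x#}) (msym Q) + real (size C - i) *\<^sub>R msand i (C - {#x#}) (msym Q)"
        have single: "lc (\<chi> q) (msand i C (msym Q)) = (if q \<in># C then ?u i q else 0)" if "i \<le> size C" for i
        proof -
          have "lc (\<chi> q) (msand i C (msym Q)) = (\<Sum>x\<in>set_mset C. \<chi> q x *\<^sub>R ?u i x)"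
          proof (rule derivation_msand[OF lin _ lc_\<chi>_msym_higher[OF qP(1) dq CP(2)] _ that])
            show "lc (\<chi> q) (x * y) = lc (\<chi> q) x * y + x * lc (\<chi> q) y" for x y
              by (rule lc_derivation[OF linear_\<chi>[OF qP(1)] deg1_functional_mult[OF d]])
            show "lc (\<chi> q) x = \<chi> q x *\<^sub>R 1" if "x \<in># C" for x
              using H1_contraction(1)[OF d] CP(1) that by auto
          qed
          also have "\<dots> = (\<Sum>x\<in>set_mset C. if x = q then ?u i q else 0)"
            using CP(1) qP(1) by (intro sum.cong refl) (auto simp: \<chi>_P)
          finally show ?thesis by simp
        qed
        show ?thesis
        proof (cases "q \<in># C")
          case True
          then obtain j where j: "size C = Suc j" by (metis size_Suc_Diff1)
          have "lc (\<chi> q) (\<Sum>i\<le>size C. \<alpha> (size C) i *\<^sub>R msand i C (msym Q)) =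
            (\<Sum>i\<le>Suc j. (\<alpha> (Suc j) i * real i) *\<^sub>R msand (i - 1) (C - {#q#}) (msym Q)) +
            (\<Sum>i\<le>Suc j. (\<alpha> (Suc j) i * real (Suc j - i)) *\<^sub>R msand i (C - {#q#}) (msym Q))"
            using True by (simp add: linear_sum[OF lin] linear_scale[OF lin] single j scaleR_add_right
                sum.distrib[symmetric] del: sum.atMost_Suc of_nat_Suc)
          also have "\<dots> = (\<Sum>i\<le>j. (\<alpha> (Suc j) (Suc i) * real (Suc i)) *\<^sub>R msand i (C - {#q#}) (msym Q)) +
            (\<Sum>i\<le>j. (\<alpha> (Suc j) i * real (Suc j - i)) *\<^sub>R msand i (C - {#q#}) (msym Q))"
            by (subst sum.atMost_Suc_shift) simp
          finally show ?thesis
            using True by (simp add: j \<alpha>'_def scaleR_add_left sum.distrib)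
        next
          case False
          then show ?thesis by (simp add: linear_sum[OF lin] linear_scale[OF lin] single)
        qed
      qed
      let ?\<R> = "{p \<in> \<J>. q \<in># fst p}" and ?g = "\<lambda>(C, Q). (C - {#q#}, Q :: 'a multiset)"
      have inj: "inj_on ?g ?\<R>"
        by (rule inj_onI) (auto, metis insert_DiffM)
      have "0 = lc (\<chi> q) (\<Sum>(C, Q)\<in>\<J>. a (C, Q) *\<^sub>R (\<Sum>i\<le>size C. \<alpha> (size C) i *\<^sub>R msand i C (msym Q)))"
        by (simp only: Suc.prems(4) linear_0[OF lin])
      also have "\<dots> = (\<Sum>(C, Q)\<in>\<J>. a (C, Q) *\<^sub>R (if q \<in># C then \<Sum>i\<le>size C - 1.
          \<alpha>' (size C - 1) i *\<^sub>R msand i (C - {#q#}) (msym Q) else 0))"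
        unfolding linear_sum[OF lin] by (intro sum.cong refl) (auto simp: linear_scale[OF lin] der)
      also have "\<dots> = (\<Sum>(C, Q)\<in>?\<R>. a (C, Q) *\<^sub>R (\<Sum>i\<le>size C - 1.
          \<alpha>' (size C - 1) i *\<^sub>R msand i (C - {#q#}) (msym Q)))"
        using Suc.prems(2) by (intro sum.mono_neutral_cong_right) (auto split: if_splits)
      also have "\<dots> = (\<Sum>(R, Q)\<in>?g ` ?\<R>. a (add_mset q R, Q) *\<^sub>R
          (\<Sum>i\<le>size R. \<alpha>' (size R) i *\<^sub>R msand i R (msym Q)))"
        unfolding sum.reindex[OF inj] by (intro sum.cong refl) (auto simp: size_Diff_singleton)
      finally have zero: "(\<Sum>(R, Q)\<in>?g ` ?\<R>. a (add_mset q R, Q) *\<^sub>R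
          (\<Sum>i\<le>size R. \<alpha>' (size R) i *\<^sub>R msand i R (msym Q))) = 0" by simp
      have "(\<lambda>(R, Q). a (add_mset q R, Q)) (C1 - {#q#}, Q1) = 0"
      proof (rule Suc.IH[of \<alpha>' "?g ` ?\<R>"])
        \<comment> \<open>The total weight is multiplied by j + 1, since i + (j + 1 - i) does not
          depend on i.\<close>
        show "(\<Sum>i\<le>j. \<alpha>' j i) \<noteq> 0" if "j \<le> k" for j
        proof -
          have "(\<Sum>i\<le>j. \<alpha>' j i) = (\<Sum>i\<le>Suc j. \<alpha> (Suc j) i * real i) + (\<Sum>i\<le>Suc j. \<alpha> (Suc j) i * real (Suc j - i))"
            by (subst sum.atMost_Suc_shift) (simp add: \<alpha>'_def sum.distrib)
          also have "\<dots> = (\<Sum>i\<le>Suc j. \<alpha> (Suc j) i * real (Suc j))"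
            unfolding sum.distrib[symmetric]
            by (intro sum.cong refl) (auto simp: distrib_left[symmetric] of_nat_diff simp del: of_nat_Suc)
          also have "\<dots> = (\<Sum>i\<le>Suc j. \<alpha> (Suc j) i) * real (Suc j)" by (rule sum_distrib_right[symmetric])
          finally show ?thesis using Suc.prems(1)[of "Suc j"] that by simp
        qed
        show "finite (?g ` ?\<R>)" using Suc.prems(2) by simp
        show "set_mset R \<subseteq> P \<inter> H 1 \<and> set_mset Q \<subseteq> P - H 1 \<and> size R \<le> k" if "(R, Q) \<in> ?g ` ?\<R>" for R Q
          using that Suc.prems(3) by (fastforce simp: size_Diff_singleton dest: in_diffD)
        show "(\<Sum>(R, Q)\<in>?g ` ?\<R>. (\<lambda>(R, Q). a (add_mset q R, Q)) (R, Q) *\<^sub>R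
          (\<Sum>i\<le>size R. \<alpha>' (size R) i *\<^sub>R msand i R (msym Q))) = 0" using zero by simp
        show "(C1 - {#q#}, Q1) \<in> ?g ` ?\<R>" using q mem(1) by force
      qed
      with q show ?thesis by simp
    qed
    show ?case
    proof (rule base[OF Suc.prems(2)])
      show "(\<Sum>i\<le>0. \<alpha> 0 i) \<noteq> 0" using Suc.prems(1)[of 0] by simp
    qed (use Suc.prems vanish in auto)
  }
qed

lemma independent_family_eigvec_mset:
  assumes "\<And>C Q. (C, Q) \<in> I \<Longrightarrow> set_mset C \<subseteq> P \<inter> H 1 \<and> set_mset Q \<subseteq> P - H 1"
  shows "independent_family (eigvec_mset r) I"
proof (rule independent_familyI)
  fix J and a :: "'a multiset \<times> 'a multiset \<Rightarrow> real"
  assume J: "finite J" "J \<subseteq> I" "(\<Sum>i\<in>J. a i *\<^sub>R eigvec_mset r i) = 0"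
  let ?e = "\<lambda>(C, Q). \<Sum>i\<le>size C. eig_coeff r (size C) i *\<^sub>R msand i C (msym Q :: 'a)"
  have "\<exists>c>0. eigvec_mset r p = c *\<^sub>R ?e p" for p :: "'a multiset \<times> 'a multiset"
  proof (cases p)
    case (Pair C Q)
    obtain c :: real where "0 < c" "\<And>r. eigvec_mset r (C, Q) =
        c *\<^sub>R (\<Sum>i\<le>size C. eig_coeff r (size C) i *\<^sub>R msand i C (msym Q))"
      by (rule eigvec_mset_msand[of C Q]) (rule that)
    then show ?thesis unfolding Pair by auto
  qed
  then have "\<forall>p :: 'a multiset \<times> 'a multiset. \<exists>c. c > 0 \<and> eigvec_mset r p = c *\<^sub>R ?e p" by (rule allI)
  then have "\<exists>c. \<forall>p. c p > (0 :: real) \<and> eigvec_mset r p = c p *\<^sub>R ?e p" by (rule choice)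
  then obtain c where "\<forall>p. c p > (0 :: real) \<and> eigvec_mset r p = c p *\<^sub>R ?e p" by (rule exE)
  then have c: "\<And>p. 0 < c p" "\<And>p. eigvec_mset r p = c p *\<^sub>R ?e p" by auto
  define k where "k = (\<Sum>p\<in>J. size (fst p))"
  have size_le: "size C \<le> k" if "(C, Q) \<in> J" for C Q
    unfolding k_def using member_le_sum[OF that, of "\<lambda>p. size (fst p)"] J(1) by simp
  have "(\<Sum>(C, Q)\<in>J. (a (C, Q) * c (C, Q)) *\<^sub>R (\<Sum>i\<le>size C. eig_coeff r (size C) i *\<^sub>R msand i C (msym Q))) = 0"
    using J(3) by (simp add: c(2) case_prod_unfold)
  note zero = this
  have "a (C, Q) * c (C, Q) = 0" if "(C, Q) \<in> J" for C Q
  proof (rule msand_independent[of k "eig_coeff r" J "\<lambda>p. a p * c p", OF _ J(1) _ zero that])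
    show "(\<Sum>i\<le>j. eig_coeff r j i) \<noteq> 0" for j using eig_coeff_sum_pos[of r j] by simp
    show "set_mset C \<subseteq> P \<inter> H 1 \<and> set_mset Q \<subseteq> P - H 1 \<and> size C \<le> k" if "(C, Q) \<in> J" for C Q
      using assms[of C Q] size_le[OF that] J(2) that by blast
  qed
  then show "\<forall>p\<in>J. a p = 0" using c(1) by (metis less_irrefl mult_eq_0_iff surj_pair)
qed

end

section \<open>Cocommutative Hopf algebras\<close>

lemma functionals_separate:
  fixes y :: "'a::real_vector"
  assumes "\<And>\<psi> :: 'a \<Rightarrow> real. linear \<psi> \<Longrightarrow> \<psi> y = 0"
  shows "y = 0"
proof (rule ccontr)
  assume "y \<noteq> 0"
  then have "independent {y}" by simp
  then obtain \<psi> :: "'a \<Rightarrow> real" where "linear \<psi>" "\<psi> y = 1"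
    using linear_independent_extend[of "{y}" "\<lambda>_. 1"] by auto
  with assms show False by fastforce
qed

lemma independent_card_ge_dim_spans:
  fixes B V F :: "'a::real_vector set"
  assumes "independent B" "B \<subseteq> V" "subspace V" "finite F" "V \<subseteq> span F" "dim V \<le> card B"
  shows "span B = V"
proof -
  obtain B' where B': "B \<subseteq> B'" "B' \<subseteq> V" "independent B'" "V \<subseteq> span B'"
    using assms(2,1) by (rule real_vector.maximal_independent_subset_extend)
  have s: "span B' = V" using subspace_span_eq[OF assms(3) B'(2,4)] .
  have fin: "finite B'"
    using real_vector.independent_span_bound[OF assms(4) B'(3)] B'(2) assms(5) by blast
  have "card B' = dim V"
    using s B'(3) real_vector.dim_eq_card_independent real_vector.dim_span by metis
  with assms(6) have "B = B'" using card_seteq[OF fin B'(1)] by simp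
  with s show ?thesis by simp
qed

section \<open>The coradical filtration\<close>

context graded_connected_hopf_algebra
begin

text \<open>Finite-dimensional truncations. \<open>P\<close> may be infinite; working below a fixed
  degree keeps the sums over \<open>P\<close> finite.\<close>

definition below :: "nat \<Rightarrow> 'a set" where
  "below n = span (\<Union>m<n. H m)"

lemma subspace_below: "subspace (below n)"
  by (simp add: below_def real_vector.subspace_span)

lemma H_below: "x \<in> H m \<Longrightarrow> m < n \<Longrightarrow> x \<in> below n"
  unfolding below_def by (rule real_vector.span_base) blast

lemma below_induct [consumes 1, case_names H subspace]:
  assumes "x \<in> below n" "\<And>m x. m < n \<Longrightarrow> x \<in> H m \<Longrightarrow> Q x" "subspace {x. Q x}"
  shows "Q x"
proof -
  have "below n \<subseteq> {x. Q x}"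
    unfolding below_def by (rule real_vector.span_minimal) (use assms(2,3) in auto)
  with assms(1) show ?thesis by auto
qed

lemma below_mono: "m \<le> n \<Longrightarrow> below m \<subseteq> below n"
  unfolding below_def by (rule real_vector.span_mono) fastforce

lemma below_0: "below 0 = {0}"
  by (simp add: below_def)

lemma below_finite_span: "\<exists>F. finite F \<and> below n \<subseteq> span F"
proof -
  have "\<forall>m. \<exists>B. finite B \<and> span B = H m" using finite_dimensional by blast
  then have "\<exists>B. \<forall>m. finite (B m) \<and> span (B m) = H m" by (rule choice)
  then obtain B where B: "\<forall>m. finite (B m) \<and> span (B m) = H m" by (rule exE)
  have "x \<in> span (\<Union>m<n. B m)" if "x \<in> H m" "m < n" for x m
    using B that real_vector.span_mono[of "B m" "\<Union>m<n. B m"] by blast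
  then have "below n \<subseteq> span (\<Union>m<n. B m)"
    unfolding below_def by (intro real_vector.span_minimal) auto
  with B show ?thesis by (intro exI[of _ "\<Union>m<n. B m"]) simp
qed

text \<open>A functional vanishing at 1 vanishes on \<open>H 0\<close>, so only first factors of
  positive degree contribute.\<close>

lemma lc_below:
  assumes "linear \<psi>" "\<psi> 1 = 0" "x \<in> below (Suc n)"
  shows "lc \<psi> x \<in> below n"
  using assms(3)
proof (induction rule: below_induct)
  case (H m x)
  show ?case
  proof (rule lc_in_subspace[OF assms(1) subspace_below H(2)])
    fix i a b assume ab: "i \<le> m" "a \<in> H i" "b \<in> H (m - i)"
    show "\<psi> a *\<^sub>R b \<in> below n"
    proof (cases "i = 0")
      case True
      then have "\<psi> a = \<psi> (\<epsilon> a *\<^sub>R 1)" using H0_eq[of a] ab(2) by simp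
      then show ?thesis using assms(2) subspace_below by (simp add: linear_scale[OF assms(1)] real_vector.subspace_0)
    next
      case False
      then show ?thesis using H_below[OF ab(3)] H(1) ab(1) by (intro subspace_scale subspace_below) simp
    qed
  qed
qed (rule subspace_vimage_linear[OF linear_lc[OF assms(1)] subspace_below])

text \<open>The coradical filtration, with \<open>corad 0 = {0}\<close> and \<open>corad 1 = span {1}\<close>.\<close>

primrec corad :: "nat \<Rightarrow> 'a set" where
  "corad 0 = {0}"
| "corad (Suc k) = {x. \<forall>\<psi>. linear \<psi> \<longrightarrow> \<psi> 1 = 0 \<longrightarrow> lc \<psi> x \<in> corad k}"

lemma subspace_corad: "subspace (corad k)"
proof (induction k)
  case (Suc k)
  have "corad (Suc k) = (\<Inter>\<psi>\<in>{\<psi>. linear \<psi> \<and> \<psi> 1 = 0}. {x. lc \<psi> x \<in> corad k})" by auto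
  then show ?case
    by (auto simp del: corad.simps intro!: real_vector.subspace_Inter subspace_vimage_linear linear_lc Suc)
qed (simp add: real_vector.subspace_single_0)

text \<open>Connectedness makes the coradical filtration exhaust \<open>H\<close>: contraction with
  a functional vanishing at 1 lowers the degree.\<close>

lemma below_corad: "below n \<subseteq> corad n"
proof (induction n)
  case (Suc n)
  then show ?case using lc_below by auto
qed (simp add: below_0)

lemma corad_1: "x \<in> corad (Suc 0) \<Longrightarrow> x = \<epsilon> x *\<^sub>R 1"
proof -
  assume x: "x \<in> corad (Suc 0)"
  have "\<psi> (x - \<epsilon> x *\<^sub>R 1) = 0" if l: "linear \<psi>" for \<psi> :: "'a \<Rightarrow> real"
  proof -
    \<comment> \<open>Subtracting a multiple of \<epsilon> makes an arbitrary functional vanish at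
      1, as membership in \<open>corad\<close> demands.\<close>
    let ?\<psi> = "\<lambda>y. \<psi> y - \<psi> 1 * \<epsilon> y"
    have l': "linear (\<lambda>y. \<psi> 1 * \<epsilon> y)"
      by (simp add: linear_iff linear_add[OF linear_counit] linear_scale[OF linear_counit] algebra_simps)
    have "lc ?\<psi> x = 0" using x linear_compose_sub[OF l l'] by (simp add: counit_one)
    then have "?\<psi> x = 0" using counit_lc[OF linear_compose_sub[OF l l'], of x] linear_0[OF linear_counit] by simp
    then show ?thesis by (simp add: linear_diff[OF l] linear_scale[OF l])
  qed
  then have "x - \<epsilon> x *\<^sub>R 1 = 0" by (rule functionals_separate)
  then show ?thesis by simp
qed

text \<open>Beyond the scalars, the next step of the filtration adds only primitive elements. All
  left contractions of \<Delta> y - 1 \<otimes> y - y \<otimes> 1 are 0 by \<open>corad_1\<close>,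
  which suffices in the tensor square.\<close>

lemma corad_2: "x \<in> corad (Suc (Suc 0)) \<Longrightarrow> x - \<epsilon> x *\<^sub>R 1 \<in> primitives \<Delta>"
proof -
  assume x: "x \<in> corad (Suc (Suc 0))"
  define y where "y = x - \<epsilon> x *\<^sub>R 1"
  let ?t = "\<Delta> y - (tens [1, y] + tens [y, 1])"
  have "?t = 0"
  proof (rule tens_pairs_eq_0)
    obtain ps where ps: "\<Delta> y = (\<Sum>(a, b)\<leftarrow>ps. tens [a, b])" by (rule comult_sum)
    have "(\<Sum>(a, b)\<leftarrow>ps. tens [a, b]) \<in> span {tens [a, b] | a b. True}"
      by (induction ps) (auto intro!: real_vector.span_add real_vector.span_zero intro: real_vector.span_base)
    then show "?t \<in> span {tens [a, b] | a b. True}"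
      unfolding ps by (intro real_vector.span_diff real_vector.span_add) (auto intro: real_vector.span_base)
    fix \<psi> :: "'a \<Rightarrow> real" assume l: "linear \<psi>"
    have g: "\<And>x. linear (\<lambda>b. \<psi> x *\<^sub>R b :: 'a)" "\<And>y. linear (\<lambda>x. \<psi> x *\<^sub>R y :: 'a)"
      by (simp_all add: linear_iff linear_add[OF l] linear_scale[OF l] algebra_simps)
    note lin = linear_tensor_lift2[of "\<lambda>a b. \<psi> a *\<^sub>R b", OF g]
    let ?\<psi> = "\<lambda>z. \<psi> z - \<psi> 1 * \<epsilon> z"
    have l': "linear (\<lambda>z. \<psi> 1 * \<epsilon> z)"
      by (simp add: linear_iff linear_add[OF linear_counit] linear_scale[OF linear_counit] algebra_simps)
    note l0 = linear_compose_sub[OF l l']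
    have one: "?\<psi> 1 = 0" by (simp add: counit_one)
    have \<epsilon>y: "\<epsilon> y = 0"
      by (simp add: y_def linear_diff[OF linear_counit] linear_scale[OF linear_counit] counit_one)
    have "lc ?\<psi> x \<in> corad (Suc 0)" using x l0 one by auto
    then have "lc ?\<psi> x = ?\<psi> x *\<^sub>R 1" using corad_1 counit_lc[OF l0, of x] by metis
    then have "lc ?\<psi> y = ?\<psi> y *\<^sub>R 1"
      using one unfolding y_def
      by (simp add: linear_diff[OF linear_lc[OF l0]] linear_scale[OF linear_lc[OF l0]] lc_one[OF l0]
          linear_diff[OF l] linear_scale[OF l] linear_diff[OF linear_counit] linear_scale[OF linear_counit] counit_one)
    then have "lc \<psi> y - \<psi> 1 *\<^sub>R y = \<psi> y *\<^sub>R 1"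
      by (simp add: lc_diff[OF l l'] lc_scale[OF linear_counit] lc_counit \<epsilon>y)
    moreover have "tensor_lift2 (\<lambda>x y. \<psi> x *\<^sub>R y) ?t = lc \<psi> y - (\<psi> 1 *\<^sub>R y + \<psi> y *\<^sub>R 1)"
      by (simp add: linear_diff[OF lin] linear_add[OF lin] tensor_lift2_tens[of "\<lambda>a b. \<psi> a *\<^sub>R b", OF g] lc_def)
    ultimately show "tensor_lift2 (\<lambda>x y. \<psi> x *\<^sub>R y) ?t = 0" by (simp add: algebra_simps)
  qed
  then show ?thesis by (simp add: primitives_def y_def)
qed

lemma cocommutative_lc_eq_rc:
  assumes "cocommutative \<Delta>" "linear \<psi>"
  shows "lc \<psi> x = rc \<psi> x"
proof -
  obtain ps where ps: "\<Delta> x = (\<Sum>(a, b)\<leftarrow>ps. tens [a, b])" by (rule comult_sum)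
  have "\<Delta> x = tensor_rev (\<Delta> x)" using assms(1) by (simp add: cocommutative_def)
  also have "\<dots> = (\<Sum>(a, b)\<leftarrow>map prod.swap ps. tens [a, b])"
    unfolding ps by (simp add: sum_list_linear[OF linear_tensor_rev] case_prod_unfold tensor_rev_tens o_def)
  finally have "rc \<psi> x = (\<Sum>(a, b)\<leftarrow>map prod.swap ps. \<psi> b *\<^sub>R a)" by (rule rc_sum[OF assms(2)])
  then show ?thesis by (simp add: lc_sum[OF assms(2) ps] case_prod_unfold o_def)
qed

text \<open>With left and right contractions equal, this is the commutation of the two sides, which
  coassociativity gives.\<close>

lemma cocommutative_lc_commute:
  "cocommutative \<Delta> \<Longrightarrow> linear \<psi> \<Longrightarrow> linear \<chi> \<Longrightarrow> lc \<psi> (lc \<chi> x) = lc \<chi> (lc \<psi> x)"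
  using lc_rc_commute[of \<psi> \<chi> x] cocommutative_lc_eq_rc by simp

lemma commutator_primitive:
  assumes "x \<in> primitives \<Delta>" "y \<in> primitives \<Delta>"
  shows "x * y - y * x \<in> primitives \<Delta>"
proof -
  have ps: "\<Delta> x = (\<Sum>(a, b)\<leftarrow>[(1, x), (x, 1)]. tens [a, b])" "\<Delta> y = (\<Sum>(a, b)\<leftarrow>[(1, y), (y, 1)]. tens [a, b])"
    using assms by (simp_all add: primitives_def)
  have diff: "tens [a - a', b] = tens [a, b] - tens [a', b]" "tens [b, a - a'] = tens [b, a] - tens [b, a']"
    for a a' b :: 'a
    using linear_diff[OF linear_tens[of "[]" "[b]"], of a a'] linear_diff[OF linear_tens[of "[b]" "[]"], of a a']
    by simp_all
  show ?thesis
    using comult_mult_sum[OF ps] comult_mult_sum[OF ps(2,1)]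
    by (simp add: primitives_def linear_diff[OF linear_comult] diff algebra_simps)
qed

end

section \<open>The Euler operator; words in primitive elements span\<close>

context primitive_basis
begin

text \<open>A functional that annihilates 1 and the primitive elements lowers the filtration by two.
  At the bottom x is a scalar plus a primitive element; above it, the induction uses that
  contractions commute.\<close>

lemma lc_corad_primitive_annihilator:
  assumes "cocommutative \<Delta>" "linear \<kappa>" "\<kappa> 1 = 0" "\<And>p. p \<in> primitives \<Delta> \<Longrightarrow> p \<in> below n \<Longrightarrow> \<kappa> p = 0"
  shows "x \<in> corad (Suc (Suc k)) \<Longrightarrow> x \<in> below n \<Longrightarrow> lc \<kappa> x \<in> corad k"
proof (induction k arbitrary: x)
  case 0
  have "lc \<kappa> x = 0"
  proof (cases n)
    case 0
    then show ?thesis using "0.prems"(2) by (simp add: below_0 linear_0[OF linear_lc[OF assms(2)]])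
  next
    case (Suc n')
    define p where "p = x - \<epsilon> x *\<^sub>R 1"
    have p: "p \<in> primitives \<Delta>" unfolding p_def by (rule corad_2[OF "0.prems"(1)])
    have "p \<in> below n"
      unfolding p_def using "0.prems"(2) H_below[OF one_H, of n] Suc
      by (intro real_vector.subspace_diff subspace_below subspace_scale) simp_all
    with p assms(4) have "\<kappa> p = 0" by blast
    then have "lc \<kappa> p = 0" using lc_primitive[OF assms(2) p] assms(3) by simp
    moreover have "x = p + \<epsilon> x *\<^sub>R 1" by (simp add: p_def)
    ultimately show ?thesis
      using linear_add[OF linear_lc[OF assms(2)], of p "\<epsilon> x *\<^sub>R 1"] assms(3)
      by (simp add: linear_scale[OF linear_lc[OF assms(2)]] lc_one[OF assms(2)])
  qed
  then show ?case by simp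
next
  case (Suc k)
  have "lc \<psi> (lc \<kappa> x) \<in> corad k" if \<psi>: "linear \<psi>" "\<psi> 1 = 0" for \<psi>
  proof -
    have "lc \<psi> x \<in> corad (Suc (Suc k))" using Suc.prems(1) \<psi> by simp
    moreover have "lc \<psi> x \<in> below n"
      using lc_below[OF \<psi>, of x n] Suc.prems(2) below_mono[of n "Suc n"] by auto
    ultimately have "lc \<kappa> (lc \<psi> x) \<in> corad k" by (rule Suc.IH)
    then show ?thesis using cocommutative_lc_commute[OF assms(1) assms(2) \<psi>(1)] by simp
  qed
  then show ?case by simp
qed

text \<open>Truncation below degree n sends each homogeneous basis element to itself or to
  0.\<close>

lemma primitives_below: "p \<in> primitives \<Delta> \<Longrightarrow> p \<in> below n \<Longrightarrow> p \<in> span (P \<inter> below n)"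
proof -
  assume p: "p \<in> primitives \<Delta>" "p \<in> below n"
  define \<pi> where "\<pi> x = (\<Sum>m<n. component H m x)" for x
  have lin: "linear \<pi>" unfolding \<pi>_def by (intro linear_compose_sum linear_component ballI)
  have \<pi>_H: "\<pi> x = (if m < n then x else 0)" if "x \<in> H m" for x m
    using that by (simp add: \<pi>_def component_H)
  have "\<pi> p = p" using p(2)
  proof (induction rule: below_induct)
    case subspace
    then show ?case by (auto simp: subspace_def linear_0[OF lin] linear_add[OF lin] linear_scale[OF lin])
  qed (simp add: \<pi>_H)
  moreover have "\<pi> p \<in> span (\<pi> ` P)"
    using p(1) linear_span_image[OF lin, of P] span_P by blast
  moreover have "\<pi> ` P \<subseteq> insert 0 (P \<inter> below n)"
    using \<pi>_H P_H_deg H_below by force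
  ultimately show ?thesis
    using real_vector.span_mono real_vector.span_insert_0 by (metis subsetD)
qed

lemma finite_P_below: "finite (P \<inter> below n)"
proof -
  obtain F where F: "finite F" "below n \<subseteq> span F" using below_finite_span by blast
  have "independent (P \<inter> below n)"
    using independent_P by (rule real_vector.independent_mono) simp
  from real_vector.independent_span_bound[OF F(1) this] F(2) show ?thesis by blast
qed

text \<open>On polynomials in \<open>P\<close> this would be Euler's operator, the sum of the q
  d/dq, which multiplies by the degree. The restriction to degrees below n makes the sum
  finite.\<close>

definition euler :: "nat \<Rightarrow> 'a \<Rightarrow> 'a" where
  "euler n x = (\<Sum>q\<in>P \<inter> below n. q * lc (\<chi> q) x)"

lemma linear_euler: "linear (euler n)"
  unfolding euler_def
  by (intro linear_compose_sum ballI linear_mult_left_fun linear_lc linear_\<chi>) simp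

text \<open>Commuting a contraction with \<open>euler\<close> produces, to leading order, the sum of
  \<psi>(q) times contraction with \<open>\<chi> q\<close>. By
  \<open>lc_corad_primitive_annihilator\<close> this differs from \<open>lc \<psi> x\<close> by an
  error of lower order, and the extra copy of \<open>lc \<psi> x\<close> turns k into k + 1.\<close>

lemma euler_corad:
  assumes cocomm: "cocommutative \<Delta>"
  shows "x \<in> corad (Suc k) \<Longrightarrow> x \<in> below n \<Longrightarrow> euler n x - real k *\<^sub>R x \<in> corad k"
proof (induction k arbitrary: x)
  case 0
  then have x: "x = \<epsilon> x *\<^sub>R 1" by (intro corad_1)
  have "euler n 1 = 0"
    by (simp add: euler_def lc_one linear_\<chi> \<chi>_one)
  then have "euler n (\<epsilon> x *\<^sub>R 1) = 0" by (simp add: linear_scale[OF linear_euler])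
  then show ?case using x by simp
next
  case (Suc k)
  let ?Pn = "P \<inter> below n"
  have fin: "finite ?Pn" by (rule finite_P_below)
  have "lc \<psi> (euler n x - real (Suc k) *\<^sub>R x) \<in> corad k" if \<psi>: "linear \<psi>" "\<psi> 1 = 0" for \<psi>
  proof -
    let ?\<psi> = "\<lambda>q y. \<psi> (q * y) - \<psi> q * \<epsilon> y"
    note lin = linear_lc[OF \<psi>(1)]
    \<comment> \<open>\<psi> minus the combination of the \<chi> that agrees with it on the
      primitive elements below degree n.\<close>
    define \<kappa> where "\<kappa> y = \<psi> y - (\<Sum>q\<in>?Pn. \<psi> q * \<chi> q y)" for y
    have l1: "linear (\<lambda>y. \<psi> q * \<chi> q y)" if "q \<in> ?Pn" for q
      using that linear_\<chi> by (auto simp: linear_iff algebra_simps)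
    have l2: "linear (\<lambda>y. \<Sum>q\<in>?Pn. \<psi> q * \<chi> q y)"
      by (intro linear_compose_sum ballI l1)
    have \<kappa>: "linear \<kappa>" "\<kappa> 1 = 0"
      unfolding \<kappa>_def[abs_def] using linear_compose_sub[OF \<psi>(1) l2] \<psi>(2) by (auto simp: \<chi>_one)
    have \<kappa>_lc: "lc \<kappa> x = lc \<psi> x - (\<Sum>q\<in>?Pn. \<psi> q *\<^sub>R lc (\<chi> q) x)"
    proof -
      have "lc (\<lambda>y. \<Sum>q\<in>?Pn. \<psi> q * \<chi> q y) x = (\<Sum>q\<in>?Pn. lc (\<lambda>y. \<psi> q * \<chi> q y) x)"
        by (rule lc_sum_functional[OF fin l1])
      also have "\<dots> = (\<Sum>q\<in>?Pn. \<psi> q *\<^sub>R lc (\<chi> q) x)"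
        by (intro sum.cong refl lc_scale linear_\<chi>) simp
      finally show ?thesis unfolding \<kappa>_def[abs_def] lc_diff[OF \<psi>(1) l2] by simp
    qed
    have \<kappa>_prim: "\<kappa> p = 0" if "p \<in> primitives \<Delta>" "p \<in> below n" for p
      using primitives_below[OF that]
    proof (induction rule: real_vector.span_induct)
      case base
      show ?case by (auto simp: subspace_def linear_0[OF \<kappa>(1)] linear_add[OF \<kappa>(1)] linear_scale[OF \<kappa>(1)])
    next
      case (step q')
      then have "(\<Sum>q\<in>?Pn. \<psi> q * \<chi> q q') = (\<Sum>q\<in>?Pn. if q = q' then \<psi> q else 0)"
        by (intro sum.cong refl) (auto simp: \<chi>_P)
      with step fin show ?case by (simp add: \<kappa>_def)
    qed
    have A: "euler n (lc \<psi> x) - real k *\<^sub>R lc \<psi> x \<in> corad k"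
      using Suc.prems \<psi> lc_below[OF \<psi>, of x n] below_mono[of n "Suc n"] by (intro Suc.IH) auto
    have B: "lc \<kappa> x \<in> corad k"
      by (rule lc_corad_primitive_annihilator[OF cocomm \<kappa> \<kappa>_prim Suc.prems])
    have C: "(\<Sum>q\<in>?Pn. lc (?\<psi> q) (lc (\<chi> q) x)) \<in> corad k"
    proof (intro subspace_sum subspace_corad)
      fix q assume q: "q \<in> ?Pn"
      have "lc (\<chi> q) x \<in> corad (Suc k)" using Suc.prems(1) q linear_\<chi> \<chi>_one by simp
      then show "lc (?\<psi> q) (lc (\<chi> q) x) \<in> corad k"
        using lc_mult_split(2,3)[OF \<psi>(1) P_primitive, of q] q by simp
    qed
    have "lc \<psi> (euler n x) = (\<Sum>q\<in>?Pn. \<psi> q *\<^sub>R lc (\<chi> q) x + lc (?\<psi> q) (lc (\<chi> q) x) + q * lc (\<chi> q) (lc \<psi> x))"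
      unfolding euler_def linear_sum[OF lin]
      by (intro sum.cong refl)
        (simp add: lc_mult_split(1)[OF \<psi>(1) P_primitive] cocommutative_lc_commute[OF cocomm \<psi>(1) linear_\<chi>])
    moreover have "lc \<psi> (euler n x - real (Suc k) *\<^sub>R x) = lc \<psi> (euler n x) - real (Suc k) *\<^sub>R lc \<psi> x"
      by (simp only: linear_diff[OF lin] linear_scale[OF lin])
    ultimately have "lc \<psi> (euler n x - real (Suc k) *\<^sub>R x) =
      (euler n (lc \<psi> x) - real k *\<^sub>R lc \<psi> x) + (\<Sum>q\<in>?Pn. lc (?\<psi> q) (lc (\<chi> q) x)) - lc \<kappa> x"
      by (simp add: sum.distrib \<kappa>_lc euler_def scaleR_add_left)
    also have "\<dots> \<in> corad k"
      by (intro real_vector.subspace_diff subspace_add subspace_corad A B C)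
    finally show ?thesis .
  qed
  then show ?case by simp
qed

lemma euler_below: "x \<in> below n \<Longrightarrow> euler n x \<in> below n" and lc_\<chi>_below: "x \<in> below n \<Longrightarrow> q \<in> P \<Longrightarrow> lc (\<chi> q) x \<in> below n"
proof -
  have hom: "lc (\<chi> q) x \<in> below n \<and> q * lc (\<chi> q) x \<in> below n" if q: "q \<in> P" and x: "x \<in> H m" "m < n" for q x m
  proof -
    note lc = lc_deg[OF \<chi>[OF q] x(1)]
    show ?thesis
    proof (cases "deg H q \<le> m")
      case True
      then have "lc (\<chi> q) x \<in> H (m - deg H q)" using lc by simp
      moreover from mult_graded[OF P_H_deg[OF q] this] True have "q * lc (\<chi> q) x \<in> H m" by simp
      ultimately show ?thesis using x(2) by (auto intro: H_below)
    next
      case False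
      then show ?thesis using lc real_vector.subspace_0[OF subspace_below] by simp
    qed
  qed
  show "lc (\<chi> q) x \<in> below n" if "x \<in> below n" "q \<in> P" for x q
    using that(1)
  proof (induction rule: below_induct)
    case (H m x)
    then show ?case using hom[OF that(2) H(2,1)] by blast
  qed (rule subspace_vimage_linear[OF linear_lc[OF linear_\<chi>[OF that(2)]] subspace_below])
  show "euler n x \<in> below n" if "x \<in> below n" for x
    using that
  proof (induction rule: below_induct)
    case (H m x)
    then show ?case using hom[OF _ H(2,1)] by (auto simp: euler_def intro!: subspace_sum subspace_below)
  qed (rule subspace_vimage_linear[OF linear_euler subspace_below])
qed

text \<open>\<open>euler n x\<close> is a sum of products of a q with elements one step down, and it
  differs from k x by a lower term; dividing by k expresses x through words. For k = 0, x is a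
  scalar.\<close>

lemma corad_words:
  assumes cocomm: "cocommutative \<Delta>"
  shows "x \<in> corad k \<Longrightarrow> x \<in> below n \<Longrightarrow> x \<in> words k"
proof (induction k arbitrary: x)
  case 0
  then show ?case by (simp add: words_0)
next
  case (Suc k)
  show ?case
  proof (cases "k = 0")
    case True
    then have "x = \<epsilon> x *\<^sub>R 1" using Suc.prems corad_1 by simp
    moreover have "(1 :: 'a) \<in> words (Suc k)" using prod_list_words[of "[]" "Suc k"] by simp
    ultimately show ?thesis using subspace_scale[OF subspace_words] by metis
  next
    case False
    have 1: "euler n x - real k *\<^sub>R x \<in> words (Suc k)"
    proof -
      have "euler n x - real k *\<^sub>R x \<in> below n"
        using Suc.prems(2) euler_below by (intro real_vector.subspace_diff subspace_below subspace_scale) auto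
      from Suc.IH[OF euler_corad[OF cocomm Suc.prems] this] show ?thesis
        using words_mono[of k "Suc k"] by auto
    qed
    have 2: "euler n x \<in> words (Suc k)"
      unfolding euler_def
    proof (intro subspace_sum subspace_words mult_words)
      fix q assume q: "q \<in> P \<inter> below n"
      then show "q \<in> primitives \<Delta>" using P_primitive by blast
      show "lc (\<chi> q) x \<in> words k"
        using q Suc.prems linear_\<chi> \<chi>_one lc_\<chi>_below by (intro Suc.IH) auto
    qed
    have "x = (1 / real k) *\<^sub>R (euler n x - (euler n x - real k *\<^sub>R x))" using False by simp
    also have "\<dots> \<in> words (Suc k)"
      by (intro subspace_scale real_vector.subspace_diff subspace_words 1 2)
    finally show ?thesis .
  qed
qed

text \<open>The commutator of two primitive elements is primitive, so exchanging adjacent letters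
  costs only words with one letter less.\<close>

lemma commute_prefix_words:
  assumes "a \<in> P"
  shows "set u \<subseteq> P \<Longrightarrow> set v \<subseteq> P \<Longrightarrow> (a * prod_list u - prod_list u * a) * prod_list v \<in> words (Suc (length u + length v))"
proof (induction u)
  case Nil
  show ?case using real_vector.subspace_0[OF subspace_words] by simp
next
  case (Cons b u)
  have "prod_list u * prod_list v \<in> words (Suc (length u + length v))"
    using prod_list_words[of "u @ v" "Suc (length u + length v)"] Cons.prems by simp
  then have 1: "(a * b - b * a) * (prod_list u * prod_list v) \<in> words (Suc (Suc (length u + length v)))"
    by (rule mult_words[OF commutator_primitive[OF P_primitive[OF assms] P_primitive], rotated])
      (use Cons.prems in simp)
  have 2: "b * ((a * prod_list u - prod_list u * a) * prod_list v) \<in> words (Suc (Suc (length u + length v)))"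
    by (rule mult_words[OF P_primitive]) (use Cons in auto)
  from subspace_add[OF subspace_words 1 2] show ?case by (simp add: algebra_simps)
qed

lemma prod_list_perm_words:
  "mset l = mset l' \<Longrightarrow> set l \<subseteq> P \<Longrightarrow> prod_list l - prod_list l' \<in> words (length l)"
proof (induction l arbitrary: l')
  case Nil
  then show ?case by (simp add: words_0)
next
  case (Cons a l)
  from Cons.prems(1) have "a \<in> set l'" by (metis list.set_intros(1) set_mset_mset)
  then obtain u v where l': "l' = u @ a # v" by (meson split_list)
  with Cons.prems(1) have m: "mset l = mset (u @ v)" by simp
  then have uv: "length l = length u + length v" "set u \<union> set v = set l"
    using mset_eq_length[OF m] mset_eq_setD[OF m] by auto
  have a: "a \<in> P" using Cons.prems by simp
  have "prod_list l - prod_list (u @ v) \<in> words (length l)"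
    using Cons.prems by (intro Cons.IH m) auto
  then have 1: "a * (prod_list l - prod_list (u @ v)) \<in> words (Suc (length l))"
    by (rule mult_words[OF P_primitive[OF a]])
  have 2: "(a * prod_list u - prod_list u * a) * prod_list v \<in> words (Suc (length l))"
    unfolding uv(1) using Cons.prems uv(2) by (intro commute_prefix_words a) auto
  from subspace_add[OF subspace_words 1 2] show ?case by (simp add: l' algebra_simps)
qed

text \<open>Modulo shorter words a product equals each of its rearrangements, hence their average,
  which is a multiple of \<open>msym\<close>.\<close>

lemma words_span_msym: "words k \<subseteq> span (msym ` {Q. set_mset Q \<subseteq> P})"
proof (induction k)
  case 0
  then show ?case by (simp add: words_0 real_vector.span_zero)
next
  case (Suc k)
  let ?Z = "span (msym ` {Q. set_mset Q \<subseteq> P})"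
  have "prod_list l \<in> ?Z" if l: "set l \<subseteq> P" "length l < Suc k" for l
  proof (cases "length l < k")
    case True
    then show ?thesis using Suc prod_list_words[OF l(1)] by blast
  next
    case False
    with l(2) have k: "length l = k" by simp
    let ?L = "permutations_of_multiset (mset l)"
    have "(\<Sum>l'\<in>?L. prod_list l - prod_list l') \<in> words k"
      unfolding k[symmetric] using l(1)
      by (intro subspace_sum subspace_words prod_list_perm_words) (auto dest: permutations_of_multisetD)
    then have "(\<Sum>l'\<in>?L. prod_list l - prod_list l') \<in> ?Z" using Suc by blast
    moreover have "msym (mset l) \<in> ?Z"
      using l(1) by (intro real_vector.span_base imageI) auto
    ultimately have "(\<Sum>l'\<in>?L. prod_list l - prod_list l') + msym (mset l) \<in> ?Z"
      by (rule real_vector.span_add)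
    also have "(\<Sum>l'\<in>?L. prod_list l - prod_list l') + msym (mset l) = real (card ?L) *\<^sub>R prod_list l"
      by (simp add: msym_def sum_subtractf sum_constant_scaleR del: sum_constant)
    finally have "(1 / real (card ?L)) *\<^sub>R real (card ?L) *\<^sub>R prod_list l \<in> ?Z"
      by (rule real_vector.span_scale)
    moreover have "card ?L \<noteq> 0" by (simp add: card_eq_0_iff)
    ultimately show ?thesis by simp
  qed
  then show ?case
    unfolding words_def by (intro real_vector.span_minimal) auto
qed

section \<open>The eigenbasis in the cocommutative case\<close>

lemma msym_P_graded: "set_mset Q \<subseteq> P \<Longrightarrow> msym Q \<in> H (\<Sum>q\<in>#Q. deg H q)"
  by (rule msym_graded) (use P_H_deg in auto)

text \<open>Symmetrised products of elements of \<open>P\<close> are homogeneous, so projecting to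
  degree n retains those of total degree n and sends the others to 0.\<close>

lemma cocommutative_H_span_msym:
  assumes "cocommutative \<Delta>"
  shows "H n \<subseteq> span (msym ` {Q. set_mset Q \<subseteq> P \<and> (\<Sum>q\<in>#Q. deg H q) = n})"
proof
  fix x assume x: "x \<in> H n"
  have xb: "x \<in> below (Suc n)" using x by (rule H_below) simp
  have "x \<in> words (Suc n)"
    using corad_words[OF assms _ xb] below_corad xb by blast
  then have "x \<in> span (msym ` {Q. set_mset Q \<subseteq> P})" using words_span_msym by blast
  then have "component H n x \<in> span (component H n ` msym ` {Q. set_mset Q \<subseteq> P})"
    using linear_span_image[OF linear_component] by blast
  moreover
  have "component H n ` msym ` {Q. set_mset Q \<subseteq> P} \<subseteq>
      insert 0 (msym ` {Q. set_mset Q \<subseteq> P \<and> (\<Sum>q\<in>#Q. deg H q) = n})"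
    using component_H[OF msym_P_graded, of _ n] by auto
  from real_vector.span_mono[OF this]
  have "span (component H n ` msym ` {Q. set_mset Q \<subseteq> P}) \<subseteq>
      span (msym ` {Q. set_mset Q \<subseteq> P \<and> (\<Sum>q\<in>#Q. deg H q) = n})"
    by (simp only: real_vector.span_insert_0)
  ultimately have "component H n x \<in> span (msym ` {Q. set_mset Q \<subseteq> P \<and> (\<Sum>q\<in>#Q. deg H q) = n})"
    by (rule rev_subsetD)
  then show "x \<in> span (msym ` {Q. set_mset Q \<subseteq> P \<and> (\<Sum>q\<in>#Q. deg H q) = n})"
    using component_H[OF x, of n] by simp
qed

lemma mset_index_subset: "(C, Q) \<in> mset_index H P n j \<Longrightarrow> set_mset C \<subseteq> P \<inter> H 1 \<and> set_mset Q \<subseteq> P - H 1"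
  by (auto simp: mset_index_def)

text \<open>A contraction of degree 1 annihilates primitive basis elements of other degrees and,
  being a derivation, their symmetrised products; so \<open>msym Q\<close> may serve as the middle
  factor p.\<close>

lemma \<E>_eigenvector:
  assumes "1 \<le> r" "2 * r \<le> n" "v \<in> \<E> H P r n j"
  shows "eigenvector_on (H n) (TaBr2R H \<Delta> r n) (\<beta> r n j) v"
proof -
  obtain B \<phi> where "H1_dual_basis H \<Delta> \<epsilon> S B \<phi>" using H1_dual_basis_exists by blast
  then interpret H1_dual_basis H \<Delta> \<epsilon> S B \<phi> .
  obtain C Q where CQ: "(C, Q) \<in> mset_index H P n j" "v = eigvec_mset r (C, Q)"
    using assms(3) by (auto simp: \<E>_def)
  obtain cs where cs: "mset cs = C" using ex_mset by blast
  obtain ps where ps: "mset ps = Q" using ex_mset by blast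
  obtain N :: nat where "0 < N" "sym_prod ps = real N *\<^sub>R msym (mset ps)"
    by (rule eigvec_msand[of ps]) (rule that)
  then have N: "sym_prod ps = real N *\<^sub>R msym Q" by (simp add: ps)
  have Q: "set_mset Q \<subseteq> P - H 1" and C: "set_mset C \<subseteq> H 1" "size C = j" and n: "(\<Sum>q\<in>#Q. deg H q) + j = n"
    using CQ(1) by (auto simp: mset_index_def)
  have zero: "lc (\<phi> a) x = 0 *\<^sub>R 1" "rc (\<phi> a) x = 0 *\<^sub>R 1" if "x \<in># Q" for a x
  proof -
    have x: "x \<in> P" "deg H x \<noteq> 1" using that Q P_H_deg[of x] by auto
    have "\<phi> a x = 0" using \<phi>_off[OF P_H_deg[OF x(1)] x(2)] .
    moreover have "\<phi> a 1 = 0" using \<phi>_off[OF one_H] by simp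
    ultimately show "lc (\<phi> a) x = 0 *\<^sub>R 1" "rc (\<phi> a) x = 0 *\<^sub>R 1"
      using lc_primitive[OF linear_\<phi> P_primitive[OF x(1)]] rc_primitive[OF linear_\<phi> P_primitive[OF x(1)]] by auto
  qed
  have DQ: "lc (\<phi> a) (msym Q) = 0" "rc (\<phi> a) (msym Q) = 0" for a
    using derivation_msym[OF linear_D D_mult zero(1)] derivation_msym[OF linear_D' D'_mult zero(2)] by simp_all
  have "eigenvector_on (H n) (TaBr2R H \<Delta> r n) (\<beta> r n (length cs)) (eigvec r cs (sym_prod ps))"
  proof (rule eigvec_eigenvector[OF assms(1,2)])
    show "sym_prod ps \<in> H (\<Sum>q\<in>#Q. deg H q)"
      unfolding N using Q by (intro subspace_scale subspace_H msym_P_graded) auto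
    show "lc (\<phi> a) (sym_prod ps) = 0" "rc (\<phi> a) (sym_prod ps) = 0" for a
      by (simp_all add: N DQ linear_scale[OF linear_D] linear_scale[OF linear_D'])
    show "set cs \<subseteq> H 1" "length cs + (\<Sum>q\<in>#Q. deg H q) = n"
      using C n by (auto simp: cs[symmetric])
  qed
  then show ?thesis
    using C(2) by (simp add: CQ(2) eigvec_mset_eq flip: cs ps)
qed

text \<open>A count of dimensions: the eigenvectors are independent, and there are at least as many
  as spanning products \<open>msym R\<close>, since R is determined by its letters of degree 1 and
  the remaining ones.\<close>

lemma cocommutative_eigenbasis:
  assumes "cocommutative \<Delta>" "1 \<le> r" "2 * r \<le> n"
  shows "span (\<Union>j\<in>{0..n - 2} \<union> {n}. \<E> H P r n j) = H n"
proof -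
  define J where "J = (\<Union>j\<in>{0..n - 2} \<union> {n}. mset_index H P n j)"
  let ?Idx = "{Q. set_mset Q \<subseteq> P \<and> (\<Sum>q\<in>#Q. deg H q) = n}"
  let ?f = "eigvec_mset r" and ?g = "\<lambda>R. (filter_mset (\<lambda>q. q \<in> H 1) R, filter_mset (\<lambda>q. q \<notin> H 1) R)"
  obtain F where F: "finite F" "span F = H n" using finite_dimensional by blast
  have EJ: "(\<Union>j\<in>{0..n - 2} \<union> {n}. \<E> H P r n j) = ?f ` J"
    unfolding J_def \<E>_def by (rule image_UN[symmetric])
  have fam: "independent_family ?f J"
    unfolding J_def by (rule independent_family_eigvec_mset) (use mset_index_subset in blast)
  then have inj: "inj_on ?f J" and ind: "independent (?f ` J)" by (auto simp: independent_family_def)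
  have sub: "?f ` J \<subseteq> H n"
    using \<E>_eigenvector[OF assms(2,3)] unfolding EJ[symmetric] by (auto simp: eigenvector_on_def)
  \<comment> \<open>Finiteness of the index set comes from independence in a finite-dimensional
    space.\<close>
  have "finite (?f ` J)"
    using real_vector.independent_span_bound[OF F(1) ind] sub F(2) by blast
  then have finJ: "finite J" using inj by (rule finite_imageD)
  have g_inj: "inj_on ?g ?Idx"
    by (rule inj_onI) (metis Pair_inject multiset_partition)
  have "?g R \<in> J" if R: "R \<in> ?Idx" for R
  proof -
    let ?A = "filter_mset (\<lambda>q. q \<in> H 1) R" and ?B = "filter_mset (\<lambda>q. q \<notin> H 1) R"
    have deg1: "deg H q = 1" if "q \<in># ?A" for q
      using that R deg_eq P_nonzero by auto
    have deg2: "2 \<le> deg H q" if "q \<in># ?B" for q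
      using that R P_H_deg[of q] deg_P_pos[of q] by (cases "deg H q = 1") (auto simp del: One_nat_def)
    have "(\<Sum>q\<in>#?A. deg H q) = (\<Sum>q\<in>#?A. 1)" using deg1 by (intro arg_cong[of _ _ sum_mset] image_mset_cong)
    then have szA: "(\<Sum>q\<in>#?A. deg H q) = size ?A" by simp
    have total: "(\<Sum>q\<in>#?B. deg H q) + size ?A = n"
    proof -
      have "n = (\<Sum>q\<in>#?A + ?B. deg H q)" using R by (simp flip: multiset_partition)
      also have "\<dots> = size ?A + (\<Sum>q\<in>#?B. deg H q)"
        by (simp only: image_mset_union sum_mset.union szA)
      finally show ?thesis by (simp only: add.commute)
    qed
    \<comment> \<open>The letters outside \<open>H 1\<close> have degree at least 2, so j = n - 1
      does not occur.\<close>
    have "(\<Sum>q\<in>#?B. deg H q) \<noteq> 1"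
    proof (cases "?B = {#}")
      case False
      then obtain q B' where qB: "?B = add_mset q B'" by (meson multiset_cases)
      then have "2 \<le> deg H q" using deg2[of q] by simp
      then show ?thesis by (simp add: qB del: One_nat_def)
    next
      case True
      show ?thesis unfolding True by simp
    qed
    then have "size ?A \<le> n - 2 \<or> size ?A = n" using total by linarith
    then have "size ?A \<in> {0..n - 2} \<union> {n}"
      by (simp only: Un_iff singleton_iff atLeastAtMost_iff le0 simp_thms)
    moreover have "?g R \<in> mset_index H P n (size ?A)"
      using R total by (auto simp: mset_index_def)
    ultimately show ?thesis unfolding J_def by blast
  qed
  then have g: "?g ` ?Idx \<subseteq> J" by blast
  then have finIdx: "finite ?Idx" using finJ g_inj by (meson finite_imageD finite_subset)
  have "dim (H n) \<le> card (msym ` ?Idx)"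
    using cocommutative_H_span_msym[OF assms(1)] finIdx by (intro real_vector.dim_le_card) auto
  also have "\<dots> \<le> card ?Idx" using finIdx by (rule card_image_le)
  also have "\<dots> = card (?g ` ?Idx)" using g_inj by (rule card_image[symmetric])
  also have "\<dots> \<le> card J" using finJ g by (rule card_mono)
  also have "\<dots> = card (?f ` J)" using inj by (rule card_image[symmetric])
  finally have "dim (H n) \<le> card (?f ` J)" .
  then show ?thesis
    unfolding EJ using F by (intro independent_card_ge_dim_spans[OF ind sub subspace_H]) auto
qed

end

theorem theorem4p6:
  fixes H :: "nat \<Rightarrow> 'a::real_algebra_1 set"
    and \<Delta> :: "'a \<Rightarrow> 'a tensor"
    and \<epsilon> :: "'a \<Rightarrow> real"
    and S :: "'a \<Rightarrow> 'a"
    and r n :: nat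
  assumes "graded_connected_hopf_algebra H \<Delta> \<epsilon> S"
    and "1 \<le> r" and "2 * r \<le> n"
  shows "(inj_on (\<beta> r n) (eigen_index r n) \<and>
      eigenvalues_on (H n) (TaBr2R H \<Delta> r n) =
        {of_real (\<beta> r n j) | j. j \<in> eigen_index r n \<and> eigen_mult H r n j \<noteq> 0} \<and>
      (\<forall>j\<in>eigen_index r n.
        real (multiplicity_on (H n) (TaBr2R H \<Delta> r n) (\<beta> r n j)) = eigen_mult H r n j))
    \<and>
    (\<forall>j\<le>n. \<forall>p\<in>H (n - j). \<forall>cs.
      comult_wc H \<Delta> [1, n - j - 1] p = 0 \<and> comult_wc H \<Delta> [n - j - 1, 1] p = 0 \<and>
      length cs = j \<and> set cs \<subseteq> H 1 \<longrightarrow>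
        (j < 2 * r \<longrightarrow>
          eigenvector_on (H n) (TaBr2R H \<Delta> r n) 0 (sym_prod cs * p)) \<and>
        (2 * r \<le> j \<longrightarrow>
          eigenvector_on (H n) (TaBr2R H \<Delta> r n) (\<beta> r n j) (sym_sandwich r cs p)))
    \<and>
    (\<forall>P. graded_basis H (primitives \<Delta>) P \<longrightarrow>
      independent_family (eigvec_mset r) (\<Union>j<2 * r. mset_index H P n j) \<and>
      (\<forall>v\<in>(\<Union>j<2 * r. \<E> H P r n j). eigenvector_on (H n) (TaBr2R H \<Delta> r n) 0 v) \<and>
      (\<forall>j>2 * r.
        independent_family (eigvec_mset r) (mset_index H P n j) \<and>
        (\<forall>v\<in>\<E> H P r n j. eigenvector_on (H n) (TaBr2R H \<Delta> r n) (\<beta> r n j) v)))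
    \<and>
    (cocommutative \<Delta> \<longrightarrow> (\<forall>P. graded_basis H (primitives \<Delta>) P \<longrightarrow>
      independent_family (eigvec_mset r) (\<Union>j\<in>{0..n - 2} \<union> {n}. mset_index H P n j) \<and>
      span (\<Union>j\<in>{0..n - 2} \<union> {n}. \<E> H P r n j) = H n \<and>
      (\<forall>v\<in>(\<Union>j\<in>{0..n - 2} \<union> {n}. \<E> H P r n j).
        \<exists>l. eigenvector_on (H n) (TaBr2R H \<Delta> r n) l v)))"
proof -
  interpret graded_connected_hopf_algebra H \<Delta> \<epsilon> S by fact
  obtain C \<phi> where "H1_dual_basis H \<Delta> \<epsilon> S C \<phi>" using H1_dual_basis_exists by blast
  then interpret H1_dual_basis H \<Delta> \<epsilon> S C \<phi> .
  have r: "1 \<le> r" "2 * r \<le> n" by fact+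
  have \<beta>_0: "\<beta> r n j = 0" if "j < 2 * r" for j
    using that by (simp add: \<beta>_eq_0_iff[OF r(2)])
  \<comment> \<open>Both cases of (ii) at once, since \<open>eigvec\<close> distinguishes them by
    the number of letters.\<close>
  have part_ii: "eigenvector_on (H n) (TaBr2R H \<Delta> r n) (\<beta> r n j) (eigvec r cs p)"
    if "j \<le> n" "p \<in> H (n - j)" "comult_wc H \<Delta> [1, n - j - 1] p = 0"
      "comult_wc H \<Delta> [n - j - 1, 1] p = 0" "length cs = j" "set cs \<subseteq> H 1" for j p cs
    using that eigvec_eigenvector[OF r that(2) _ _ that(6)] comult_wc_D_eq_0[OF that(2)] by auto
  \<comment> \<open>Independence for every set J of indices; the families in (iii) and (iv) are
    instances.\<close>
  have part_iii: "independent_family (eigvec_mset r) (\<Union>j\<in>J. mset_index H P n j)"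
    if "graded_basis H (primitives \<Delta>) P" for P J
  proof -
    interpret primitive_basis H \<Delta> \<epsilon> S P by unfold_locales fact
    show ?thesis by (rule independent_family_eigvec_mset) (use mset_index_subset in blast)
  qed
  have eigenvectors: "eigenvector_on (H n) (TaBr2R H \<Delta> r n) (\<beta> r n j) v"
    if "graded_basis H (primitives \<Delta>) P" "v \<in> \<E> H P r n j" for P j v
  proof -
    interpret primitive_basis H \<Delta> \<epsilon> S P by unfold_locales fact
    show ?thesis by (rule \<E>_eigenvector[OF r that(2)])
  qed
  have part_iv: "span (\<Union>j\<in>{0..n - 2} \<union> {n}. \<E> H P r n j) = H n"
    if "cocommutative \<Delta>" "graded_basis H (primitives \<Delta>) P" for P
  proof -
    interpret primitive_basis H \<Delta> \<epsilon> S P by unfold_locales fact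
    show ?thesis by (rule cocommutative_eigenbasis[OF that(1) r])
  qed
  show ?thesis
  proof (intro conjI allI ballI impI; (elim conjE)?)
    show "inj_on (\<beta> r n) (eigen_index r n)" by (rule inj_on_\<beta>[OF r])
    show "eigenvalues_on (H n) (TaBr2R H \<Delta> r n) =
        {of_real (\<beta> r n j) | j. j \<in> eigen_index r n \<and> eigen_mult H r n j \<noteq> 0}"
      by (rule eigenvalues_TaBr2R[OF r])
    show "real (multiplicity_on (H n) (TaBr2R H \<Delta> r n) (\<beta> r n j)) = eigen_mult H r n j"
      if "j \<in> eigen_index r n" for j
      by (rule multiplicity_TaBr2R[OF r that])
  next
    fix j p cs
    assume *: "j \<le> n" "p \<in> H (n - j)" "comult_wc H \<Delta> [1, n - j - 1] p = 0"
      "comult_wc H \<Delta> [n - j - 1, 1] p = 0" "length cs = j" "set cs \<subseteq> H 1"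
    show "eigenvector_on (H n) (TaBr2R H \<Delta> r n) 0 (sym_prod cs * p)" if "j < 2 * r"
      using part_ii[OF *] that *(5) by (simp add: eigvec_def \<beta>_0)
    show "eigenvector_on (H n) (TaBr2R H \<Delta> r n) (\<beta> r n j) (sym_sandwich r cs p)" if "2 * r \<le> j"
      using part_ii[OF *] that *(5) by (simp add: eigvec_def)
  next
    fix P assume P: "graded_basis H (primitives \<Delta>) P"
    show "independent_family (eigvec_mset r) (\<Union>j<2 * r. mset_index H P n j)"
      by (rule part_iii[OF P])
    show "eigenvector_on (H n) (TaBr2R H \<Delta> r n) 0 v" if "v \<in> (\<Union>j<2 * r. \<E> H P r n j)" for v
      using that eigenvectors[OF P] \<beta>_0 by fastforce
    show "independent_family (eigvec_mset r) (mset_index H P n j)" for j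
      using part_iii[OF P, of "{j}"] by simp
    show "eigenvector_on (H n) (TaBr2R H \<Delta> r n) (\<beta> r n j) v" if "v \<in> \<E> H P r n j" for j v
      by (rule eigenvectors[OF P that])
  next
    fix P assume co: "cocommutative \<Delta>" and P: "graded_basis H (primitives \<Delta>) P"
    show "independent_family (eigvec_mset r) (\<Union>j\<in>{0..n - 2} \<union> {n}. mset_index H P n j)"
      by (rule part_iii[OF P])
    show "span (\<Union>j\<in>{0..n - 2} \<union> {n}. \<E> H P r n j) = H n"
      by (rule part_iv[OF co P])
    show "\<exists>l. eigenvector_on (H n) (TaBr2R H \<Delta> r n) l v"
      if "v \<in> (\<Union>j\<in>{0..n - 2} \<union> {n}. \<E> H P r n j)" for v
      using that eigenvectors[OF P] by blast
  qed
qed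

end
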